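(* Let $g:\mathbb R^n\to\mathbb R$ be positive, bounded and Lipschitz continuous. Then viscosity solutions to $$\begin{cases}\partial_t u+F\big((x,t),u,Du,D^2u\big)=0 & \text{in }\mathbb R^n\times(0,T),\\ u(x,T)=g(x) & \text{on }\mathbb R^n,\end{cases}$$ where $F\big((x,t),\xi,\nu,M\big)=\big(p(x,t)-2\big)\frac{\langle M\nu,\nu\rangle}{|\nu|^2}+\operatorname{trace}(M)+\langle\mu,\nu\rangle-r\xi$ for $\nu\ne0$, are unique in the class of functions satisfying a linear growth bound: if $u$ and $v$ are viscosity solutions, each satisfying a bound of the form $|u(x,t)|\le c(1+|x|)$ for all $(x,t)\in\mathbb R^n\times[0,T]$ with some $c<\infty$ independent of $(x,t)$, then $u=v$ on $\mathbb R^n\times[0,T]$.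
   Context: $n\ge 2$, $T>0$, $\mu\in\mathbb R^n$, $r\ge 0$; $p:\mathbb R^n\times[0,T]\to\mathbb R$ is Lipschitz continuous with values in a compact interval $[p_{\min},p_{\max}]$, $1<p_{\min}\le p_{\max}<\infty$. $S(n)$ is the set of symmetric $n\times n$ matrices; $D$, $D^2$ denote gradient and Hessian in $x$. For all $(x,t)\in\mathbb R^n\times[0,T]$, $\xi\in\mathbb R$, $\nu\in\mathbb R^n$, $M\in S(n)$ let $F_*((x,t),\xi,\nu,M)=\liminf_{\tilde\nu\to\nu,\ \tilde\nu\ne0}F((x,t),\xi,\tilde\nu,M)$ and $F^*=-(-F)_*$. A function $u:\mathbb R^n\times[0,T]\to\mathbb R$ has linear growth if there is $c<\infty$ with $|u(x,t)|\le c(1+|x|)$ for all $(x,t)$. A lower semicontinuous $u:\mathbb R^n\times[0,T]\to\mathbb R$ is a viscosity supersolution if it has linear growth, $u(x,T)\ge g(x)$ for all $x$, and for all $(x_0,t_0)\in\mathbb R^n\times(0,T)$ and $\phi\in C^{2,1}(\mathbb R^n\times(0,T))$ with $u(x_0,t_0)=\phi(x_0,t_0)$ and $u>\phi$ at all other points, it holds $\partial_t\phi(x_0,t_0)+F((x_0,t_0),\phi(x_0,t_0),D\phi(x_0,t_0),D^2\phi(x_0,t_0))\le0$ if $D\phi(x_0,t_0)\ne0$, and $\partial_t\phi(x_0,t_0)+F_*((x_0,t_0),\phi(x_0,t_0),0,D^2\phi(x_0,t_0))\le0$ if $D\phi(x_0,t_0)=0$. An upper semicontinuous $u$ is a viscosity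 subsolution if it has linear growth, $u(x,T)\le g(x)$ for all $x$, and for all such $(x_0,t_0)$ and $\phi$ with $u(x_0,t_0)=\phi(x_0,t_0)$ and $u<\phi$ at all other points, the same holds with $\ge0$ in place of $\le0$ and $F^*$ in place of $F_*$. A viscosity solution is a function that is both. *)

theory Defs
  imports "HOL-Analysis.Analysis"
begin

text \<open>A space-time point \<open>(x, t)\<close> has type \<open>(real^'n) \<times> real\<close>. Functions on
  \<open>\<real>\<^sup>n \<times> [0,T]\<close> are total functions; their values off that set are never used.\<close>

abbreviation closed_cyl :: "real \<Rightarrow> ((real^'n) \<times> real) set" where
  "closed_cyl T \<equiv> UNIV \<times> {0..T}"

abbreviation open_cyl :: "real \<Rightarrow> ((real^'n) \<times> real) set" where
  "open_cyl T \<equiv> UNIV \<times> {0<..<T}"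

definition gradient :: "(real^'n \<Rightarrow> real) \<Rightarrow> real^'n \<Rightarrow> real^'n" where
  "gradient f x = (\<chi> i. frechet_derivative f (at x) (axis i 1))"

definition hessian :: "(real^'n \<Rightarrow> real) \<Rightarrow> real^'n \<Rightarrow> real^'n^'n" where
  "hessian f x = matrix (frechet_derivative (gradient f) (at x))"

definition dt :: "((real^'n) \<times> real \<Rightarrow> real) \<Rightarrow> (real^'n) \<times> real \<Rightarrow> real" where
  "dt \<phi> z = deriv (\<lambda>s. \<phi> (fst z, s)) (snd z)"

definition Dx :: "((real^'n) \<times> real \<Rightarrow> real) \<Rightarrow> (real^'n) \<times> real \<Rightarrow> real^'n" where
  "Dx \<phi> z = gradient (\<lambda>y. \<phi> (y, snd z)) (fst z)"

definition Dxx :: "((real^'n) \<times> real \<Rightarrow> real) \<Rightarrow> (real^'n) \<times> real \<Rightarrow> real^'n^'n" where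
  "Dxx \<phi> z = hessian (\<lambda>y. \<phi> (y, snd z)) (fst z)"

text \<open>The class \<open>C\<^sup>2\<^sup>,\<^sup>1\<close>: \<open>\<phi>\<close>, its time derivative, its spatial gradient and its spatial
  Hessian exist and are jointly continuous. The set is meant to be open. The three
  differentiability conjuncts are needed because \<open>deriv\<close> and \<open>frechet_derivative\<close> are
  total operators.\<close>

definition C21_on :: "((real^'n) \<times> real) set \<Rightarrow> ((real^'n) \<times> real \<Rightarrow> real) \<Rightarrow> bool" where
  "C21_on S \<phi> \<longleftrightarrow>
     (\<forall>(x, t) \<in> S. (\<lambda>s. \<phi> (x, s)) differentiable (at t)
                 \<and> (\<lambda>y. \<phi> (y, t)) differentiable (at x)
                 \<and> (\<lambda>y. Dx \<phi> (y, t)) differentiable (at x))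
     \<and> continuous_on S \<phi> \<and> continuous_on S (dt \<phi>)
     \<and> continuous_on S (Dx \<phi>) \<and> continuous_on S (Dxx \<phi>)"

definition lsc_on :: "'a::topological_space set \<Rightarrow> ('a \<Rightarrow> real) \<Rightarrow> bool" where
  "lsc_on S u \<longleftrightarrow> (\<forall>z\<in>S. \<forall>a < u z. \<forall>\<^sub>F w in at z within S. a < u w)"

definition usc_on :: "'a::topological_space set \<Rightarrow> ('a \<Rightarrow> real) \<Rightarrow> bool" where
  "usc_on S u \<longleftrightarrow> (\<forall>z\<in>S. \<forall>a > u z. \<forall>\<^sub>F w in at z within S. u w < a)"

definition linear_growth :: "real \<Rightarrow> ((real^'n) \<times> real \<Rightarrow> real) \<Rightarrow> bool" where
  "linear_growth T u \<longleftrightarrow> (\<exists>c. \<forall>x. \<forall>t\<in>{0..T}. \<bar>u (x, t)\<bar> \<le> c * (1 + norm x))"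

text \<open>The nonlinearity \<open>F ((x,t), \<xi>, \<nu>, M)\<close> is a curried function. It is only meaningful
  for \<open>\<nu> \<noteq> 0\<close>: below it is never evaluated at \<open>\<nu> = 0\<close>.\<close>

type_synonym 'n nonlinearity =
  "(real^'n) \<times> real \<Rightarrow> real \<Rightarrow> real^'n \<Rightarrow> real^'n^'n \<Rightarrow> real"

text \<open>Limits inferior are taken in \<open>ereal\<close>. The filter \<open>inf (nhds \<nu>) (principal {\<omega>. \<omega> \<noteq> 0})\<close> is
  \<open>\<omega> \<rightarrow> \<nu>, \<omega> \<noteq> 0\<close>, where \<open>\<omega> = \<nu>\<close> is allowed if \<open>\<nu> \<noteq> 0\<close>; at \<open>\<nu> = 0\<close> it is \<open>at 0\<close>.\<close>

definition lower_env ::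
  "'n::finite nonlinearity \<Rightarrow> (real^'n) \<times> real \<Rightarrow> real \<Rightarrow> real^'n \<Rightarrow> real^'n^'n \<Rightarrow> ereal" where
  "lower_env F z \<xi> \<nu> M =
     Liminf (inf (nhds \<nu>) (principal {\<omega>. \<omega> \<noteq> 0})) (\<lambda>\<omega>. ereal (F z \<xi> \<omega> M))"

definition upper_env ::
  "'n::finite nonlinearity \<Rightarrow> (real^'n) \<times> real \<Rightarrow> real \<Rightarrow> real^'n \<Rightarrow> real^'n^'n \<Rightarrow> ereal" where
  "upper_env F z \<xi> \<nu> M = - lower_env (\<lambda>z \<xi> \<nu> M. - F z \<xi> \<nu> M) z \<xi> \<nu> M"

definition visc_supersolution ::
  "real \<Rightarrow> 'n::finite nonlinearity \<Rightarrow> (real^'n \<Rightarrow> real) \<Rightarrow> ((real^'n) \<times> real \<Rightarrow> real) \<Rightarrow> bool" where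
  "visc_supersolution T F g u \<longleftrightarrow>
     lsc_on (closed_cyl T) u \<and> linear_growth T u \<and> (\<forall>x. u (x, T) \<ge> g x) \<and>
     (\<forall>z0 \<in> open_cyl T. \<forall>\<phi>.
        C21_on (open_cyl T) \<phi> \<longrightarrow> u z0 = \<phi> z0 \<longrightarrow> (\<forall>z \<in> open_cyl T - {z0}. u z > \<phi> z) \<longrightarrow>
          (Dx \<phi> z0 \<noteq> 0 \<longrightarrow> dt \<phi> z0 + F z0 (\<phi> z0) (Dx \<phi> z0) (Dxx \<phi> z0) \<le> 0) \<and>
          (Dx \<phi> z0 = 0 \<longrightarrow> ereal (dt \<phi> z0) + lower_env F z0 (\<phi> z0) 0 (Dxx \<phi> z0) \<le> 0))"

definition visc_subsolution ::
  "real \<Rightarrow> 'n::finite nonlinearity \<Rightarrow> (real^'n \<Rightarrow> real) \<Rightarrow> ((real^'n) \<times> real \<Rightarrow> real) \<Rightarrow> bool" where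
  "visc_subsolution T F g u \<longleftrightarrow>
     usc_on (closed_cyl T) u \<and> linear_growth T u \<and> (\<forall>x. u (x, T) \<le> g x) \<and>
     (\<forall>z0 \<in> open_cyl T. \<forall>\<phi>.
        C21_on (open_cyl T) \<phi> \<longrightarrow> u z0 = \<phi> z0 \<longrightarrow> (\<forall>z \<in> open_cyl T - {z0}. u z < \<phi> z) \<longrightarrow>
          (Dx \<phi> z0 \<noteq> 0 \<longrightarrow> dt \<phi> z0 + F z0 (\<phi> z0) (Dx \<phi> z0) (Dxx \<phi> z0) \<ge> 0) \<and>
          (Dx \<phi> z0 = 0 \<longrightarrow> ereal (dt \<phi> z0) + upper_env F z0 (\<phi> z0) 0 (Dxx \<phi> z0) \<ge> 0))"

definition visc_solution ::
  "real \<Rightarrow> 'n::finite nonlinearity \<Rightarrow> (real^'n \<Rightarrow> real) \<Rightarrow> ((real^'n) \<times> real \<Rightarrow> real) \<Rightarrow> bool" where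
  "visc_solution T F g u \<longleftrightarrow> visc_supersolution T F g u \<and> visc_subsolution T F g u"

definition pLap_F ::
  "((real^'n) \<times> real \<Rightarrow> real) \<Rightarrow> real^'n \<Rightarrow> real \<Rightarrow> 'n::finite nonlinearity" where
  "pLap_F p \<mu> r z \<xi> \<nu> M =
     (p z - 2) * (((M *v \<nu>) \<bullet> \<nu>) / (norm \<nu>)\<^sup>2) + trace M + \<mu> \<bullet> \<nu> - r * \<xi>"

end

theory Submission
  imports Defs
begin

text \<open>
  A viscosity solution is lower and upper semicontinuous, hence continuous. The nonlinearity is odd in
  \<open>(\<xi>, \<nu>, M)\<close>, so \<open>- v\<close> is a subsolution of the equation that \<open>u\<close> satisfies. Uniqueness thus follows from a
  statement on two subsolutions whose sum is bounded above: if \<open>w1(x,T) + w2(y,T) \<le> Lg |x - y|\<close>, then \<open>w1 + w2 \<le> 0\<close> on the diagonal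
  (\<open>parabolic_comparison\<close>). Its proof doubles the variables. At a maximum point of
  \<open>w1(x,t) + w2(y,t) - A exp (K (T - t)) |x - y|\<^sup>4 - \<gamma>/2 (|x|\<^sup>2 + |y|\<^sup>2) - \<beta>/t\<close> the two differential
  inequalities have to be combined, although neither function is differentiable.

  Combining them is the task of a theorem on sums. Since the nonlinearity is linear in the Hessian, a
  trace form of that theorem suffices, and it is obtained in three steps.

  First, each \<open>w\<^sub>i\<close> is replaced by a sup-convolution in space. A smooth function that touches a sup-convolution
  from above has a gradient close to that of the penalty and a Hessian bounded below by \<open>- \<kappa>\<close>
  (\<open>supconv_linear_sub\<close>). A lower bound on the Hessian is enough to freeze the coefficients: the error is a small multiple of
  the trace of a positive matrix, which is again a linear expression. So the sup-convolution is, near one point, a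
  viscosity subsolution of a linear equation with constant coefficients.

  Second, for constant coefficients \<open>\<Sum>\<^sub>k a\<^sub>k a\<^sub>k\<^sup>T\<close> and \<open>\<Sum>\<^sub>k b\<^sub>k b\<^sub>k\<^sup>T\<close> the theorem on sums follows from comparison with smooth functions
  (\<open>linear_theorem_on_sums\<close>). Each function is compared over a short time step with a solution of its
  heat equation; the data are trigonometric sums, for which the solution is explicit, and which are dense by the Stone-Weierstrass
  theorem. The sum of the two heat solutions satisfies the heat equation in the directions \<open>(a\<^sub>k, b\<^sub>k)\<close> of the doubled space, so
  it stays below the evolution of any quadratic majorant. Only the terms linear in the time step survive.

  Third, the directions are chosen (\<open>doubling_inequality\<close>). With the columns of a square root \<open>\<sigma>\<close> of the coefficient
  matrix, the large part of the Hessian of the penalty contributes a multiple of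
  \<open>|x - y|\<^sup>2 |\<sigma>(x) - \<sigma>(y)|\<^sup>2\<close>, which the Lipschitz continuity of \<open>p\<close> and \<open>p \<ge> pmin > 1\<close> bound by a
  multiple of \<open>|x - y|\<^sup>4\<close>, up to an error from the different directions of the two gradients. The factor
  \<open>exp (K (T - t))\<close> absorbs that multiple. The error vanishes as \<open>\<gamma> \<rightarrow> 0\<close> as long as
  \<open>|x - y|\<close> stays bounded below. If \<open>|x - y|\<close> is small, then so are the Hessians, and the nonlinearity may be replaced by
  a multiple of the Laplacian in both variables, which does not see the difference \<open>x - y\<close> at all.
\<close>

section \<open>Smooth test functions with explicit derivatives\<close>

definition outer :: "real^'n \<Rightarrow> real^'n^'n" where
  "outer k = (\<chi> i j. k $ i * k $ j)"

lemma outer_mult_vec: "outer k *v h = (k \<bullet> h) *\<^sub>R k"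
  by (simp add: outer_def matrix_vector_mult_def vec_eq_iff inner_vec_def sum_distrib_left mult_ac)

lemma uminus_matrix_vector_mult: "(- A) *v x = - (A *v (x::real^'n))"
  by (simp add: matrix_vector_mult_def vec_eq_iff sum_negf)

text \<open>All test functions in this development are sums of
  polynomials and cosine waves in space, with coefficients that depend on time. For these the gradient, the Hessian and the time
  derivative are known in closed form, so they are carried along as data instead of being
  recovered from the total operators \<^const>\<open>Dx\<close>, \<^const>\<open>Dxx\<close> and \<^const>\<open>dt\<close>.\<close>

definition test_data ::
  "real \<Rightarrow> ((real^'n) \<times> real \<Rightarrow> real) \<Rightarrow> ((real^'n) \<times> real \<Rightarrow> real^'n) \<Rightarrow>
   ((real^'n) \<times> real \<Rightarrow> real^'n^'n) \<Rightarrow> ((real^'n) \<times> real \<Rightarrow> real) \<Rightarrow> bool" where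
  "test_data T \<psi> G M \<tau> \<longleftrightarrow>
     (\<forall>x. \<forall>t\<in>{0<..<T}.
        ((\<lambda>y. \<psi> (y, t)) has_derivative (\<lambda>h. G (x, t) \<bullet> h)) (at x) \<and>
        ((\<lambda>y. G (y, t)) has_derivative (\<lambda>h. M (x, t) *v h)) (at x) \<and>
        ((\<lambda>s. \<psi> (x, s)) has_real_derivative \<tau> (x, t)) (at t)) \<and>
     continuous_on (open_cyl T) \<psi> \<and> continuous_on (open_cyl T) G \<and>
     continuous_on (open_cyl T) M \<and> continuous_on (open_cyl T) \<tau> \<and>
     (\<forall>z a b. (M z *v a) \<bullet> b = (M z *v b) \<bullet> a)"

lemma test_dataD:
  assumes "test_data T \<psi> G M \<tau>" "0 < t" "t < T"
  shows "((\<lambda>y. \<psi> (y, t)) has_derivative (\<lambda>h. G (x, t) \<bullet> h)) (at x)"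
    and "((\<lambda>y. G (y, t)) has_derivative (\<lambda>h. M (x, t) *v h)) (at x)"
    and "((\<lambda>s. \<psi> (x, s)) has_real_derivative \<tau> (x, t)) (at t)"
  using assms by (auto simp: test_data_def)

lemma test_data_sym:
  assumes "test_data T \<psi> G M \<tau>" shows "(M z *v a) \<bullet> b = (M z *v b) \<bullet> a"
  using assms unfolding test_data_def by blast

lemma test_data_cont:
  assumes "test_data T \<psi> G M \<tau>" shows "continuous_on (open_cyl T) \<psi>"
  using assms by (auto simp: test_data_def)

lemma gradient_eqI:
  assumes "(f has_derivative (\<lambda>h. G \<bullet> h)) (at x)"
  shows "gradient f x = G"
  using frechet_derivative_at[OF assms, symmetric]
  by (simp add: gradient_def vec_eq_iff inner_axis)

text \<open>On the open cylinder the total operators return the carried data, so test data are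
  legitimate test functions.\<close>

lemma test_data_derivs:
  assumes D: "test_data T \<psi> G M \<tau>" and t: "0 < t" "t < T"
  shows "Dx \<psi> (x, t) = G (x, t)" "Dxx \<psi> (x, t) = M (x, t)" "dt \<psi> (x, t) = \<tau> (x, t)"
proof -
  have g: "gradient (\<lambda>y. \<psi> (y, t)) y = G (y, t)" for y
    by (rule gradient_eqI) (rule test_dataD(1)[OF D t])
  then show "Dx \<psi> (x, t) = G (x, t)" by (simp add: Dx_def)
  have "gradient (\<lambda>y. \<psi> (y, t)) = (\<lambda>y. G (y, t))" using g by auto
  then show "Dxx \<psi> (x, t) = M (x, t)"
    using frechet_derivative_at[OF test_dataD(2)[OF D t, of x], symmetric]
    by (simp add: Dxx_def hessian_def matrix_of_matrix_vector_mul)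
  show "dt \<psi> (x, t) = \<tau> (x, t)"
    using test_dataD(3)[OF D t] by (simp add: dt_def DERIV_imp_deriv)
qed

lemma test_data_C21:
  assumes D: "test_data T \<psi> G M \<tau>"
  shows "C21_on (open_cyl T) \<psi>"
proof -
  have c: "continuous_on (open_cyl T) (Dx \<psi>)" "continuous_on (open_cyl T) (Dxx \<psi>)"
    "continuous_on (open_cyl T) (dt \<psi>)"
    using D test_data_derivs[OF D]
    by (auto simp: test_data_def intro: continuous_on_eq)
  have "(\<lambda>s. \<psi> (x, s)) differentiable (at t)" "(\<lambda>y. \<psi> (y, t)) differentiable (at x)"
    "(\<lambda>y. Dx \<psi> (y, t)) differentiable (at x)" if t: "0 < t" "t < T" for x t
    using test_dataD[OF D t, of x] test_data_derivs(1)[OF D t]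
    by (auto simp: differentiable_def has_field_derivative_def)
  with c show ?thesis using D by (auto simp: C21_on_def test_data_def)
qed

lemma test_data_add:
  assumes D1: "test_data T \<psi>1 G1 M1 \<tau>1" and D2: "test_data T \<psi>2 G2 M2 \<tau>2"
  shows "test_data T (\<lambda>z. \<psi>1 z + \<psi>2 z) (\<lambda>z. G1 z + G2 z) (\<lambda>z. M1 z + M2 z) (\<lambda>z. \<tau>1 z + \<tau>2 z)"
  unfolding test_data_def
proof (intro conjI allI ballI)
  fix x t assume "t \<in> {0<..<T}"
  then have t: "0 < t" "t < T" by auto
  note A = test_dataD[OF D1 t, of x] and B = test_dataD[OF D2 t, of x]
  show "((\<lambda>y. \<psi>1 (y, t) + \<psi>2 (y, t)) has_derivative (\<lambda>h. (G1 (x, t) + G2 (x, t)) \<bullet> h)) (at x)"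
    using has_derivative_add[OF A(1) B(1)] by (simp add: inner_add_left)
  show "((\<lambda>y. G1 (y, t) + G2 (y, t)) has_derivative (*v) (M1 (x, t) + M2 (x, t))) (at x)"
    by (rule has_derivative_eq_rhs[OF has_derivative_add[OF A(2) B(2)]])
       (simp add: fun_eq_iff matrix_vector_mult_add_rdistrib)
  show "((\<lambda>s. \<psi>1 (x, s) + \<psi>2 (x, s)) has_real_derivative \<tau>1 (x, t) + \<tau>2 (x, t)) (at t)"
    by (rule DERIV_add[OF A(3) B(3)])
qed (use D1 D2 in \<open>auto simp: test_data_def intro!: continuous_on_add
       simp: matrix_vector_mult_add_rdistrib inner_add_left\<close>)

lemma test_data_scale:
  assumes D: "test_data T \<psi> G M \<tau>"
  shows "test_data T (\<lambda>z. c * \<psi> z) (\<lambda>z. c *\<^sub>R G z) (\<lambda>z. c *\<^sub>R M z) (\<lambda>z. c * \<tau> z)"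
  unfolding test_data_def
proof (intro conjI allI ballI)
  fix x t assume "t \<in> {0<..<T}"
  then have t: "0 < t" "t < T" by auto
  note A = test_dataD[OF D t, of x]
  show "((\<lambda>y. c * \<psi> (y, t)) has_derivative (\<lambda>h. (c *\<^sub>R G (x, t)) \<bullet> h)) (at x)"
    using has_derivative_mult_right[OF A(1), of c] by simp
  show "((\<lambda>y. c *\<^sub>R G (y, t)) has_derivative (*v) (c *\<^sub>R M (x, t))) (at x)"
    by (rule has_derivative_eq_rhs[OF has_derivative_scaleR_right[OF A(2), of c]])
       (simp add: fun_eq_iff scaleR_matrix_vector_assoc)
  show "((\<lambda>s. c * \<psi> (x, s)) has_real_derivative c * \<tau> (x, t)) (at t)"
    by (rule DERIV_cmult[OF A(3)])
qed (use D in \<open>auto simp: test_data_def intro!: continuous_intros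
       simp: scaleR_matrix_vector_assoc[symmetric]\<close>)

lemma test_data_time:
  assumes "\<And>t. 0 < t \<Longrightarrow> t < T \<Longrightarrow> (f has_real_derivative f' t) (at t)"
    and "continuous_on {0<..<T} f'"
  shows "test_data T (\<lambda>z. f (snd z)) (\<lambda>z. 0) (\<lambda>z. 0) (\<lambda>z. f' (snd z))"
proof -
  have "continuous_on {0<..<T} f"
    by (rule continuous_at_imp_continuous_on) (auto intro!: DERIV_isCont assms(1))
  then show ?thesis using assms
    unfolding test_data_def
    by (auto intro!: derivative_eq_intros simp: fun_eq_iff intro!: continuous_on_compose2[of "{0<..<T}" f] continuous_on_compose2[of "{0<..<T}" f']
        continuous_intros)
qed

lemma test_data_const: "test_data T (\<lambda>z. c) (\<lambda>z. 0) (\<lambda>z. 0) (\<lambda>z. 0)"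
  using test_data_time[of T "\<lambda>t. c" "\<lambda>t. 0"] by auto

lemma has_derivative_power2_norm_diff:
  "((\<lambda>y::real^'n. (norm (y - a))\<^sup>2) has_derivative (\<lambda>h. (2 *\<^sub>R (x - a)) \<bullet> h)) (at x)"
  unfolding power2_norm_eq_inner
  by (auto intro!: derivative_eq_intros simp: inner_commute)

lemma test_data_square:
  fixes a :: "real^'n"
  assumes "\<And>t. 0 < t \<Longrightarrow> t < T \<Longrightarrow> (f has_real_derivative f' t) (at t)"
    and "continuous_on {0<..<T} f'"
  shows "test_data T (\<lambda>z. f (snd z) * (norm (fst z - a))\<^sup>2) (\<lambda>z. (2 * f (snd z)) *\<^sub>R (fst z - a))
      (\<lambda>z. (2 * f (snd z)) *\<^sub>R mat 1) (\<lambda>z. f' (snd z) * (norm (fst z - a))\<^sup>2)"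
  unfolding test_data_def
proof (intro conjI allI ballI)
  have cf: "continuous_on {0<..<T} f"
    by (rule continuous_at_imp_continuous_on) (auto intro!: DERIV_isCont assms(1))
  fix x :: "real^'n" and t assume "t \<in> {0<..<T}"
  then have t: "0 < t" "t < T" by auto
  show "((\<lambda>y. f (snd (y, t)) * (norm (fst (y, t) - a))\<^sup>2) has_derivative
        (\<lambda>h. ((2 * f (snd (x, t))) *\<^sub>R (fst (x, t) - a)) \<bullet> h)) (at x)"
    using has_derivative_mult_right[OF has_derivative_power2_norm_diff[of a x], of "f t"]
    by (simp add: mult_ac)
  show "((\<lambda>y. (2 * f (snd (y, t))) *\<^sub>R (fst (y, t) - a)) has_derivative
         (\<lambda>h. ((2 * f (snd (x, t))) *\<^sub>R mat 1) *v h)) (at x)"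
    by (auto intro!: derivative_eq_intros simp: fun_eq_iff scaleR_matrix_vector_assoc[symmetric])
  show "((\<lambda>s. f (snd (x, s)) * (norm (fst (x, s) - a))\<^sup>2) has_real_derivative
         f' (snd (x, t)) * (norm (fst (x, t) - a))\<^sup>2) (at t)"
    using assms(1)[OF t] by (auto intro!: derivative_eq_intros)
next
  have cf: "continuous_on {0<..<T} f"
    by (rule continuous_at_imp_continuous_on) (auto intro!: DERIV_isCont assms(1))
  have cf1: "continuous_on (open_cyl T) (\<lambda>z::(real^'n)\<times>real. f (snd z))"
    by (rule continuous_on_compose2[OF cf]) (auto intro!: continuous_intros)
  have cf2: "continuous_on (open_cyl T) (\<lambda>z::(real^'n)\<times>real. f' (snd z))"
    by (rule continuous_on_compose2[OF assms(2)]) (auto intro!: continuous_intros)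
  show "continuous_on (open_cyl T) (\<lambda>z. f (snd z) * (norm (fst z - a))\<^sup>2)"
    "continuous_on (open_cyl T) (\<lambda>z. (2 * f (snd z)) *\<^sub>R (fst z - a))"
    "continuous_on (open_cyl T) (\<lambda>z::(real^'n)\<times>real. (2 * f (snd z)) *\<^sub>R (mat 1 :: real^'n^'n))"
    "continuous_on (open_cyl T) (\<lambda>z. f' (snd z) * (norm (fst z - a))\<^sup>2)"
    by (intro continuous_intros cf1 cf2)+
qed (simp add: scaleR_matrix_vector_assoc[symmetric] inner_commute)

lemma test_data_quartic:
  fixes a :: "real^'n"
  shows "test_data T (\<lambda>z. (norm (fst z - a))^4) (\<lambda>z. (4 * (norm (fst z - a))\<^sup>2) *\<^sub>R (fst z - a))
      (\<lambda>z. (4 * (norm (fst z - a))\<^sup>2) *\<^sub>R mat 1 + 8 *\<^sub>R outer (fst z - a)) (\<lambda>z. 0)"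
  unfolding test_data_def
proof (intro conjI allI ballI)
  fix x :: "real^'n" and t assume "t \<in> {0<..<T}"
  show "((\<lambda>y. norm (fst (y, t) - a) ^ 4) has_derivative
        (\<lambda>h. ((4 * (norm (fst (x, t) - a))\<^sup>2) *\<^sub>R (fst (x, t) - a)) \<bullet> h)) (at x)"
    using has_derivative_power[OF has_derivative_power2_norm_diff[of a x], of 2]
    by (simp add: power_mult[symmetric] mult_ac)
  show "((\<lambda>y. (4 * (norm (fst (y, t) - a))\<^sup>2) *\<^sub>R (fst (y, t) - a)) has_derivative
         (\<lambda>h. ((4 * (norm (fst (x, t) - a))\<^sup>2) *\<^sub>R mat 1 + 8 *\<^sub>R outer (fst (x, t) - a)) *v h)) (at x)"
  proof -
    have 1: "((\<lambda>y. 4 * (norm (y - a))\<^sup>2) has_derivative (\<lambda>h. 4 * ((2 *\<^sub>R (x - a)) \<bullet> h))) (at x)"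
      by (rule has_derivative_mult_right[OF has_derivative_power2_norm_diff])
    have 2: "((\<lambda>y. y - a) has_derivative (\<lambda>h. h)) (at x)" by (auto intro!: derivative_eq_intros)
    show ?thesis
      unfolding fst_conv snd_conv
      by (rule has_derivative_eq_rhs[OF has_derivative_scaleR[OF 1 2]])
         (simp add: fun_eq_iff scaleR_matrix_vector_assoc[symmetric] matrix_vector_mult_add_rdistrib
           outer_mult_vec)
  qed
next
  have "continuous_on UNIV (\<lambda>z::(real^'n)\<times>real. outer (fst z - a))"
    unfolding outer_def by (intro continuous_intros)
  then have "continuous_on (open_cyl T) (\<lambda>z::(real^'n)\<times>real. outer (fst z - a))"
    by (rule continuous_on_subset) auto
  then show "continuous_on (open_cyl T)
     (\<lambda>z::(real^'n)\<times>real. (4 * (norm (fst z - a))\<^sup>2) *\<^sub>R mat 1 + 8 *\<^sub>R outer (fst z - a))"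
    by (intro continuous_intros)
qed (auto intro!: continuous_intros simp: scaleR_matrix_vector_assoc[symmetric]
      matrix_vector_mult_add_rdistrib outer_mult_vec inner_add_left inner_add_right inner_commute)

lemma test_data_wave:
  fixes k :: "real^'n"
  assumes "\<And>t. 0 < t \<Longrightarrow> t < T \<Longrightarrow> (f has_real_derivative f' t) (at t)"
    and "continuous_on {0<..<T} f'"
  shows "test_data T (\<lambda>z. f (snd z) * cos (k \<bullet> fst z + c)) (\<lambda>z. (- f (snd z) * sin (k \<bullet> fst z + c)) *\<^sub>R k)
      (\<lambda>z. (- f (snd z) * cos (k \<bullet> fst z + c)) *\<^sub>R outer k) (\<lambda>z. f' (snd z) * cos (k \<bullet> fst z + c))"
  unfolding test_data_def
proof (intro conjI allI ballI)
  fix x :: "real^'n" and t assume "t \<in> {0<..<T}"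
  then have t: "0 < t" "t < T" by auto
  show "((\<lambda>y. f (snd (y, t)) * cos (k \<bullet> fst (y, t) + c)) has_derivative
        (\<lambda>h. ((- f (snd (x, t)) * sin (k \<bullet> fst (x, t) + c)) *\<^sub>R k) \<bullet> h)) (at x)"
    by (auto intro!: derivative_eq_intros)
  show "((\<lambda>y. (- f (snd (y, t)) * sin (k \<bullet> fst (y, t) + c)) *\<^sub>R k) has_derivative
         (\<lambda>h. ((- f (snd (x, t)) * cos (k \<bullet> fst (x, t) + c)) *\<^sub>R outer k) *v h)) (at x)"
    by (auto intro!: derivative_eq_intros simp: fun_eq_iff uminus_matrix_vector_mult scaleR_matrix_vector_assoc[symmetric] outer_mult_vec)
  show "((\<lambda>s. f (snd (x, s)) * cos (k \<bullet> fst (x, s) + c)) has_real_derivative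
         f' (snd (x, t)) * cos (k \<bullet> fst (x, t) + c)) (at t)"
    using assms(1)[OF t] by (auto intro!: derivative_eq_intros)
next
  have cf: "continuous_on {0<..<T} f"
    by (rule continuous_at_imp_continuous_on) (auto intro!: DERIV_isCont assms(1))
  have cf1: "continuous_on (open_cyl T) (\<lambda>z::(real^'n)\<times>real. f (snd z))"
    by (rule continuous_on_compose2[OF cf]) (auto intro!: continuous_intros)
  have cf2: "continuous_on (open_cyl T) (\<lambda>z::(real^'n)\<times>real. f' (snd z))"
    by (rule continuous_on_compose2[OF assms(2)]) (auto intro!: continuous_intros)
  show "continuous_on (open_cyl T) (\<lambda>z. f (snd z) * cos (k \<bullet> fst z + c))"
    "continuous_on (open_cyl T) (\<lambda>z. (- f (snd z) * sin (k \<bullet> fst z + c)) *\<^sub>R k)"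
    "continuous_on (open_cyl T) (\<lambda>z. (- f (snd z) * cos (k \<bullet> fst z + c)) *\<^sub>R outer k)"
    "continuous_on (open_cyl T) (\<lambda>z. f' (snd z) * cos (k \<bullet> fst z + c))"
    by (intro continuous_intros cf1 cf2)+
qed (simp add: uminus_matrix_vector_mult scaleR_matrix_vector_assoc[symmetric] outer_mult_vec inner_commute)

lemma test_data_shift:
  fixes d :: "real^'n"
  assumes D: "test_data T \<psi> G M \<tau>"
  shows "test_data T (\<lambda>z. \<psi> (fst z + d, snd z)) (\<lambda>z. G (fst z + d, snd z))
      (\<lambda>z. M (fst z + d, snd z)) (\<lambda>z. \<tau> (fst z + d, snd z))"
  unfolding test_data_def
proof (intro conjI allI ballI)
  fix x :: "real^'n" and t assume "t \<in> {0<..<T}"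
  then have t: "0 < t" "t < T" by auto
  note A = test_dataD[OF D t, of "x + d"]
  have s: "((\<lambda>y. y + d) has_derivative (\<lambda>h. h)) (at x)" by (auto intro!: derivative_eq_intros)
  show "((\<lambda>y. \<psi> (fst (y, t) + d, snd (y, t))) has_derivative
        (\<lambda>h. G (fst (x, t) + d, snd (x, t)) \<bullet> h)) (at x)"
    using has_derivative_compose[OF s A(1)] by simp
  show "((\<lambda>y. G (fst (y, t) + d, snd (y, t))) has_derivative
         (\<lambda>h. M (fst (x, t) + d, snd (x, t)) *v h)) (at x)"
    using has_derivative_compose[OF s A(2)] by simp
  show "((\<lambda>s. \<psi> (fst (x, s) + d, snd (x, s))) has_real_derivative
         \<tau> (fst (x, t) + d, snd (x, t))) (at t)"
    using A(3) by simp
next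
  have i: "(\<lambda>z::(real^'n)\<times>real. (fst z + d, snd z)) ` open_cyl T \<subseteq> open_cyl T" by auto
  have c: "continuous_on (open_cyl T) (\<lambda>z::(real^'n)\<times>real. (fst z + d, snd z))"
    by (intro continuous_intros)
  show "continuous_on (open_cyl T) (\<lambda>z. \<psi> (fst z + d, snd z))"
    "continuous_on (open_cyl T) (\<lambda>z. G (fst z + d, snd z))"
    "continuous_on (open_cyl T) (\<lambda>z. M (fst z + d, snd z))"
    "continuous_on (open_cyl T) (\<lambda>z. \<tau> (fst z + d, snd z))"
    using D i by (auto simp: test_data_def intro!: continuous_on_compose2[OF _ c])
qed (use D in \<open>auto simp: test_data_def\<close>)

section \<open>Viscosity inequalities\<close>

text \<open>At a vanishing gradient the upper envelope is replaced by its upper bounds \<open>S\<close>. This keeps the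
  argument in the reals and treats sub- and supersolutions alike.\<close>

definition viscosity_ineq ::
  "'n::finite nonlinearity \<Rightarrow> (real^'n) \<times> real \<Rightarrow> real \<Rightarrow> real^'n \<Rightarrow> real^'n^'n \<Rightarrow> real \<Rightarrow> bool" where
  "viscosity_ineq F z \<xi> G M \<tau> \<longleftrightarrow>
     (G \<noteq> 0 \<longrightarrow> 0 \<le> \<tau> + F z \<xi> G M) \<and>
     (G = 0 \<longrightarrow> (\<forall>S. (\<forall>\<^sub>F \<omega> in at 0. F z \<xi> \<omega> M \<le> S) \<longrightarrow> 0 \<le> \<tau> + S))"

text \<open>Only the interior differential inequality of a subsolution is kept. Boundary data, growth and
  semicontinuity are separate hypotheses wherever they matter, which lets \<open>u\<close> and \<open>- v\<close> share one notion.\<close>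

definition viscosity_sub ::
  "real \<Rightarrow> 'n::finite nonlinearity \<Rightarrow> ((real^'n) \<times> real \<Rightarrow> real) \<Rightarrow> bool" where
  "viscosity_sub T F w \<longleftrightarrow>
     (\<forall>\<psi> G M \<tau> z0. test_data T \<psi> G M \<tau> \<longrightarrow> z0 \<in> open_cyl T \<longrightarrow> w z0 = \<psi> z0 \<longrightarrow>
        (\<forall>z \<in> open_cyl T - {z0}. w z < \<psi> z) \<longrightarrow>
        viscosity_ineq F z0 (w z0) (G z0) (M z0) (\<tau> z0))"

lemma nhds_zero_inf_nonzero: "inf (nhds 0) (principal {\<omega>. \<omega> \<noteq> 0}) = (at (0::real^'n))"
proof -
  have "{\<omega>::real^'n. \<omega> \<noteq> 0} = - {0}" by auto
  then show ?thesis by (simp add: at_within_def Compl_eq_Diff_UNIV)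
qed

lemma visc_subsolution_imp_sub:
  assumes "visc_subsolution T F g u"
  shows "viscosity_sub T F u"
  unfolding viscosity_sub_def
proof (intro allI impI)
  fix \<psi> G M \<tau> z0
  assume D: "test_data T \<psi> G M \<tau>" and z0: "z0 \<in> open_cyl T" and eq: "u z0 = \<psi> z0"
    and lt: "\<forall>z \<in> open_cyl T - {z0}. u z < \<psi> z"
  obtain x t where z: "z0 = (x, t)" "0 < t" "t < T" using z0 by (cases z0) auto
  note d = test_data_derivs[OF D z(2,3), of x, folded z(1)]
  have "(G z0 \<noteq> 0 \<longrightarrow> 0 \<le> \<tau> z0 + F z0 (u z0) (G z0) (M z0)) \<and>
    (G z0 = 0 \<longrightarrow> 0 \<le> ereal (\<tau> z0) + upper_env F z0 (u z0) 0 (M z0))"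
    using assms test_data_C21[OF D] z0 eq lt d unfolding visc_subsolution_def
    by (metis (no_types, lifting))
  moreover have "upper_env F z0 (u z0) 0 (M z0) \<le> ereal S"
    if "\<forall>\<^sub>F \<omega> in at 0. F z0 (u z0) \<omega> (M z0) \<le> S" for S
  proof -
    have "ereal (- S) \<le> Liminf (at 0) (\<lambda>\<omega>. ereal (- F z0 (u z0) \<omega> (M z0)))"
      by (rule Liminf_bounded) (use that in \<open>auto elim: eventually_mono\<close>)
    then show ?thesis
      unfolding upper_env_def lower_env_def nhds_zero_inf_nonzero
      by (metis ereal_minus_le_minus ereal_uminus_uminus uminus_ereal.simps(1))
  qed
  ultimately show "viscosity_ineq F z0 (u z0) (G z0) (M z0) (\<tau> z0)"
    unfolding viscosity_ineq_def
    by (metis add_left_mono ereal_less_eq(3) order_trans plus_ereal.simps(1) zero_ereal_def)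
qed

lemma pLap_F_odd: "pLap_F p \<mu> r z (- \<xi>) (- \<nu>) (- M) = - pLap_F p \<mu> r z \<xi> \<nu> M"
proof -
  have 1: "(- M) *v (- \<nu>) = M *v \<nu>"
    using matrix_vector_mult_scaleR[of M "-1" \<nu>] by (simp add: uminus_matrix_vector_mult)
  show ?thesis unfolding pLap_F_def 1 by (simp add: trace_def sum_negf algebra_simps)
qed

text \<open>The nonlinearity is odd in \<open>(\<xi>, \<nu>, M)\<close>, hence reflection turns a supersolution into a
  subsolution of the same equation; at a vanishing gradient the limit inferior turns into a limit
  superior because the punctured neighbourhood of \<open>0\<close> is symmetric.\<close>

lemma visc_supersolution_imp_sub:
  assumes "visc_supersolution T (pLap_F p \<mu> r) g v"
  shows "viscosity_sub T (pLap_F p \<mu> r) (\<lambda>z. - v z)"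
  unfolding viscosity_sub_def
proof (intro allI impI)
  fix \<psi> G M \<tau> z0
  assume D: "test_data T \<psi> G M \<tau>" and z0: "z0 \<in> open_cyl T" and eq: "- v z0 = \<psi> z0"
    and lt: "\<forall>z \<in> open_cyl T - {z0}. - v z < \<psi> z"
  let ?F = "pLap_F p \<mu> r"
  have D': "test_data T (\<lambda>z. - \<psi> z) (\<lambda>z. - G z) (\<lambda>z. - M z) (\<lambda>z. - \<tau> z)"
    using test_data_scale[OF D, of "-1"] by simp
  obtain x t where z: "z0 = (x, t)" "0 < t" "t < T" using z0 by (cases z0) auto
  note d = test_data_derivs[OF D' z(2,3), of x, folded z(1)]
  have eq': "v z0 = - \<psi> z0" using eq by simp
  have lt': "\<forall>z \<in> open_cyl T - {z0}. v z > - \<psi> z"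
    using lt by (metis minus_less_iff)
  have *: "(- G z0 \<noteq> 0 \<longrightarrow> - \<tau> z0 + ?F z0 (v z0) (- G z0) (- M z0) \<le> 0) \<and>
    (- G z0 = 0 \<longrightarrow> ereal (- \<tau> z0) + lower_env ?F z0 (v z0) 0 (- M z0) \<le> 0)"
    using assms test_data_C21[OF D'] z0 eq' lt' d unfolding visc_supersolution_def
    by (metis (no_types, lifting))
  have "0 \<le> \<tau> z0 + ?F z0 (- v z0) (G z0) (M z0)" if "G z0 \<noteq> 0"
    using * that pLap_F_odd[of p \<mu> r z0 "- v z0" "G z0" "M z0"] by simp
  moreover have "0 \<le> \<tau> z0 + S" if G: "G z0 = 0" and S: "\<forall>\<^sub>F \<omega> in at 0. ?F z0 (- v z0) \<omega> (M z0) \<le> S" for S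
  proof -
    have "\<forall>\<^sub>F \<omega> in at 0. - S \<le> ?F z0 (v z0) \<omega> (- M z0)"
    proof -
      obtain d where d: "d > 0" "\<And>\<omega>. \<omega> \<noteq> 0 \<Longrightarrow> dist \<omega> 0 < d \<Longrightarrow> ?F z0 (- v z0) \<omega> (M z0) \<le> S"
        using S unfolding eventually_at by auto
      show ?thesis unfolding eventually_at
      proof (intro exI[of _ d] conjI ballI impI d(1))
        fix \<omega> :: "real^'a" assume "\<omega> \<noteq> 0 \<and> dist \<omega> 0 < d"
        then show "- S \<le> ?F z0 (v z0) \<omega> (- M z0)"
          using d(2)[of "- \<omega>"] pLap_F_odd[of p \<mu> r z0 "- v z0" "- \<omega>" "M z0"] by simp
      qed
    qed
    then have "ereal (- S) \<le> lower_env ?F z0 (v z0) 0 (- M z0)"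
      unfolding lower_env_def nhds_zero_inf_nonzero by (intro Liminf_bounded) (auto elim: eventually_mono)
    moreover have "ereal (- \<tau> z0) + lower_env ?F z0 (v z0) 0 (- M z0) \<le> 0" using * G by simp
    ultimately have "ereal (- \<tau> z0) + ereal (- S) \<le> 0"
      by (meson add_left_mono order_trans)
    then show ?thesis by simp
  qed
  ultimately show "viscosity_ineq ?F z0 (- v z0) (G z0) (M z0) (\<tau> z0)"
    unfolding viscosity_ineq_def by blast
qed

text \<open>Quartic growth is the right threshold: it holds for every test function used below, and it
  still allows the correction \<open>|x - x\<^sub>0|\<^sup>4\<close> to dominate at infinity.\<close>

definition quartic_below :: "real \<Rightarrow> ((real^'n) \<times> real \<Rightarrow> real) \<Rightarrow> bool" where
  "quartic_below T \<psi> \<longleftrightarrow> (\<exists>c. \<forall>x. \<forall>t\<in>{0<..<T}. - c * (1 + norm x ^ 4) \<le> \<psi> (x, t))"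

lemma power4_sum_le:
  fixes a b :: real assumes "0 \<le> a" "0 \<le> b"
  shows "(a + b) ^ 4 \<le> 8 * a ^ 4 + 8 * b ^ 4"
proof -
  have 1: "(a + b)\<^sup>2 \<le> 2 * a\<^sup>2 + 2 * b\<^sup>2" for a b :: real using sum_squares_bound[of a b] by (simp add: power2_sum)
  have "((a + b)\<^sup>2)\<^sup>2 \<le> (2 * a\<^sup>2 + 2 * b\<^sup>2)\<^sup>2" by (rule power_mono[OF 1]) simp
  also have "\<dots> \<le> 2 * (2 * a\<^sup>2)\<^sup>2 + 2 * (2 * b\<^sup>2)\<^sup>2" by (rule 1)
  finally show ?thesis by (simp add: power_mult_distrib power_mult[symmetric])
qed

text \<open>Strict global contact is a matter of normalisation. Adding \<open>K (|x - x\<^sub>0|\<^sup>4 + (t - t\<^sub>0)\<^sup>2)\<close> changes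
  neither the gradient nor the Hessian nor the time derivative at the contact point, makes a local
  maximum strict, and for large \<open>K\<close> beats the growth of \<open>w - \<psi>\<close> away from it.\<close>

lemma viscosity_sub_local_max:
  fixes w :: "(real^'n::finite) \<times> real \<Rightarrow> real"
  assumes w: "viscosity_sub T F w" and lg: "linear_growth T w"
    and D: "test_data T \<psi> G M \<tau>" and qb: "quartic_below T \<psi>"
    and t0: "0 < t0" "t0 < T" and e: "e > 0"
    and max: "\<And>x t. 0 < t \<Longrightarrow> t < T \<Longrightarrow> norm (x - x0) < e \<Longrightarrow> \<bar>t - t0\<bar> < e \<Longrightarrow>
       w (x, t) - \<psi> (x, t) \<le> w (x0, t0) - \<psi> (x0, t0)"
  shows "viscosity_ineq F (x0, t0) (w (x0, t0)) (G (x0, t0)) (M (x0, t0)) (\<tau> (x0, t0))"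
proof -
  obtain c1 where c1: "\<And>x t. 0 < t \<Longrightarrow> t < T \<Longrightarrow> - c1 * (1 + norm x ^ 4) \<le> \<psi> (x, t)"
    using qb unfolding quartic_below_def by (metis greaterThanLessThan_iff)
  obtain c2 where c2: "\<And>x t. 0 < t \<Longrightarrow> t < T \<Longrightarrow> \<bar>w (x, t)\<bar> \<le> c2 * (1 + norm x)"
    using lg unfolding linear_growth_def by fastforce
  \<comment> \<open>Away from the contact point \<open>1 + |x|\<^sup>4 \<le> (8 + C0 / d0) (|x - x\<^sub>0|\<^sup>4 + (t - t\<^sub>0)\<^sup>2)\<close>, which fixes \<open>K\<close>.\<close>
  define C0 where "C0 = 1 + 8 * norm x0 ^ 4"
  define d0 where "d0 = min (e ^ 4) (e\<^sup>2)"
  define c where "c = 2 * \<bar>c2\<bar> + \<bar>c1\<bar> + \<bar>\<psi> (x0, t0) - w (x0, t0)\<bar>"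
  define K where "K = c * (8 + C0 / d0) + 1"
  let ?q = "\<lambda>z::(real^'n)\<times>real. norm (fst z - x0) ^ 4 + (snd z - t0)\<^sup>2"
  define \<phi> where "\<phi> = (\<lambda>z. \<psi> z + (w (x0, t0) - \<psi> (x0, t0)) + K * ?q z)"
  have d0: "d0 > 0" using e by (simp add: d0_def)
  have C0: "C0 \<ge> 1" by (simp add: C0_def)
  have c0: "c \<ge> 0" by (simp add: c_def)
  have K: "K > 0" using c0 d0 C0 by (auto simp: K_def intro!: add_nonneg_pos mult_nonneg_nonneg)
  have D1: "test_data T (\<lambda>z::(real^'n)\<times>real. (snd z - t0)\<^sup>2) (\<lambda>z. 0) (\<lambda>z. 0) (\<lambda>z. 2 * (snd z - t0))"
    by (rule test_data_time[where f="\<lambda>s. (s - t0)\<^sup>2" and f'="\<lambda>s. 2 * (s - t0)"])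
       (auto intro!: derivative_eq_intros continuous_intros)
  note D2 = test_data_add[OF test_data_add[OF D test_data_const[of T "w (x0,t0) - \<psi> (x0,t0)"]]
     test_data_scale[OF test_data_add[OF test_data_quartic[of T x0] D1], of K], folded \<phi>_def]
  have lt: "w z < \<phi> z" if "z \<in> open_cyl T - {(x0, t0)}" for z
  proof -
    obtain x t where z: "z = (x, t)" by (cases z)
    with that have t: "0 < t" "t < T" and ne: "x \<noteq> x0 \<or> t \<noteq> t0" by auto
    have q0: "?q z > 0" using ne unfolding z
      by (auto intro: add_pos_nonneg add_nonneg_pos)
    show ?thesis
    proof (cases "norm (x - x0) < e \<and> \<bar>t - t0\<bar> < e")
      case True
      then show ?thesis using max[OF t, of x] K q0 unfolding \<phi>_def z by (smt (verit) mult_pos_pos)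
    next
      case False
      have "d0 \<le> ?q z"
      proof (cases "norm (x - x0) < e")
        case True
        then have "e \<le> \<bar>t - t0\<bar>" using False by auto
        then have "e\<^sup>2 \<le> (t - t0)\<^sup>2" using e by (simp add: abs_le_square_iff[symmetric])
        then show ?thesis unfolding z d0_def by (auto intro: min.coboundedI2 add_increasing)
      next
        case False
        then have "e ^ 4 \<le> norm (x - x0) ^ 4" using e by (intro power_mono) auto
        then show ?thesis unfolding z d0_def by (auto intro: min.coboundedI1 add_increasing2)
      qed
      have "norm x \<le> norm (x - x0) + norm x0" using norm_triangle_ineq[of "x - x0" x0] by simp
      then have "norm x ^ 4 \<le> (norm (x - x0) + norm x0) ^ 4" by (intro power_mono) auto
      also have "\<dots> \<le> 8 * norm (x - x0) ^ 4 + 8 * norm x0 ^ 4" by (rule power4_sum_le) auto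
      finally have "1 + norm x ^ 4 \<le> 8 * norm (x - x0) ^ 4 + C0" by (simp add: C0_def)
      also have "\<dots> \<le> 8 * ?q z + C0" unfolding z by simp
      also have "C0 \<le> C0 * (?q z / d0)"
        using mult_left_mono[of 1 "?q z / d0" C0] \<open>d0 \<le> ?q z\<close> d0 C0 by simp
      finally have g: "1 + norm x ^ 4 \<le> (8 + C0 / d0) * ?q z" by (simp add: algebra_simps add_divide_distrib)
      have n: "1 + norm x \<le> 2 * (1 + norm x ^ 4)"
      proof (cases "norm x \<le> 1")
        case True then show ?thesis by (smt (verit) zero_le_power norm_ge_zero)
      next
        case False then show ?thesis using self_le_power[of "norm x" 4] by simp
      qed
      have "c2 * (1 + norm x) \<le> \<bar>c2\<bar> * (2 * (1 + norm x ^ 4))"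
        by (rule mult_mono) (use n in auto)
      moreover have "c1 * (1 + norm x ^ 4) \<le> \<bar>c1\<bar> * (1 + norm x ^ 4)"
        by (intro mult_right_mono) (auto intro: add_nonneg_nonneg)
      moreover have "\<psi> (x0, t0) - w (x0, t0) \<le> \<bar>\<psi> (x0, t0) - w (x0, t0)\<bar> * (1 + norm x ^ 4)"
        by (smt (verit) mult_cancel_left1 mult_left_mono zero_le_power norm_ge_zero)
      ultimately have "w (x, t) - \<psi> (x, t) + (\<psi> (x0, t0) - w (x0, t0)) \<le> c * (1 + norm x ^ 4)"
        using c1[OF t, of x] c2[OF t, of x] unfolding c_def by (simp add: algebra_simps) linarith
      also have "\<dots> \<le> c * ((8 + C0 / d0) * ?q z)" by (rule mult_left_mono[OF g c0])
      also have "\<dots> < K * ?q z" using q0 unfolding K_def by (simp add: algebra_simps)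
      finally show ?thesis unfolding \<phi>_def z by simp
    qed
  qed
  have eq: "w (x0, t0) = \<phi> (x0, t0)" by (simp add: \<phi>_def)
  have o: "outer (0::real^'n) = 0" by (simp add: outer_def vec_eq_iff)
  have z0: "(x0, t0) \<in> open_cyl T" using t0 by auto
  show ?thesis
    using w[unfolded viscosity_sub_def, rule_format, OF D2 z0 eq lt, simplified, unfolded o, simplified] .
qed

section \<open>First and second order conditions at a maximum\<close>

lemma second_derivative_at_max:
  fixes f f' :: "real \<Rightarrow> real"
  assumes f: "\<And>s. (f has_real_derivative f' s) (at s)" and f2: "(f' has_real_derivative D) (at 0)"
    and e: "e > 0" and max: "\<And>s. \<bar>s\<bar> < e \<Longrightarrow> f s \<le> f 0"
  shows "f' 0 = 0" and "D \<le> 0"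
proof -
  show 0: "f' 0 = 0" by (rule DERIV_local_max[OF f e]) (use max in auto)
  show "D \<le> 0"
  proof (rule ccontr)
    assume "\<not> D \<le> 0"
    then obtain d where d: "d > 0" "\<And>h. 0 < h \<Longrightarrow> h < d \<Longrightarrow> f' 0 < f' (0 + h)"
      using DERIV_pos_inc_right[OF f2] by force
    define h where "h = min d e / 2"
    have h: "0 < h" "h < d" "h < e" using d(1) e by (auto simp: h_def)
    obtain z where z: "0 < z" "z < h" "f h - f 0 = (h - 0) * f' z"
      using MVT2[of 0 h f f'] f h by auto
    have "f' z > 0" using d(2)[of z] z h 0 by auto
    then have "f h > f 0" using z h by (smt (verit) mult_pos_pos)
    then show False using max[of h] h by auto
  qed
qed

lemma derivative_at_right_max:
  fixes f :: "real \<Rightarrow> real"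
  assumes f: "(f has_real_derivative D) (at t)" and e: "e > 0"
    and max: "\<And>s. t < s \<Longrightarrow> s < t + e \<Longrightarrow> f s \<le> f t"
  shows "D \<le> 0"
proof (rule ccontr)
  assume "\<not> D \<le> 0"
  then obtain d where d: "d > 0" "\<And>h. 0 < h \<Longrightarrow> h < d \<Longrightarrow> f t < f (t + h)"
    using DERIV_pos_inc_right[OF f] by force
  define h where "h = min d e / 2"
  have "0 < h" "h < d" "h < e" using d(1) e by (auto simp: h_def)
  then show False using d(2)[of h] max[of "t + h"] by auto
qed

lemma test_data_line:
  assumes D: "test_data T \<psi> G M \<tau>" and t: "0 < t" "t < T"
  shows "((\<lambda>s. \<psi> (x + s *\<^sub>R a, t)) has_real_derivative G (x + s *\<^sub>R a, t) \<bullet> a) (at s)"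
    and "((\<lambda>s. G (x + s *\<^sub>R a, t) \<bullet> a) has_real_derivative (M (x + s *\<^sub>R a, t) *v a) \<bullet> a) (at s)"
proof -
  have l: "((\<lambda>s. x + s *\<^sub>R a) has_derivative (\<lambda>h. h *\<^sub>R a)) (at s)"
    by (auto intro!: derivative_eq_intros)
  note A = test_dataD[OF D t, of "x + s *\<^sub>R a"]
  show "((\<lambda>s. \<psi> (x + s *\<^sub>R a, t)) has_real_derivative G (x + s *\<^sub>R a, t) \<bullet> a) (at s)"
    using has_derivative_compose[OF l A(1)]
    by (simp add: has_field_derivative_def mult.commute[of _ "_ \<bullet> _"])
  show "((\<lambda>s. G (x + s *\<^sub>R a, t) \<bullet> a) has_real_derivative (M (x + s *\<^sub>R a, t) *v a) \<bullet> a) (at s)"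
    using has_derivative_inner_left[OF has_derivative_compose[OF l A(2)], of a]
    by (simp add: has_field_derivative_def matrix_vector_mult_scaleR mult.commute[of _ "_ \<bullet> _"])
qed

text \<open>The classical maximum principle in the doubled space, tested only in the directions
  \<open>(a\<^sub>k, b\<^sub>k)\<close>. Maximality for later times alone suffices since only the sign of the time derivative is
  used; this is what makes the initial slice \<open>t = t\<^sub>0\<close> of a backward problem harmless.\<close>

lemma two_point_max:
  fixes a b :: "'k::finite \<Rightarrow> real^'n"
  assumes D1: "test_data T \<psi>1 G1 M1 \<tau>1" and D2: "test_data T \<psi>2 G2 M2 \<tau>2"
    and t: "0 < t" "t < T" and e: "e > 0"
    and q: "\<And>k s. q (x + s *\<^sub>R a k) (y + s *\<^sub>R b k) = q x y + l k * s + m k * s\<^sup>2"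
    and max: "\<And>x' y' s. norm (x' - x) < e \<Longrightarrow> norm (y' - y) < e \<Longrightarrow> t \<le> s \<Longrightarrow> s < t + e \<Longrightarrow>
      \<psi>1 (x', s) + \<psi>2 (y', s) - q x' y' \<le> \<psi>1 (x, t) + \<psi>2 (y, t) - q x y"
  shows "\<tau>1 (x, t) + \<tau>2 (y, t) + (\<Sum>k\<in>UNIV. (M1 (x, t) *v a k) \<bullet> a k + (M2 (y, t) *v b k) \<bullet> b k)
    \<le> (\<Sum>k\<in>UNIV. 2 * m k)"
proof -
  have "\<tau>1 (x, t) + \<tau>2 (y, t) \<le> 0"
    by (rule derivative_at_right_max[OF DERIV_add[OF test_dataD(3)[OF D1 t] test_dataD(3)[OF D2 t]] e])
       (use max[of x y] e in force)
  moreover have "(M1 (x, t) *v a k) \<bullet> a k + (M2 (y, t) *v b k) \<bullet> b k \<le> 2 * m k" for k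
  proof -
    define d where "d = e / (1 + norm (a k) + norm (b k))"
    have pos: "0 < 1 + norm (a k) + norm (b k)" by (smt (verit) norm_ge_zero)
    have d: "d > 0" using e pos by (simp add: d_def)
    have small: "norm (s *\<^sub>R a k) < e" "norm (s *\<^sub>R b k) < e" if "\<bar>s\<bar> < d" for s
    proof -
      have "\<bar>s\<bar> * (1 + norm (a k) + norm (b k)) < e"
        using that pos by (simp add: d_def pos_less_divide_eq)
      moreover have "\<bar>s\<bar> * norm (a k) \<le> \<bar>s\<bar> * (1 + norm (a k) + norm (b k))"
        "\<bar>s\<bar> * norm (b k) \<le> \<bar>s\<bar> * (1 + norm (a k) + norm (b k))"
        by (intro mult_left_mono; simp)+
      ultimately show "norm (s *\<^sub>R a k) < e" "norm (s *\<^sub>R b k) < e" by auto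
    qed
    let ?f = "\<lambda>s. \<psi>1 (x + s *\<^sub>R a k, t) + \<psi>2 (y + s *\<^sub>R b k, t) - (q x y + l k * s + m k * s\<^sup>2)"
    let ?f' = "\<lambda>s. G1 (x + s *\<^sub>R a k, t) \<bullet> a k + G2 (y + s *\<^sub>R b k, t) \<bullet> b k - (l k + 2 * m k * s)"
    have "(M1 (x + 0 *\<^sub>R a k, t) *v a k) \<bullet> a k + (M2 (y + 0 *\<^sub>R b k, t) *v b k) \<bullet> b k - 2 * m k \<le> 0"
    proof (rule second_derivative_at_max(2)[of ?f ?f' _ d])
      show "(?f has_real_derivative ?f' s) (at s)" for s
        by (intro DERIV_diff DERIV_add test_data_line(1)[OF D1 t] test_data_line(1)[OF D2 t])
           (auto intro!: derivative_eq_intros)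
      show "(?f' has_real_derivative
        (M1 (x + 0 *\<^sub>R a k, t) *v a k) \<bullet> a k + (M2 (y + 0 *\<^sub>R b k, t) *v b k) \<bullet> b k - 2 * m k) (at 0)"
        by (intro DERIV_diff DERIV_add test_data_line(2)[OF D1 t] test_data_line(2)[OF D2 t])
           (auto intro!: derivative_eq_intros)
      show "?f s \<le> ?f 0" if "\<bar>s\<bar> < d" for s
        using max[of "x + s *\<^sub>R a k" "y + s *\<^sub>R b k" t] small[OF that] e q[of s k] by simp
    qed (rule d)
    then show ?thesis by simp
  qed
  ultimately show ?thesis
    by (smt (verit) sum_mono)
qed

lemma test_data_diff:
  assumes D1: "test_data T \<psi>1 G1 M1 \<tau>1" and D2: "test_data T \<psi>2 G2 M2 \<tau>2"
  shows "test_data T (\<lambda>z. \<psi>1 z - \<psi>2 z) (\<lambda>z. G1 z - G2 z) (\<lambda>z. M1 z - M2 z) (\<lambda>z. \<tau>1 z - \<tau>2 z)"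
  using test_data_add[OF D1 test_data_scale[OF D2, of "-1"]] by simp

lemma diff_matrix_vector_mult: "(A - B) *v x = A *v x - B *v (x::real^'n)"
  by (simp add: matrix_vector_mult_def vec_eq_iff sum_subtractf left_diff_distrib)

section \<open>Constant coefficient heat equations with trigonometric data\<close>

text \<open>The constant coefficient operator \<open>tr (A M)\<close> with \<open>A = \<Sum>\<^sub>k a\<^sub>k a\<^sub>k\<^sup>T\<close>. The vectors are kept
  instead of \<open>A\<close>, because two operators with the same index set can be coupled by pairing their vectors.\<close>

definition heat_op :: "('k::finite \<Rightarrow> real^'n) \<Rightarrow> real^'n^'n \<Rightarrow> real" where
  "heat_op a M = (\<Sum>k\<in>UNIV. (M *v a k) \<bullet> a k)"

lemma heat_op_add: "heat_op a (M + N) = heat_op a M + heat_op a N"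
  by (simp add: heat_op_def matrix_vector_mult_add_rdistrib inner_add_left sum.distrib)

lemma heat_op_scale: "heat_op a (c *\<^sub>R M) = c * heat_op a M"
  by (simp add: heat_op_def scaleR_matrix_vector_assoc[symmetric] sum_distrib_left)

lemma heat_op_diff: "heat_op a (M - N) = heat_op a M - heat_op a N"
  by (simp add: heat_op_def diff_matrix_vector_mult inner_diff_left sum_subtractf)

lemma heat_op_0: "heat_op a 0 = 0"
  by (simp add: heat_op_def)

lemma heat_op_mat1: "heat_op a (mat 1) = (\<Sum>k\<in>UNIV. (norm (a k))\<^sup>2)"
  by (simp add: heat_op_def power2_norm_eq_inner)

lemma heat_op_outer: "heat_op a (outer v) = (\<Sum>k\<in>UNIV. (v \<bullet> a k)\<^sup>2)"
  by (simp add: heat_op_def outer_mult_vec power2_eq_square)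

lemma heat_op_outer_le: "heat_op a (outer v) \<le> (norm v)\<^sup>2 * (\<Sum>k\<in>UNIV. (norm (a k))\<^sup>2)"
proof -
  have "(v \<bullet> a k)\<^sup>2 \<le> (norm v)\<^sup>2 * (norm (a k))\<^sup>2" for k
    using Cauchy_Schwarz_ineq[of v "a k"] by (simp add: power2_norm_eq_inner)
  then show ?thesis by (simp add: heat_op_outer sum_distrib_left sum_mono)
qed

text \<open>Bounded classical solutions of the backward equation \<open>\<partial>\<^sub>t H + tr (A D\<^sup>2H) = 0\<close>.\<close>

definition heat_sol where
  "heat_sol T a H G M \<tau> \<longleftrightarrow> test_data T H G M \<tau> \<and> (\<forall>x t. 0 < t \<longrightarrow> t < T \<longrightarrow> \<tau> (x, t) + heat_op a (M (x, t)) = 0)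
     \<and> (\<exists>C. \<forall>x t. 0 < t \<longrightarrow> t < T \<longrightarrow> \<bar>H (x, t)\<bar> \<le> C)"

text \<open>Finite sums of cosine waves with arbitrary real frequencies. They form an algebra, and a
  wave evolves under the heat equation by an exponential factor; so solutions with dense data
  come without any integral representation.\<close>

inductive_set trig :: "(real^'n \<Rightarrow> real) set" where
  wave: "(\<lambda>x. cos (k \<bullet> x + c)) \<in> trig"
| scale: "f \<in> trig \<Longrightarrow> (\<lambda>x. b * f x) \<in> trig"
| add: "f \<in> trig \<Longrightarrow> g \<in> trig \<Longrightarrow> (\<lambda>x. f x + g x) \<in> trig"

text \<open>Product-to-sum formula.\<close>

lemma trig_mult:
  assumes "f \<in> trig" "g \<in> trig" shows "(\<lambda>x. f x * g x) \<in> trig"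
  using assms
proof (induction arbitrary: g)
  case (wave k c)
  from \<open>g \<in> trig\<close> show ?case
  proof induction
    case (wave k' c')
    have "(\<lambda>x. 1/2 * cos ((k - k') \<bullet> x + (c - c')) + 1/2 * cos ((k + k') \<bullet> x + (c + c'))) \<in> trig"
      by (intro trig.intros)
    also have "(\<lambda>x. 1/2 * cos ((k - k') \<bullet> x + (c - c')) + 1/2 * cos ((k + k') \<bullet> x + (c + c')))
       = (\<lambda>x. cos (k \<bullet> x + c) * cos (k' \<bullet> x + c'))"
    proof
      fix x
      have "(k - k') \<bullet> x + (c - c') = (k \<bullet> x + c) - (k' \<bullet> x + c')"
        "(k + k') \<bullet> x + (c + c') = (k \<bullet> x + c) + (k' \<bullet> x + c')"
        by (simp_all add: inner_diff_left inner_add_left)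
      moreover have "1/2 * p + 1/2 * q = (p + q) / 2" for p q :: real by simp
      ultimately show "1/2 * cos ((k - k') \<bullet> x + (c - c')) + 1/2 * cos ((k + k') \<bullet> x + (c + c'))
         = cos (k \<bullet> x + c) * cos (k' \<bullet> x + c')"
        by (simp only: cos_times_cos)
    qed
    finally show ?case .
  next
    case (scale f b)
    then show ?case using trig.scale[of "\<lambda>x. cos (k \<bullet> x + c) * f x" b] by (simp add: mult_ac)
  next
    case (add f g)
    then show ?case using trig.add by (fastforce simp: distrib_left)
  qed
next
  case (scale f b)
  show ?case using trig.scale[OF scale.IH[OF scale.prems], of b] by (simp only: mult.assoc)
next
  case (add f1 f2)
  then show ?case using trig.add by (fastforce simp: distrib_right)
qed

lemma trig_const: "(\<lambda>x. c) \<in> trig"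
  using trig.scale[OF trig.wave[of 0 0], of c] by simp

lemma trig_sum: "(\<And>i. i \<in> I \<Longrightarrow> f i \<in> trig) \<Longrightarrow> (\<lambda>x. \<Sum>i\<in>I. f i x) \<in> trig"
  by (induction I rule: infinite_finite_induct) (auto simp: trig_const intro: trig.add)

lemma trig_polynomial_sin:
  fixes x0 :: "real^'n"
  assumes "real_polynomial_function P"
  shows "(\<lambda>x. P (\<chi> i. sin ((x $ i - x0 $ i) / R))) \<in> trig"
  using assms
proof induction
  case (linear f)
  have s: "(\<lambda>x::real^'n. sin ((x $ i - x0 $ i) / R)) \<in> trig" for i
  proof -
    have "(\<lambda>x. cos ((axis i (1 / R)) \<bullet> x + (- x0 $ i / R - pi / 2))) \<in> trig" by (rule trig.wave)
    moreover have "cos ((axis i (1 / R)) \<bullet> x + (- x0 $ i / R - pi / 2)) = sin ((x $ i - x0 $ i) / R)" for x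
    proof -
      have "(axis i (1 / R)) \<bullet> x + (- x0 $ i / R - pi / 2) = - (pi / 2 - (x $ i - x0 $ i) / R)"
        by (simp add: inner_commute inner_axis diff_divide_distrib)
      then show ?thesis by (simp only: cos_minus) (simp add: cos_diff)
    qed
    ultimately show ?thesis by simp
  qed
  have "f (\<chi> i. sin ((x $ i - x0 $ i) / R)) = (\<Sum>i\<in>UNIV. f (axis i 1) * sin ((x $ i - x0 $ i) / R))" for x
  proof -
    let ?v = "\<chi> i. sin ((x $ i - x0 $ i) / R)"
    interpret bounded_linear f by (rule linear)
    have "(\<Sum>i\<in>UNIV. (?v $ i) *\<^sub>R axis i (1::real)) = ?v"
      using basis_expansion[of ?v] unfolding scalar_mult_eq_scaleR .
    then have "f ?v = f (\<Sum>i\<in>UNIV. (?v $ i) *\<^sub>R axis i 1)" by metis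
    also have "\<dots> = (\<Sum>i\<in>UNIV. (?v $ i) * f (axis i 1))" by (simp add: sum scaleR)
    finally show ?thesis by (simp add: mult.commute)
  qed
  then show ?case by (auto intro!: trig_sum trig.scale s)
next
  case (const c) show ?case by (rule trig_const)
next
  case (add f g) then show ?case by (intro trig.add)
next
  case (mult f g) then show ?case by (intro trig_mult)
qed

lemma trig_heat_extension:
  fixes a :: "'k::finite \<Rightarrow> real^'n"
  assumes "h \<in> trig"
  shows "\<exists>H G M \<tau>. heat_sol T a H G M \<tau> \<and> (\<forall>x. H (x, t1) = h x)"
  using assms
proof induction
  case (wave k c)
  define lam where "lam = (\<Sum>j\<in>UNIV. (k \<bullet> a j)\<^sup>2)"
  have lam: "lam \<ge> 0" by (simp add: lam_def sum_nonneg)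
  let ?f = "\<lambda>t. exp (lam * (t - t1))"
  have f: "(?f has_real_derivative lam * ?f t) (at t)" for t
    by (auto intro!: derivative_eq_intros)
  have D: "test_data T (\<lambda>z. ?f (snd z) * cos (k \<bullet> fst z + c)) (\<lambda>z. (- ?f (snd z) * sin (k \<bullet> fst z + c)) *\<^sub>R k)
      (\<lambda>z. (- ?f (snd z) * cos (k \<bullet> fst z + c)) *\<^sub>R outer k) (\<lambda>z. lam * ?f (snd z) * cos (k \<bullet> fst z + c))"
    by (rule test_data_wave[OF f]) (intro continuous_intros)
  have "\<bar>exp (lam * (t - t1)) * cos (k \<bullet> x + c)\<bar> \<le> exp (lam * (T - t1))" if "t < T" for x t
  proof -
    have "exp (lam * (t - t1)) \<le> exp (lam * (T - t1))" using that lam by (simp add: mult_left_mono)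
    then have "exp (lam * (t - t1)) * \<bar>cos (k \<bullet> x + c)\<bar> \<le> exp (lam * (T - t1)) * 1"
      by (intro mult_mono) auto
    then show ?thesis by (simp add: abs_mult)
  qed
  then have "\<exists>C. \<forall>x t. 0 < t \<longrightarrow> t < T \<longrightarrow> \<bar>exp (lam * (t - t1)) * cos (k \<bullet> x + c)\<bar> \<le> C" by blast
  with D have "heat_sol T a (\<lambda>z. ?f (snd z) * cos (k \<bullet> fst z + c)) (\<lambda>z. (- ?f (snd z) * sin (k \<bullet> fst z + c)) *\<^sub>R k)
      (\<lambda>z. (- ?f (snd z) * cos (k \<bullet> fst z + c)) *\<^sub>R outer k) (\<lambda>z. lam * ?f (snd z) * cos (k \<bullet> fst z + c))"
    unfolding heat_sol_def by (simp only: heat_op_scale heat_op_outer lam_def[symmetric]) simp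
  moreover have "\<forall>x. (\<lambda>z. ?f (snd z) * cos (k \<bullet> fst z + c)) (x, t1) = cos (k \<bullet> x + c)" by simp
  ultimately show ?case by blast
next
  case (scale f b)
  then obtain H G M \<tau> where H: "heat_sol T a H G M \<tau>" "\<forall>x. H (x, t1) = f x" by blast
  obtain C where "\<And>x t. 0 < t \<Longrightarrow> t < T \<Longrightarrow> \<bar>H (x, t)\<bar> \<le> C" using H(1) unfolding heat_sol_def by blast
  then have "\<And>x t. 0 < t \<Longrightarrow> t < T \<Longrightarrow> \<bar>b * H (x, t)\<bar> \<le> \<bar>b\<bar> * C"
    by (simp add: abs_mult mult_left_mono)
  then have "\<exists>C. \<forall>x t. 0 < t \<longrightarrow> t < T \<longrightarrow> \<bar>b * H (x, t)\<bar> \<le> C" by blast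
  then have "heat_sol T a (\<lambda>z. b * H z) (\<lambda>z. b *\<^sub>R G z) (\<lambda>z. b *\<^sub>R M z) (\<lambda>z. b * \<tau> z)"
    using H(1) unfolding heat_sol_def
    by (auto intro!: test_data_scale simp: heat_op_scale distrib_left[symmetric])
  then show ?case using H(2) by (intro exI conjI) auto
next
  case (add f g)
  then obtain H1 G1 M1 \<tau>1 H2 G2 M2 \<tau>2 where
    H: "heat_sol T a H1 G1 M1 \<tau>1" "\<forall>x. H1 (x, t1) = f x" "heat_sol T a H2 G2 M2 \<tau>2" "\<forall>x. H2 (x, t1) = g x"
    by metis
  obtain C1 where 1: "\<And>x t. 0 < t \<Longrightarrow> t < T \<Longrightarrow> \<bar>H1 (x, t)\<bar> \<le> C1" using H(1) unfolding heat_sol_def by blast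
  obtain C2 where 2: "\<And>x t. 0 < t \<Longrightarrow> t < T \<Longrightarrow> \<bar>H2 (x, t)\<bar> \<le> C2" using H(3) unfolding heat_sol_def by blast
  have "\<exists>C. \<forall>x t. 0 < t \<longrightarrow> t < T \<longrightarrow> \<bar>H1 (x, t) + H2 (x, t)\<bar> \<le> C"
    using 1 2 by (intro exI[of _ "C1 + C2"] allI impI order_trans[OF abs_triangle_ineq] add_mono)
  moreover have "\<tau>1 (x, t) + \<tau>2 (x, t) + heat_op a (M1 (x, t) + M2 (x, t)) = 0" if "0 < t" "t < T" for x t
    using H(1,3) that unfolding heat_sol_def heat_op_add by (smt (verit))
  ultimately have "heat_sol T a (\<lambda>z. H1 z + H2 z) (\<lambda>z. G1 z + G2 z) (\<lambda>z. M1 z + M2 z) (\<lambda>z. \<tau>1 z + \<tau>2 z)"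
    using H(1,3) unfolding heat_sol_def by (auto intro!: test_data_add)
  then show ?case using H(2,4) by (intro exI conjI) auto
qed

text \<open>The triangle wave \<open>arcsin \<circ> sin\<close> in every coordinate: the identity near \<open>x0\<close>, and a retraction of the
  whole space onto a small box. Composition with it extends a function given near \<open>x0\<close> to all of space,
  as a function of the sines of the coordinates.\<close>

definition clamp_sin :: "real^'n \<Rightarrow> real \<Rightarrow> real^'n \<Rightarrow> real^'n" where
  "clamp_sin x0 R x = x0 + (\<chi> i. R * arcsin (sin ((x $ i - x0 $ i) / R)))"

lemma norm_arcsin_vec_le:
  fixes s :: "real^'n"
  assumes "\<And>i. \<bar>s $ i\<bar> \<le> 1" "R > 0"
  shows "norm (\<chi> i. R * arcsin (s $ i)) \<le> real CARD('n) * (2 * R)"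
proof -
  have "\<bar>R * arcsin (s $ i)\<bar> \<le> 2 * R" for i
  proof -
    have "\<bar>arcsin (s $ i)\<bar> \<le> pi / 2"
      using arcsin_lbound[of "s $ i"] arcsin_ubound[of "s $ i"] assms(1)[of i] by linarith
    also have "\<dots> \<le> 2" using pi_less_4 by simp
    finally show ?thesis using assms(2) by (simp add: abs_mult)
  qed
  then have "(\<Sum>i\<in>UNIV. \<bar>R * arcsin (s $ i)\<bar>) \<le> (\<Sum>i\<in>(UNIV::'n set). 2 * R)" by (intro sum_mono)
  then show ?thesis using norm_le_l1_cart[of "\<chi> i. R * arcsin (s $ i)"] by simp
qed

lemma clamp_sin_mem:
  fixes x0 :: "real^'n"
  assumes "R > 0" "real CARD('n) * (2 * R) \<le> \<rho>"
  shows "clamp_sin x0 R x \<in> cball x0 \<rho>"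
  using norm_arcsin_vec_le[of "\<chi> i. sin ((x $ i - x0 $ i) / R)" R] assms
  by (simp add: clamp_sin_def dist_norm)

lemma clamp_sin_id:
  assumes "R > 0" "x \<in> cball x0 R" shows "clamp_sin x0 R x = x"
proof -
  have "\<bar>x $ i - x0 $ i\<bar> \<le> R" for i
    using component_le_norm_cart[of "x - x0" i] assms(2) by (simp add: dist_norm norm_minus_commute)
  then have "\<bar>(x $ i - x0 $ i) / R\<bar> \<le> 1" for i
    using assms(1) by simp
  then have "\<bar>(x $ i - x0 $ i) / R\<bar> \<le> pi / 2" for i
    by (rule order_trans) (use pi_gt3 in simp)
  then have "arcsin (sin ((x $ i - x0 $ i) / R)) = (x $ i - x0 $ i) / R" for i
    by (intro arcsin_sin) (smt (verit))+
  then show ?thesis using assms(1) by (simp add: clamp_sin_def vec_eq_iff)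
qed

text \<open>Stone-Weierstrass on the cube of sine values; a polynomial in sines is a trigonometric sum.
  The approximation is uniform on the whole space, which bounds the heat evolution globally.\<close>

lemma trig_approximation:
  fixes x0 :: "real^'n"
  assumes f: "continuous_on (cball x0 \<rho>) f" and R: "R > 0" "real CARD('n) * (2 * R) \<le> \<rho>" and e: "\<epsilon> > 0"
  shows "\<exists>h\<in>trig. \<forall>x. \<bar>h x - f (clamp_sin x0 R x)\<bar> < \<epsilon>"
proof -
  let ?K = "cbox (\<chi> i. (- 1 :: real)) (\<chi> i. (1 :: real)) :: (real^'n) set"
  let ?g = "\<lambda>s::real^'n. f (x0 + (\<chi> i. R * arcsin (s $ i)))"
  have K: "s \<in> ?K \<longleftrightarrow> (\<forall>i. \<bar>s $ i\<bar> \<le> 1)" for s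
    by (auto simp: mem_box_cart abs_le_iff minus_le_iff)
  have "continuous_on ?K (\<lambda>s. x0 + (\<chi> i. R * arcsin (s $ i)))"
    by (intro continuous_intros continuous_on_arcsin ballI) (auto simp: mem_box_cart)
  then have "continuous_on ?K ?g"
    by (rule continuous_on_compose2[OF f])
       (use norm_arcsin_vec_le[OF _ R(1)] R(2) K in \<open>force simp: dist_norm\<close>)
  then obtain P where P: "real_polynomial_function P" "\<And>s. s \<in> ?K \<Longrightarrow> \<bar>?g s - P s\<bar> < \<epsilon>"
    using Stone_Weierstrass_real_polynomial_function[of ?K ?g \<epsilon>] e by auto
  show ?thesis
  proof (intro bexI allI)
    show "(\<lambda>x. P (\<chi> i. sin ((x $ i - x0 $ i) / R))) \<in> trig" by (rule trig_polynomial_sin[OF P(1)])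
    show "\<bar>P (\<chi> i. sin ((x $ i - x0 $ i) / R)) - f (clamp_sin x0 R x)\<bar> < \<epsilon>" for x
      using P(2)[of "\<chi> i. sin ((x $ i - x0 $ i) / R)"] unfolding K clamp_sin_def
      by (simp add: abs_minus_commute)
  qed
qed

section \<open>Comparison of linear subsolutions with heat solutions\<close>

text \<open>Viscosity subsolutions of \<open>\<partial>\<^sub>t U + tr (A D\<^sup>2U) + c \<ge> 0\<close> in a neighbourhood of \<open>(x0, t0)\<close>.\<close>

definition linear_sub ::
  "real \<Rightarrow> ('k::finite \<Rightarrow> real^'n) \<Rightarrow> real \<Rightarrow> real^'n \<Rightarrow> real \<Rightarrow> real \<Rightarrow> ((real^'n) \<times> real \<Rightarrow> real) \<Rightarrow> bool" where
  "linear_sub T a c x0 t0 \<rho> U \<longleftrightarrow>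
     (\<forall>\<psi> G M \<tau> x t e. test_data T \<psi> G M \<tau> \<longrightarrow> quartic_below T \<psi> \<longrightarrow>
        norm (x - x0) < \<rho> \<longrightarrow> \<bar>t - t0\<bar> < \<rho> \<longrightarrow> e > 0 \<longrightarrow>
        (\<forall>y s. norm (y - x) < e \<longrightarrow> \<bar>s - t\<bar> < e \<longrightarrow> U (y, s) - \<psi> (y, s) \<le> U (x, t) - \<psi> (x, t)) \<longrightarrow>
        0 \<le> \<tau> (x, t) + heat_op a (M (x, t)) + c)"

text \<open>A supersolution that is at least \<open>|x - x0|\<^sup>4\<close> up to time \<open>t1\<close> and only of size \<open>(t1 - t)\<^sup>2\<close> at the centre.
  It absorbs everything that happens on the lateral boundary of a small cylinder at a cost that is
  quadratic in the time step, hence negligible against linear terms.\<close>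

definition barrier :: "real \<Rightarrow> real^'n \<Rightarrow> real \<Rightarrow> (real^'n) \<times> real \<Rightarrow> real" where
  "barrier S x0 t1 z = norm (fst z - x0) ^ 4 + 12 * S * (t1 - snd z) * (norm (fst z - x0))\<^sup>2
     + 12 * S\<^sup>2 * (t1 - snd z)\<^sup>2"

text \<open>With \<open>S = tr A\<close> the coefficients \<open>12 S\<close> and \<open>12 S\<^sup>2\<close> are exactly those for which the time
  derivative cancels \<open>tr (A D\<^sup>2|x|\<^sup>4) \<le> 12 S |x|\<^sup>2\<close> and the second order term that the mixed monomial produces.\<close>

lemma barrier_test_data:
  fixes x0 :: "real^'n" and a :: "'k::finite \<Rightarrow> real^'n"
  assumes S: "S = (\<Sum>k\<in>UNIV. (norm (a k))\<^sup>2)"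
  shows "\<exists>G M \<tau>. test_data T (barrier S x0 t1) G M \<tau> \<and> (\<forall>x t. \<tau> (x, t) + heat_op a (M (x, t)) \<le> 0)"
proof -
  have D1: "test_data T (\<lambda>z::(real^'n)\<times>real. 12 * S\<^sup>2 * (t1 - snd z)\<^sup>2) (\<lambda>z. 0) (\<lambda>z. 0) (\<lambda>z. - 24 * S\<^sup>2 * (t1 - snd z))"
    by (rule test_data_time[where f="\<lambda>s. 12 * S\<^sup>2 * (t1 - s)\<^sup>2" and f'="\<lambda>s. - 24 * S\<^sup>2 * (t1 - s)"])
       (auto intro!: derivative_eq_intros continuous_intros simp: algebra_simps)
  have D2: "test_data T (\<lambda>z::(real^'n)\<times>real. 12 * S * (t1 - snd z) * (norm (fst z - x0))\<^sup>2)
     (\<lambda>z. (2 * (12 * S * (t1 - snd z))) *\<^sub>R (fst z - x0)) (\<lambda>z. (2 * (12 * S * (t1 - snd z))) *\<^sub>R mat 1)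
     (\<lambda>z. - 12 * S * (norm (fst z - x0))\<^sup>2)"
    by (rule test_data_square[where f="\<lambda>s. 12 * S * (t1 - s)" and f'="\<lambda>s. - 12 * S"])
       (auto intro!: derivative_eq_intros continuous_intros)
  have "heat_op a (outer (x - x0)) \<le> (norm (x - x0))\<^sup>2 * S" for x
    unfolding S by (rule heat_op_outer_le)
  then have le: "4 * (norm (x - x0))\<^sup>2 * S + 8 * heat_op a (outer (x - x0)) \<le> 12 * S * (norm (x - x0))\<^sup>2" for x
    by (simp add: mult.commute)
  note D = test_data_add[OF test_data_add[OF test_data_quartic[of T x0] D2] D1]
  define M where "M = (\<lambda>z::(real^'n)\<times>real. ((4 * (norm (fst z - x0))\<^sup>2) *\<^sub>R mat 1 + 8 *\<^sub>R outer (fst z - x0))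
     + (2 * (12 * S * (t1 - snd z))) *\<^sub>R mat 1 + (0 :: real^'n^'n))"
  define \<tau> where "\<tau> = (\<lambda>z::(real^'n)\<times>real. 0 + - 12 * S * (norm (fst z - x0))\<^sup>2 + - 24 * S\<^sup>2 * (t1 - snd z))"
  have "\<tau> (x, t) + heat_op a (M (x, t)) \<le> 0" for x t
  proof -
    have "2 * (12 * S * (t1 - t)) * S = 24 * S\<^sup>2 * (t1 - t)" by (simp add: power2_eq_square)
    moreover have "heat_op a (M (x, t)) = 4 * (norm (x - x0))\<^sup>2 * S + 8 * heat_op a (outer (x - x0)) + 2 * (12 * S * (t1 - t)) * S"
      unfolding M_def fst_conv snd_conv heat_op_add heat_op_scale heat_op_mat1 S[symmetric] heat_op_0 by simp
    moreover have "\<tau> (x, t) = - 12 * S * (norm (x - x0))\<^sup>2 - 24 * S\<^sup>2 * (t1 - t)" by (simp add: \<tau>_def)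
    ultimately show ?thesis
      using le[of x] by linarith
  qed
  moreover have "test_data T (barrier S x0 t1) (\<lambda>z. (4 * (norm (fst z - x0))\<^sup>2) *\<^sub>R (fst z - x0) +
      (2 * (12 * S * (t1 - snd z))) *\<^sub>R (fst z - x0) + 0) M \<tau>"
    unfolding barrier_def[abs_def] by (rule D[folded M_def \<tau>_def])
  ultimately show ?thesis by blast
qed

lemma barrier_lower:
  assumes "S \<ge> 0" "0 \<le> t1" "t1 < T" "0 < t" "t < T"
  shows "- 36 * S\<^sup>2 * T\<^sup>2 \<le> barrier S x0 t1 (x, t)"
proof -
  let ?b = "norm (x - x0) ^ 2"
  have "(b + 6 * S * d)\<^sup>2 = b\<^sup>2 + 12 * S * d * b + 36 * S\<^sup>2 * d\<^sup>2" for b d :: real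
    by (simp add: power2_eq_square algebra_simps)
  from this[of ?b "t1 - t"] have 1: "- 36 * S\<^sup>2 * (t1 - t)\<^sup>2 \<le> norm (x - x0) ^ 4 + 12 * S * (t1 - t) * ?b"
    using zero_le_power2[of "?b + 6 * S * (t1 - t)"] by (simp add: power_mult[symmetric])
  show ?thesis
  proof (cases "t \<le> t1")
    case True
    have "0 \<le> 12 * S * (t1 - t) * ?b" "0 \<le> 12 * S\<^sup>2 * (t1 - t)\<^sup>2" "0 \<le> 36 * S\<^sup>2 * T\<^sup>2" "0 \<le> norm (x - x0) ^ 4"
      using True assms by auto
    then show ?thesis unfolding barrier_def fst_conv snd_conv by linarith
  next
    case False
    have "(t1 - t)\<^sup>2 \<le> T\<^sup>2" using False assms by (simp add: abs_le_square_iff[symmetric])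
    then have "36 * S\<^sup>2 * (t1 - t)\<^sup>2 \<le> 36 * S\<^sup>2 * T\<^sup>2" by (intro mult_left_mono) auto
    moreover have "0 \<le> 12 * S\<^sup>2 * (t1 - t)\<^sup>2" by simp
    ultimately show ?thesis using 1 unfolding barrier_def fst_conv snd_conv by linarith
  qed
qed

text \<open>Maximum principle on the whole space; a small multiple of \<open>|x|\<^sup>2 + (2 S + 1) (t1 - t)\<close> forces the
  maximum to be attained and has the strict sign.\<close>

lemma heat_max_bounded:
  fixes a :: "'k::finite \<Rightarrow> real^'n"
  assumes H: "heat_sol T a H G M \<tau>" and t1: "t1 < T" and t0: "0 < t0" "t0 \<le> t1"
    and B: "\<And>x. H (x, t1) \<le> B"
  shows "H (x0, t0) \<le> B"
proof (rule ccontr)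
  assume *: "\<not> H (x0, t0) \<le> B"
  define S where "S = (\<Sum>k\<in>UNIV. (norm (a k))\<^sup>2)"
  have S: "S \<ge> 0" by (simp add: S_def sum_nonneg)
  obtain C where C: "\<And>x t. 0 < t \<Longrightarrow> t < T \<Longrightarrow> \<bar>H (x, t)\<bar> \<le> C"
    using H unfolding heat_sol_def by blast
  have D: "test_data T H G M \<tau>" using H unfolding heat_sol_def by blast
  define \<eta> where "\<eta> = (H (x0, t0) - B) / (2 * ((norm x0)\<^sup>2 + (2 * S + 1) * (t1 - t0) + 1))"
  have P: "0 < (norm x0)\<^sup>2 + (2 * S + 1) * (t1 - t0) + 1"
    using S t0 by (intro add_nonneg_pos add_nonneg_nonneg mult_nonneg_nonneg) auto
  have eta: "\<eta> > 0" using * P by (simp add: \<eta>_def)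
  have "\<eta> * ((norm x0)\<^sup>2 + (2 * S + 1) * (t1 - t0)) \<le> \<eta> * ((norm x0)\<^sup>2 + (2 * S + 1) * (t1 - t0) + 1)"
    using eta by simp
  also have "\<dots> = (H (x0, t0) - B) / 2" using P by (simp add: \<eta>_def field_simps)
  also have "\<dots> < H (x0, t0) - B" using * by simp
  finally have small: "\<eta> * ((norm x0)\<^sup>2 + (2 * S + 1) * (t1 - t0)) < H (x0, t0) - B" .
  define q where "q = (\<lambda>z::(real^'n)\<times>real. \<eta> * (norm (fst z - 0))\<^sup>2 + \<eta> * ((2 * S + 1) * (t1 - snd z)))"
  have D1: "test_data T (\<lambda>z::(real^'n)\<times>real. \<eta> * ((2 * S + 1) * (t1 - snd z))) (\<lambda>z. 0) (\<lambda>z. 0) (\<lambda>z. - \<eta> * (2 * S + 1))"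
    by (rule test_data_time[where f="\<lambda>s. \<eta> * ((2 * S + 1) * (t1 - s))" and f'="\<lambda>s. - \<eta> * (2 * S + 1)"])
       (auto intro!: derivative_eq_intros continuous_intros simp: algebra_simps)
  have D2: "test_data T (\<lambda>z::(real^'n)\<times>real. \<eta> * (norm (fst z - 0))\<^sup>2)
     (\<lambda>z. (2 * \<eta>) *\<^sub>R (fst z - 0)) (\<lambda>z. (2 * \<eta>) *\<^sub>R mat 1) (\<lambda>z. 0 * (norm (fst z - 0))\<^sup>2)"
    by (rule test_data_square[where f="\<lambda>s. \<eta>" and f'="\<lambda>s. 0"]) auto
  note Dq = test_data_diff[OF D test_data_add[OF D2 D1, folded q_def]]
  let ?R = "sqrt ((C + \<bar>B\<bar>) / \<eta>) + norm x0 + 1"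
  let ?K = "cball (0::real^'n) ?R \<times> {t0..t1}"
  have C0: "C \<ge> 0" using C[of t0 x0] t0 t1 by auto
  have sub: "?K \<subseteq> open_cyl T" using t0 t1 by auto
  have cont: "continuous_on ?K (\<lambda>z. H z - q z)"
    by (rule continuous_on_subset[OF test_data_cont[OF Dq] sub])
  have R1: "norm x0 \<le> ?R" using C0 eta by simp
  have ne: "(x0, t0) \<in> ?K" using R1 t0 by auto
  obtain z where z: "z \<in> ?K" "\<And>z'. z' \<in> ?K \<Longrightarrow> H z' - q z' \<le> H z - q z"
    using continuous_attains_sup[OF compact_Times[OF compact_cball compact_Icc] _ cont] ne by blast
  obtain x t where xt: "z = (x, t)" by (cases z)
  have val: "H (x, t) - q (x, t) > B"
    using z(2)[of "(x0, t0)"] R1 t0 small unfolding xt by (auto simp: q_def distrib_left)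
  have t: "t0 \<le> t" "t \<le> t1" using z(1) xt by auto
  have "t \<noteq> t1"
  proof
    assume "t = t1"
    moreover have "0 \<le> \<eta> * (norm x)\<^sup>2" using eta by simp
    ultimately show False using val B[of x] by (simp add: q_def)
  qed
  with t have tt: "t < t1" by simp
  have "norm x < ?R"
  proof -
    have "0 \<le> \<eta> * ((2 * S + 1) * (t1 - t))" using eta S t by auto
    then have "\<eta> * (norm x)\<^sup>2 < C + \<bar>B\<bar>" using val C[of t x] t t0 t1 by (auto simp: q_def)
    then have "(norm x)\<^sup>2 < (C + \<bar>B\<bar>) / \<eta>" using eta by (simp add: pos_less_divide_eq mult.commute)
    then have "norm x < sqrt ((C + \<bar>B\<bar>) / \<eta>)" by (rule real_less_rsqrt)
    moreover have "0 \<le> norm x0" by simp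
    ultimately show ?thesis by linarith
  qed
  define e where "e = min (t1 - t) (?R - norm x)"
  have e: "e > 0" using tt \<open>norm x < ?R\<close> by (auto simp: e_def)
  have T: "0 < t" "t < T" using t t0 t1 by auto
  have max: "(H (x', s) - q (x', s)) + 0 - 0 \<le> (H (x, t) - q (x, t)) + 0 - 0"
    if as: "norm (x' - x) < e" "norm (y' - (0::real^'n)) < e" "t \<le> s" "s < t + e" for x' y' s
  proof -
    have "norm x' \<le> norm x + norm (x' - x)" using norm_triangle_ineq[of x "x' - x"] by simp
    then have "norm x' \<le> ?R" using as(1) by (simp add: e_def)
    then show ?thesis using z(2)[of "(x', s)"] as t xt by (auto simp: e_def)
  qed
  have q0: "(0::real) = 0 + 0 * s + 0 * s\<^sup>2" for s :: real by simp
  note R = two_point_max[where a=a and b="\<lambda>k. 0" and q="\<lambda>x y. 0" and l="\<lambda>k. 0" and m="\<lambda>k. 0",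
      OF Dq test_data_const[of T 0] T e q0 max]
  then have "\<tau> (x, t) + \<eta> * (2 * S + 1) + heat_op a (M (x, t) - (2 * \<eta>) *\<^sub>R mat 1) \<le> 0"
    by (simp add: heat_op_def)
  moreover have "\<tau> (x, t) + heat_op a (M (x, t)) = 0" using H T unfolding heat_sol_def by blast
  ultimately have "\<eta> * (2 * S + 1) - 2 * \<eta> * S \<le> 0"
    by (simp add: heat_op_diff heat_op_scale heat_op_mat1 S_def[symmetric])
  then show False using eta by (simp add: algebra_simps)
qed

lemma heat_sol_uminus:
  assumes "heat_sol T a H G M \<tau>"
  shows "heat_sol T a (\<lambda>z. - H z) (\<lambda>z. - G z) (\<lambda>z. - M z) (\<lambda>z. - \<tau> z)"
proof -
  have neg: "heat_op a (- M z) = - heat_op a (M z)" for z using heat_op_scale[of a "-1" "M z"] by simp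
  have "test_data T H G M \<tau>" "\<And>x t. 0 < t \<Longrightarrow> t < T \<Longrightarrow> \<tau> (x, t) + heat_op a (M (x, t)) = 0"
    "\<exists>C. \<forall>x t. 0 < t \<longrightarrow> t < T \<longrightarrow> \<bar>H (x, t)\<bar> \<le> C"
    using assms unfolding heat_sol_def by blast+
  moreover have "- \<tau> (x, t) + heat_op a (- M (x, t)) = 0" if "0 < t" "t < T" for x t
    using neg[of "(x, t)"] assms that unfolding heat_sol_def by (smt (verit))
  ultimately show ?thesis using test_data_scale[of T H G M \<tau> "-1"]
    unfolding heat_sol_def by simp
qed

lemma heat_abs_bounded:
  fixes a :: "'k::finite \<Rightarrow> real^'n"
  assumes H: "heat_sol T a H G M \<tau>" and t1: "t1 < T" and t0: "0 < t0" "t0 \<le> t1"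
    and B: "\<And>x. \<bar>H (x, t1)\<bar> \<le> B"
  shows "\<bar>H (x0, t0)\<bar> \<le> B"
  using heat_max_bounded[OF H t1 t0, of B x0] heat_max_bounded[OF heat_sol_uminus[OF H] t1 t0, of B x0] B
  by (simp add: abs_le_iff)

lemma quartic_below_bounded:
  fixes \<psi> :: "(real^'n) \<times> real \<Rightarrow> real"
  assumes "\<And>x t. 0 < t \<Longrightarrow> t < T \<Longrightarrow> C \<le> \<psi> (x, t)"
  shows "quartic_below T \<psi>"
  unfolding quartic_below_def
proof (intro exI allI ballI)
  fix x :: "real^'n" and t assume "t \<in> {0<..<T}"
  then have "C \<le> \<psi> (x, t)" using assms by auto
  moreover have "\<bar>C\<bar> * 1 \<le> \<bar>C\<bar> * (1 + norm x ^ 4)" by (intro mult_left_mono) auto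
  ultimately show "- \<bar>C\<bar> * (1 + norm x ^ 4) \<le> \<psi> (x, t)" by simp
qed

text \<open>The function \<open>max(0, t0 - s)\<^sup>2\<close> is continuously differentiable and nonincreasing. It can therefore close
  a cylinder below time \<open>t0\<close> without spoiling a supersolution and without contributing after \<open>t0\<close>.\<close>

lemma max_square_deriv: "((\<lambda>s::real. (max 0 (t0 - s))\<^sup>2) has_real_derivative - 2 * max 0 (t0 - t)) (at t)"
proof -
  consider "t < t0" | "t > t0" | "t = t0" by linarith
  then show ?thesis
  proof cases
    case 1
    have "((\<lambda>s. (t0 - s)\<^sup>2) has_real_derivative - 2 * (t0 - t)) (at t)"
      by (auto intro!: derivative_eq_intros)
    then show ?thesis
      using has_field_derivative_transform_within_open[of "\<lambda>s. (t0 - s)\<^sup>2" _ t "{..<t0}"] 1 by simp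
  next
    case 2
    have "((\<lambda>s. 0::real) has_real_derivative 0) (at t)" by simp
    then show ?thesis
      using has_field_derivative_transform_within_open[of "\<lambda>s. 0::real" _ t "{t0<..}"] 2 by simp
  next
    case 3
    have "((\<lambda>h. ((max 0 (t0 - (t0 + h)))\<^sup>2 - (max 0 (t0 - t0))\<^sup>2) / h) \<longlongrightarrow> 0) (at (0::real))"
    proof (rule Lim_null_comparison)
      show "\<forall>\<^sub>F h in at (0::real). norm (((max 0 (t0 - (t0 + h)))\<^sup>2 - (max 0 (t0 - t0))\<^sup>2) / h) \<le> \<bar>h\<bar>"
        unfolding eventually_at_filter
        by (rule always_eventually) (simp add: max_def power2_eq_square)
      show "((\<lambda>h. \<bar>h\<bar>) \<longlongrightarrow> 0) (at (0::real))" by (auto intro!: tendsto_eq_intros)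
    qed
    then show ?thesis using 3 by (simp add: DERIV_def)
  qed
qed

text \<open>Comparison of a viscosity subsolution with a smooth solution: the latter, corrected by
  \<open>\<epsilon> + (c + \<eta>) (t1 - t)\<close>, by the barrier on the sides and by \<^term>\<open>\<lambda>t::real. (max 0 (t0 - t))\<^sup>2\<close> on the bottom,
  is a strict supersolution, so no interior contact is possible.\<close>

lemma linear_sub_le_heat:
  fixes a :: "'k::finite \<Rightarrow> real^'n"
  assumes sub: "linear_sub T a c x0 t0 \<rho> U"
    and r: "0 < R" "R < \<rho>" "0 < t0 - \<rho>" "t0 + \<rho> < T" and t1: "t0 < t1" "t1 < t0 + \<rho>"
    and cont: "continuous_on (cball x0 R \<times> {t0 - \<rho> / 2..t1}) U"
    and UB: "\<And>x t. x \<in> cball x0 R \<Longrightarrow> t \<in> {t0 - \<rho> / 2..t1} \<Longrightarrow> U (x, t) \<le> B"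
    and H: "heat_sol T a H G M \<tau>"
    and HB: "\<And>x t. x \<in> cball x0 R \<Longrightarrow> t \<in> {t0 - \<rho> / 2..t1} \<Longrightarrow> - B \<le> H (x, t)"
    and init: "\<And>x. x \<in> cball x0 R \<Longrightarrow> U (x, t1) \<le> H (x, t1) + \<epsilon>"
    and pos: "\<epsilon> \<ge> 0" "\<eta> > 0" "B \<ge> 0" and S: "S = (\<Sum>k\<in>UNIV. (norm (a k))\<^sup>2)"
  shows "U (x0, t0) \<le> H (x0, t0) + \<epsilon> + (c + \<eta>) * (t1 - t0) + (2 * B + 2 * \<bar>c\<bar> * \<rho>) / R ^ 4 * (12 * S\<^sup>2 * (t1 - t0)\<^sup>2)"
proof (rule ccontr)
  assume contra: "\<not> ?thesis"
  \<comment> \<open>\<open>N\<close> bounds the possible excess on the sides and on the bottom of the cylinder; \<open>K\<close> and \<open>L\<close> lift the two correction terms to that height there.\<close>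
  define N where "N = 2 * B + 2 * \<bar>c\<bar> * \<rho>"
  define K where "K = N / R ^ 4"
  define L where "L = N / (\<rho> / 2)\<^sup>2"
  have rho: "\<rho> > 0" using r by simp
  have N: "N \<ge> 0" using pos rho by (simp add: N_def)
  have K: "K \<ge> 0" using N r by (simp add: K_def)
  have L: "L \<ge> 0" using N by (simp add: L_def)
  have S0: "S \<ge> 0" unfolding S by (simp add: sum_nonneg)
  define f where "f = (\<lambda>t. \<epsilon> + (c + \<eta>) * (t1 - t) + L * (max 0 (t0 - t))\<^sup>2)"
  define \<psi> where "\<psi> = (\<lambda>z. (H z + f (snd z)) + K * barrier S x0 t1 z)"
  obtain GB MB \<tau>B where Bd: "test_data T (barrier S x0 t1) GB MB \<tau>B"
    and Bh: "\<And>x t. \<tau>B (x, t) + heat_op a (MB (x, t)) \<le> 0"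
    using barrier_test_data[OF S, of T x0 t1] by blast
  have Df: "test_data T (\<lambda>z::(real^'n)\<times>real. f (snd z)) (\<lambda>z. 0) (\<lambda>z. 0) (\<lambda>z. - (c + \<eta>) - 2 * L * max 0 (t0 - snd z))"
  proof (rule test_data_time)
    fix t
    have "((\<lambda>s. \<epsilon> + (c + \<eta>) * (t1 - s)) has_real_derivative - (c + \<eta>)) (at t)"
      by (auto intro!: derivative_eq_intros)
    from DERIV_add[OF this DERIV_cmult[OF max_square_deriv, of L t0 t]]
    show "(f has_real_derivative - (c + \<eta>) - 2 * L * max 0 (t0 - t)) (at t)"
      unfolding f_def by (simp add: mult_ac)
  qed (intro continuous_intros)
  have Hd: "test_data T H G M \<tau>" using H unfolding heat_sol_def by blast
  note D = test_data_add[OF test_data_add[OF Hd Df] test_data_scale[OF Bd, of K], folded \<psi>_def]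
  let ?K = "cball x0 R \<times> {t0 - \<rho> / 2..t1}"
  have sub': "?K \<subseteq> open_cyl T" using r t1 by auto
  have c1: "continuous_on ?K (\<lambda>z. U z - \<psi> z)"
    by (intro continuous_on_diff cont continuous_on_subset[OF test_data_cont[OF D] sub'])
  have ne: "(x0, t0) \<in> ?K" using r t1 by auto
  obtain z where z: "z \<in> ?K" "\<And>z'. z' \<in> ?K \<Longrightarrow> U z' - \<psi> z' \<le> U z - \<psi> z"
    using continuous_attains_sup[OF compact_Times[OF compact_cball compact_Icc] _ c1] ne by blast
  obtain x t where xt: "z = (x, t)" by (cases z)
  have x: "norm (x - x0) \<le> R" "x \<in> cball x0 R" and t: "t0 - \<rho> / 2 \<le> t" "t \<le> t1"
    using z(1) xt by (auto simp: dist_norm norm_minus_commute)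
  have "\<psi> (x0, t0) = H (x0, t0) + \<epsilon> + (c + \<eta>) * (t1 - t0) + K * (12 * S\<^sup>2 * (t1 - t0)\<^sup>2)"
    by (simp add: \<psi>_def f_def barrier_def)
  then have "U (x0, t0) - \<psi> (x0, t0) > 0"
    using contra unfolding K_def N_def by simp
  then have val: "U (x, t) - \<psi> (x, t) > 0" using z(2)[OF ne] xt by auto
  have tc: "- (2 * \<bar>c\<bar> * \<rho>) \<le> (c + \<eta>) * (t1 - t)"
  proof -
    have "\<bar>c\<bar> * (t1 - t) \<le> \<bar>c\<bar> * (2 * \<rho>)" by (rule mult_left_mono) (use t t1 rho in auto)
    moreover have "- (\<bar>c\<bar> * (t1 - t)) \<le> (c + \<eta>) * (t1 - t)"
      using mult_right_mono[of "- \<bar>c\<bar>" "c + \<eta>" "t1 - t"] t pos by auto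
    ultimately show ?thesis by linarith
  qed
  have bar: "norm (x - x0) ^ 4 \<le> barrier S x0 t1 (x, t)"
    using t S0 by (simp add: barrier_def)
  have "t \<noteq> t1"
  proof
    assume *: "t = t1"
    have "0 \<le> K * barrier S x0 t1 (x, t1)" using K by (auto simp: barrier_def)
    moreover have "0 \<le> L * (max 0 (t0 - t1))\<^sup>2" using L by simp
    ultimately show False using init[OF x(2)] val * by (simp add: \<psi>_def f_def)
  qed
  moreover have "norm (x - x0) \<noteq> R"
  proof
    assume *: "norm (x - x0) = R"
    have "K * R ^ 4 \<le> K * barrier S x0 t1 (x, t)" using bar K * by (intro mult_left_mono) auto
    moreover have "K * R ^ 4 = N" using r by (simp add: K_def)
    moreover have "0 \<le> L * (max 0 (t0 - t))\<^sup>2" using L by simp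
    ultimately have "H (x, t) + 2 * B \<le> \<psi> (x, t)"
      using tc pos unfolding \<psi>_def f_def N_def by simp
    then show False using val UB[OF x(2), of t] HB[OF x(2), of t] t by auto
  qed
  moreover have "t \<noteq> t0 - \<rho> / 2"
  proof
    assume *: "t = t0 - \<rho> / 2"
    have "0 \<le> K * barrier S x0 t1 (x, t)"
      using bar K by (intro mult_nonneg_nonneg) (auto intro: order_trans[rotated])
    moreover have "L * (max 0 (t0 - t))\<^sup>2 = N" using rho * by (simp add: L_def)
    ultimately have "H (x, t) + 2 * B \<le> \<psi> (x, t)"
      using tc pos unfolding \<psi>_def f_def N_def by simp
    then show False using val UB[OF x(2), of t] HB[OF x(2), of t] t by auto
  qed
  ultimately have int: "norm (x - x0) < R" "t0 - \<rho> / 2 < t" "t < t1" using x t by auto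
  define e where "e = min (R - norm (x - x0)) (min (t - (t0 - \<rho> / 2)) (t1 - t))"
  have e: "e > 0" using int by (simp add: e_def)
  obtain C where C: "\<And>x t. 0 < t \<Longrightarrow> t < T \<Longrightarrow> \<bar>H (x, t)\<bar> \<le> C"
    using H unfolding heat_sol_def by blast
  have t1T: "0 < t1" "t1 < T" using r t1 by auto
  have qb: "quartic_below T \<psi>"
  proof (rule quartic_below_bounded)
    fix x t assume tt: "0 < t" "t < T"
    have "K * (- 36 * S\<^sup>2 * T\<^sup>2) \<le> K * barrier S x0 t1 (x, t)"
      by (rule mult_left_mono[OF barrier_lower K]) (use S0 t1T tt in auto)
    moreover have "\<bar>c + \<eta>\<bar> * \<bar>t1 - t\<bar> \<le> \<bar>c + \<eta>\<bar> * T"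
      by (rule mult_left_mono) (use t1T tt in auto)
    then have "- \<bar>c + \<eta>\<bar> * T \<le> (c + \<eta>) * (t1 - t)" by (simp add: abs_mult[symmetric] abs_le_iff)
    moreover have "0 \<le> L * (max 0 (t0 - t))\<^sup>2" using L by simp
    ultimately show "- C + - \<bar>c + \<eta>\<bar> * T + K * (- 36 * S\<^sup>2 * T\<^sup>2) \<le> \<psi> (x, t)"
      using C[OF tt, of x] pos unfolding \<psi>_def f_def snd_conv by linarith
  qed
  have "0 \<le> (\<tau> (x, t) + (- (c + \<eta>) - 2 * L * max 0 (t0 - snd (x, t))) + K * \<tau>B (x, t))
      + heat_op a (M (x, t) + 0 + K *\<^sub>R MB (x, t)) + c"
  proof (rule sub[unfolded linear_sub_def, rule_format, OF D qb _ _ e])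
    show "norm (x - x0) < \<rho>" "\<bar>t - t0\<bar> < \<rho>" using int r t1 by auto
    fix y s assume "norm (y - x) < e" "\<bar>s - t\<bar> < e"
    moreover have "norm (y - x0) \<le> norm (y - x) + norm (x - x0)"
      using norm_triangle_ineq[of "y - x" "x - x0"] by simp
    ultimately have "(y, s) \<in> ?K" by (auto simp: e_def dist_norm norm_minus_commute)
    then show "U (y, s) - \<psi> (y, s) \<le> U (x, t) - \<psi> (x, t)" using z(2) xt by blast
  qed
  moreover have "\<tau> (x, t) + heat_op a (M (x, t)) = 0"
    using H int r t1 unfolding heat_sol_def by auto
  moreover have "K * (\<tau>B (x, t) + heat_op a (MB (x, t))) \<le> 0"
    using Bh K by (simp add: mult_nonneg_nonpos)
  moreover have "0 \<le> L * max 0 (t0 - t)" using L by simp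
  ultimately show False using pos by (simp add: heat_op_add heat_op_scale heat_op_0 algebra_simps)
qed

section \<open>A theorem on sums for constant coefficients\<close>

text \<open>The quadratic majorants used in doubling: isotropic in the difference \<open>w1 - w2\<close> plus a small multiple of the
  identity. Isotropy is enough because constant factors in the second order terms are absorbed later.\<close>

definition quad_bound ::
  "real \<Rightarrow> real^'n \<Rightarrow> real^'n \<Rightarrow> real \<Rightarrow> real \<Rightarrow> real^'n \<Rightarrow> real^'n \<Rightarrow> real" where
  "quad_bound m \<nu>1 \<nu>2 \<alpha> \<gamma> w1 w2 = m + \<nu>1 \<bullet> w1 + \<nu>2 \<bullet> w2 + \<alpha> * (norm (w1 - w2))\<^sup>2
     + \<gamma> * ((norm w1)\<^sup>2 + (norm w2)\<^sup>2)"

lemma norm_add_scaled_sq: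
  "(norm (w + s *\<^sub>R v))\<^sup>2 = (norm w)\<^sup>2 + 2 * (w \<bullet> v) * s + (norm v)\<^sup>2 * s\<^sup>2"
  for w :: "'a::real_inner"
  unfolding power2_norm_eq_inner
  by (simp add: inner_add_left inner_add_right inner_commute algebra_simps power2_eq_square)

lemma quad_bound_line:
  "quad_bound m \<nu>1 \<nu>2 \<alpha> \<gamma> (w1 + s *\<^sub>R a) (w2 + s *\<^sub>R b) = quad_bound m \<nu>1 \<nu>2 \<alpha> \<gamma> w1 w2
     + (\<nu>1 \<bullet> a + \<nu>2 \<bullet> b + 2 * \<alpha> * ((w1 - w2) \<bullet> (a - b)) + 2 * \<gamma> * (w1 \<bullet> a + w2 \<bullet> b)) * s
     + (\<alpha> * (norm (a - b))\<^sup>2 + \<gamma> * ((norm a)\<^sup>2 + (norm b)\<^sup>2)) * s\<^sup>2"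
proof -
  have "w1 + s *\<^sub>R a - (w2 + s *\<^sub>R b) = (w1 - w2) + s *\<^sub>R (a - b)" by (simp add: algebra_simps)
  then show ?thesis unfolding quad_bound_def norm_add_scaled_sq
    by (simp only: norm_add_scaled_sq inner_add_right inner_scaleR_right) (simp add: algebra_simps)
qed

text \<open>The trace of the Hessian of \<^const>\<open>quad_bound\<close> along the coupled directions \<open>(a\<^sub>k, b\<^sub>k)\<close>; the singular part
  sees only the differences \<open>a\<^sub>k - b\<^sub>k\<close>.\<close>

definition coupling_cost :: "('k::finite \<Rightarrow> real^'n) \<Rightarrow> ('k \<Rightarrow> real^'n) \<Rightarrow> real \<Rightarrow> real \<Rightarrow> real" where
  "coupling_cost a b \<alpha> \<gamma> = (\<Sum>k\<in>UNIV. 2 * (\<alpha> * (norm (a k - b k))\<^sup>2 + \<gamma> * ((norm (a k))\<^sup>2 + (norm (b k))\<^sup>2)))"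

text \<open>The function \<open>H1(x) + H2(y)\<close> solves the heat equation in the directions \<open>(a\<^sub>k, b\<^sub>k)\<close> of the doubled space, since
  it has no mixed derivatives. Under that equation a quadratic function grows at the rate of its trace.\<close>

lemma heat_pair_le_quad:
  fixes a b :: "'k::finite \<Rightarrow> real^'n"
  assumes H1: "heat_sol T a H1 G1 M1 \<tau>1" and H2: "heat_sol T b H2 G2 M2 \<tau>2"
    and t: "0 < t0" "t0 \<le> t1" "t1 < T" and R: "R > 0"
    and ag: "\<alpha> \<ge> 0" "\<gamma> \<ge> 0" and pos: "B \<ge> 0" "\<eta> > 0"
    and init: "\<And>x y. x \<in> cball x0 R \<Longrightarrow> y \<in> cball y0 R \<Longrightarrow>
       H1 (x, t1) + H2 (y, t1) \<le> quad_bound m \<nu>1 \<nu>2 \<alpha> \<gamma> (x - x0) (y - y0)"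
    and HB: "\<And>x y t. x \<in> cball x0 R \<Longrightarrow> y \<in> cball y0 R \<Longrightarrow> t \<in> {t0..t1} \<Longrightarrow> H1 (x, t) + H2 (y, t) \<le> B"
    and qB: "\<And>x y. x \<in> cball x0 R \<Longrightarrow> y \<in> cball y0 R \<Longrightarrow> - B \<le> quad_bound m \<nu>1 \<nu>2 \<alpha> \<gamma> (x - x0) (y - y0)"
    and S1: "S1 = (\<Sum>k\<in>UNIV. (norm (a k))\<^sup>2)" and S2: "S2 = (\<Sum>k\<in>UNIV. (norm (b k))\<^sup>2)"
  shows "H1 (x0, t0) + H2 (y0, t0) \<le> m + (coupling_cost a b \<alpha> \<gamma> + \<eta>) * (t1 - t0)
     + 2 * B / R ^ 4 * (12 * S1\<^sup>2 * (t1 - t0)\<^sup>2 + 12 * S2\<^sup>2 * (t1 - t0)\<^sup>2)"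
proof (rule ccontr)
  assume contra: "\<not> ?thesis"
  define K where "K = 2 * B / R ^ 4"
  define Q where "Q = coupling_cost a b \<alpha> \<gamma>"
  have K: "K \<ge> 0" using pos R by (simp add: K_def)
  have Q: "Q \<ge> 0" unfolding Q_def coupling_cost_def using ag by (intro sum_nonneg) simp
  have S0: "S1 \<ge> 0" "S2 \<ge> 0" unfolding S1 S2 by (simp_all add: sum_nonneg)
  let ?q = "\<lambda>x y. quad_bound m \<nu>1 \<nu>2 \<alpha> \<gamma> (x - x0) (y - y0)"
  define \<psi>1 where "\<psi>1 = (\<lambda>z. (H1 z - (Q + \<eta>) * (t1 - snd z)) - K * barrier S1 x0 t1 z)"
  define \<psi>2 where "\<psi>2 = (\<lambda>z. H2 z - K * barrier S2 y0 t1 z)"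
  obtain GB1 MB1 \<tau>B1 where Bd1: "test_data T (barrier S1 x0 t1) GB1 MB1 \<tau>B1"
    and Bh1: "\<And>x t. \<tau>B1 (x, t) + heat_op a (MB1 (x, t)) \<le> 0"
    using barrier_test_data[OF S1, of T x0 t1] by blast
  obtain GB2 MB2 \<tau>B2 where Bd2: "test_data T (barrier S2 y0 t1) GB2 MB2 \<tau>B2"
    and Bh2: "\<And>x t. \<tau>B2 (x, t) + heat_op b (MB2 (x, t)) \<le> 0"
    using barrier_test_data[OF S2, of T y0 t1] by blast
  have Hd: "test_data T H1 G1 M1 \<tau>1" "test_data T H2 G2 M2 \<tau>2"
    using H1 H2 unfolding heat_sol_def by blast+
  have Df: "test_data T (\<lambda>z::(real^'n)\<times>real. (Q + \<eta>) * (t1 - snd z)) (\<lambda>z. 0) (\<lambda>z. 0) (\<lambda>z. - (Q + \<eta>))"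
    by (rule test_data_time[where f="\<lambda>s. (Q + \<eta>) * (t1 - s)" and f'="\<lambda>s. - (Q + \<eta>)"])
       (auto intro!: derivative_eq_intros)
  note D1 = test_data_diff[OF test_data_diff[OF Hd(1) Df] test_data_scale[OF Bd1, of K], folded \<psi>1_def]
  note D2 = test_data_diff[OF Hd(2) test_data_scale[OF Bd2, of K], folded \<psi>2_def]
  let ?K = "(cball x0 R \<times> cball y0 R) \<times> {t0..t1}"
  let ?D = "\<lambda>p. \<psi>1 (fst (fst p), snd p) + \<psi>2 (snd (fst p), snd p) - ?q (fst (fst p)) (snd (fst p))"
  have c: "continuous_on ?K ?D"
  proof (intro continuous_on_diff continuous_on_add)
    show "continuous_on ?K (\<lambda>p. \<psi>1 (fst (fst p), snd p))"
      by (rule continuous_on_compose2[OF test_data_cont[OF D1]]) (use t in \<open>auto intro!: continuous_intros\<close>)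
    show "continuous_on ?K (\<lambda>p. \<psi>2 (snd (fst p), snd p))"
      by (rule continuous_on_compose2[OF test_data_cont[OF D2]]) (use t in \<open>auto intro!: continuous_intros\<close>)
    show "continuous_on ?K (\<lambda>p. ?q (fst (fst p)) (snd (fst p)))"
      unfolding quad_bound_def by (intro continuous_intros)
  qed
  have ne: "((x0, y0), t0) \<in> ?K" using R t by auto
  have comp: "compact ?K" by (intro compact_Times compact_cball compact_Icc)
  obtain z where z: "z \<in> ?K" "\<And>z'. z' \<in> ?K \<Longrightarrow> ?D z' \<le> ?D z"
    using continuous_attains_sup[OF comp _ c] ne by blast
  obtain x y t where xyt: "z = ((x, y), t)" by (metis surj_pair)
  have x: "norm (x - x0) \<le> R" "x \<in> cball x0 R" and y: "norm (y - y0) \<le> R" "y \<in> cball y0 R"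
    and tt: "t0 \<le> t" "t \<le> t1"
    using z(1) xyt by (auto simp: dist_norm norm_minus_commute)
  have "?D ((x0, y0), t0) > 0"
    using contra unfolding K_def[symmetric] Q_def[symmetric]
    by (simp add: \<psi>1_def \<psi>2_def barrier_def quad_bound_def algebra_simps)
  then have val: "\<psi>1 (x, t) + \<psi>2 (y, t) - ?q x y > 0" using z(2)[OF ne] xyt by simp
  have bar: "norm (x - x0) ^ 4 \<le> barrier S1 x0 t1 (x, t)" "norm (y - y0) ^ 4 \<le> barrier S2 y0 t1 (y, t)"
    using tt S0 by (simp_all add: barrier_def)
  have bar0: "0 \<le> K * barrier S1 x0 t1 (x, t)" "0 \<le> K * barrier S2 y0 t1 (y, t)"
    using bar K by (auto intro!: mult_nonneg_nonneg intro: order_trans[rotated])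
  have lin: "0 \<le> (Q + \<eta>) * (t1 - t)" using Q pos tt by simp
  have KR: "K * R ^ 4 = 2 * B" using R by (simp add: K_def)
  have "t \<noteq> t1"
    using init[OF x(2) y(2)] val bar0 lin by (auto simp: \<psi>1_def \<psi>2_def)
  moreover have "norm (x - x0) \<noteq> R"
  proof
    assume *: "norm (x - x0) = R"
    have "K * R ^ 4 \<le> K * barrier S1 x0 t1 (x, t)" using bar K * by (intro mult_left_mono) auto
    then show False
      using val HB[OF x(2) y(2), of t] qB[OF x(2) y(2)] tt KR bar0 lin by (simp add: \<psi>1_def \<psi>2_def)
  qed
  moreover have "norm (y - y0) \<noteq> R"
  proof
    assume *: "norm (y - y0) = R"
    have "K * R ^ 4 \<le> K * barrier S2 y0 t1 (y, t)" using bar K * by (intro mult_left_mono) auto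
    then show False
      using val HB[OF x(2) y(2), of t] qB[OF x(2) y(2)] tt KR bar0 lin by (simp add: \<psi>1_def \<psi>2_def)
  qed
  ultimately have int: "norm (x - x0) < R" "norm (y - y0) < R" "t < t1" using x y tt by auto
  define e where "e = min (R - norm (x - x0)) (min (R - norm (y - y0)) (t1 - t))"
  have e: "e > 0" using int by (simp add: e_def)
  have T: "0 < t" "t < T" using tt t by auto
  have max: "\<psi>1 (x', s) + \<psi>2 (y', s) - ?q x' y' \<le> \<psi>1 (x, t) + \<psi>2 (y, t) - ?q x y"
    if as: "norm (x' - x) < e" "norm (y' - y) < e" "t \<le> s" "s < t + e" for x' y' s
  proof -
    have "norm (x' - x0) \<le> norm (x' - x) + norm (x - x0)" "norm (y' - y0) \<le> norm (y' - y) + norm (y - y0)"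
      using norm_triangle_ineq[of "x' - x" "x - x0"] norm_triangle_ineq[of "y' - y" "y - y0"] by simp_all
    then have "((x', y'), s) \<in> ?K" using as tt by (auto simp: e_def dist_norm norm_minus_commute)
    then show ?thesis using z(2)[of "((x', y'), s)"] xyt by simp
  qed
  have line: "?q (x + s *\<^sub>R a k) (y + s *\<^sub>R b k) = ?q x y
     + (\<nu>1 \<bullet> a k + \<nu>2 \<bullet> b k + 2 * \<alpha> * ((x - x0 - (y - y0)) \<bullet> (a k - b k)) + 2 * \<gamma> * ((x - x0) \<bullet> a k + (y - y0) \<bullet> b k)) * s
     + (\<alpha> * (norm (a k - b k))\<^sup>2 + \<gamma> * ((norm (a k))\<^sup>2 + (norm (b k))\<^sup>2)) * s\<^sup>2" for k s
  proof -
    have "x + s *\<^sub>R a k - x0 = (x - x0) + s *\<^sub>R a k" "y + s *\<^sub>R b k - y0 = (y - y0) + s *\<^sub>R b k" by simp_all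
    then show ?thesis by (simp only: quad_bound_line)
  qed
  from two_point_max[OF D1 D2 T e, where q="?q" and a=a and b=b, OF line max]
  have "\<tau>1 (x, t) + (Q + \<eta>) - K * \<tau>B1 (x, t) + (\<tau>2 (y, t) - K * \<tau>B2 (y, t)) +
     (heat_op a (M1 (x, t) - 0 - K *\<^sub>R MB1 (x, t)) + heat_op b (M2 (y, t) - K *\<^sub>R MB2 (y, t))) \<le> Q"
    unfolding Q_def coupling_cost_def heat_op_def by (simp add: sum.distrib)
  moreover have "\<tau>1 (x, t) + heat_op a (M1 (x, t)) = 0" "\<tau>2 (y, t) + heat_op b (M2 (y, t)) = 0"
    using H1 H2 T unfolding heat_sol_def by blast+
  moreover have "K * (\<tau>B1 (x, t) + heat_op a (MB1 (x, t))) \<le> 0" "K * (\<tau>B2 (y, t) + heat_op b (MB2 (y, t))) \<le> 0"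
    using Bh1 Bh2 K by (simp_all add: mult_nonneg_nonpos)
  ultimately show False using pos by (simp add: heat_op_diff heat_op_scale heat_op_0 algebra_simps)
qed

text \<open>The theorem on sums for constant coefficients, in trace form. Over a time step \<open>s\<close> each function lies below the heat evolution of its own values at \<open>t0 + s\<close>,
  the sum of the two evolutions lies below the evolution of the quadratic majorant, and all errors are
  of order \<open>s\<^sup>2\<close>. Comparing coefficients of \<open>s\<close> gives the claim. Probabilistically, the two diffusions are driven
  by the same noise.\<close>

lemma linear_theorem_on_sums:
  fixes a b :: "'k::finite \<Rightarrow> real^'n"
  assumes sub1: "linear_sub T a c1 x0 t0 \<rho> U1" and sub2: "linear_sub T b c2 y0 t0 \<rho> U2"
    and r: "\<rho> > 0" "0 < t0 - \<rho>" "t0 + \<rho> < T"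
    and cont1: "continuous_on (cball x0 \<rho> \<times> {t0 - \<rho>..t0 + \<rho>}) U1"
    and cont2: "continuous_on (cball y0 \<rho> \<times> {t0 - \<rho>..t0 + \<rho>}) U2"
    and ag: "\<alpha> \<ge> 0" "\<gamma> \<ge> 0"
    and contact: "\<And>w1 w2 s. norm w1 \<le> \<rho> \<Longrightarrow> norm w2 \<le> \<rho> \<Longrightarrow> 0 \<le> s \<Longrightarrow> s \<le> \<rho> \<Longrightarrow>
      U1 (x0 + w1, t0 + s) + U2 (y0 + w2, t0 + s) \<le>
        quad_bound (U1 (x0, t0) + U2 (y0, t0) + \<tau> * s) \<nu>1 \<nu>2 \<alpha> \<gamma> w1 w2"
  shows "0 \<le> \<tau> + c1 + c2 + coupling_cost a b \<alpha> \<gamma>"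
proof -
  define S1 where "S1 = (\<Sum>k\<in>UNIV. (norm (a k))\<^sup>2)"
  define S2 where "S2 = (\<Sum>k\<in>UNIV. (norm (b k))\<^sup>2)"
  define Q where "Q = coupling_cost a b \<alpha> \<gamma>"
  define m0 where "m0 = U1 (x0, t0) + U2 (y0, t0)"
  let ?C1 = "cball x0 \<rho> \<times> {t0 - \<rho>..t0 + \<rho>}" and ?C2 = "cball y0 \<rho> \<times> {t0 - \<rho>..t0 + \<rho>}"
  have "bounded (U1 ` ?C1)" "bounded (U2 ` ?C2)"
    by (intro compact_imp_bounded compact_continuous_image cont1 cont2 compact_Times compact_cball compact_Icc)+
  then obtain B1 B2 where "\<And>z. z \<in> ?C1 \<Longrightarrow> \<bar>U1 z\<bar> \<le> B1" "\<And>z. z \<in> ?C2 \<Longrightarrow> \<bar>U2 z\<bar> \<le> B2"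
    unfolding bounded_iff by (metis imageI real_norm_def)
  then have UB: "\<And>z. z \<in> ?C1 \<Longrightarrow> \<bar>U1 z\<bar> \<le> max 0 (max B1 B2)" "\<And>z. z \<in> ?C2 \<Longrightarrow> \<bar>U2 z\<bar> \<le> max 0 (max B1 B2)"
    by (meson le_max_iff_disj)+
  define B where "B = max 0 (max B1 B2) + 1"
  have B: "B \<ge> 1" by (simp add: B_def)
  have UB': "\<And>z. z \<in> ?C1 \<Longrightarrow> \<bar>U1 z\<bar> \<le> B - 1" "\<And>z. z \<in> ?C2 \<Longrightarrow> \<bar>U2 z\<bar> \<le> B - 1" using UB by (simp_all add: B_def)
  define n where "n = real CARD('n)"
  have n: "n \<ge> 1" unfolding n_def using one_le_card_finite[where 'a='n] by linarith
  \<comment> \<open>The box onto which \<^const>\<open>clamp_sin\<close> retracts has to fit into the ball of radius \<open>\<rho>\<close>.\<close>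
  define R where "R = \<rho> / (2 * n)"
  have R: "R > 0" "R < \<rho>" "n * (2 * R) \<le> \<rho>"
    using n r by (auto simp: R_def divide_less_eq)
  define B' where "B' = 2 * B + \<bar>m0\<bar> + \<bar>\<tau>\<bar> * \<rho> + (norm \<nu>1 + norm \<nu>2) * \<rho>"
  have B': "B' \<ge> 0" "B' \<ge> 2 * B" using B r by (auto simp: B'_def)
  define C where "C = (2 * B + 2 * \<bar>c1\<bar> * \<rho>) / R ^ 4 * (12 * S1\<^sup>2) + (2 * B + 2 * \<bar>c2\<bar> * \<rho>) / R ^ 4 * (12 * S2\<^sup>2)
     + 2 * B' / R ^ 4 * (12 * S1\<^sup>2 + 12 * S2\<^sup>2)"
  have C: "C \<ge> 0" unfolding C_def using B B' R r
    by (intro add_nonneg_nonneg mult_nonneg_nonneg divide_nonneg_nonneg) auto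
  have main: "0 \<le> (\<tau> + c1 + c2 + Q) + (C + 7) * s" if s: "0 < s" "s \<le> \<rho> / 2" "s \<le> 1" for s
  proof -
    define t1 where "t1 = t0 + s"
    have t1: "t0 < t1" "t1 < t0 + \<rho>" "t1 \<le> t0 + \<rho>" "0 < t0" "t0 \<le> t1" "t1 < T" using s r by (auto simp: t1_def)
    \<comment> \<open>Both the approximation error and the slack \<open>\<eta> = s\<close> in the growth rate then cost only \<open>O(s\<^sup>2)\<close>.\<close>
    define \<epsilon> where "\<epsilon> = s\<^sup>2"
    have eps: "0 < \<epsilon>" "\<epsilon> \<le> 1" using s by (auto simp: \<epsilon>_def power_le_one)
    have co1: "continuous_on (cball x0 \<rho>) (\<lambda>x. U1 (x, t1))"
      by (rule continuous_on_compose2[OF cont1]) (use t1 r in \<open>auto intro!: continuous_intros\<close>)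
    have co2: "continuous_on (cball y0 \<rho>) (\<lambda>x. U2 (x, t1))"
      by (rule continuous_on_compose2[OF cont2]) (use t1 r in \<open>auto intro!: continuous_intros\<close>)
    obtain h1 where h1: "h1 \<in> trig" "\<And>x. \<bar>h1 x - U1 (clamp_sin x0 R x, t1)\<bar> < \<epsilon>"
      using trig_approximation[OF co1 R(1) R(3)[unfolded n_def] eps(1)] by blast
    obtain h2 where h2: "h2 \<in> trig" "\<And>x. \<bar>h2 x - U2 (clamp_sin y0 R x, t1)\<bar> < \<epsilon>"
      using trig_approximation[OF co2 R(1) R(3)[unfolded n_def] eps(1)] by blast
    obtain H1 G1 M1 \<tau>1 where H1: "heat_sol T a H1 G1 M1 \<tau>1" "\<And>x. H1 (x, t1) = h1 x"
      using trig_heat_extension[OF h1(1), of T a t1] by blast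
    obtain H2 G2 M2 \<tau>2 where H2: "heat_sol T b H2 G2 M2 \<tau>2" "\<And>x. H2 (x, t1) = h2 x"
      using trig_heat_extension[OF h2(1), of T b t1] by blast
    have "(clamp_sin x0 R x, t1) \<in> ?C1" "(clamp_sin y0 R x, t1) \<in> ?C2" for x
      using clamp_sin_mem[OF R(1) R(3)[unfolded n_def], of x0 x] clamp_sin_mem[OF R(1) R(3)[unfolded n_def], of y0 x] t1 r by auto
    then have hB: "\<bar>h1 x\<bar> \<le> B" "\<bar>h2 x\<bar> \<le> B" for x
      using h1(2)[of x] h2(2)[of x] UB'(1)[of "(clamp_sin x0 R x, t1)"] UB'(2)[of "(clamp_sin y0 R x, t1)"] eps
      by auto
    have HB: "\<bar>H1 (x, t)\<bar> \<le> B" "\<bar>H2 (x, t)\<bar> \<le> B" if "t \<in> {t0 - \<rho> / 2..t1}" for x t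
    proof -
      have tt: "0 < t" "t \<le> t1" using that r by auto
      show "\<bar>H1 (x, t)\<bar> \<le> B" by (rule heat_abs_bounded[OF H1(1) t1(6) tt]) (simp add: H1(2) hB)
      show "\<bar>H2 (x, t)\<bar> \<le> B" by (rule heat_abs_bounded[OF H2(1) t1(6) tt]) (simp add: H2(2) hB)
    qed
    have near: "\<bar>h1 x - U1 (x, t1)\<bar> < \<epsilon>" if "x \<in> cball x0 R" for x
      using h1(2)[of x] clamp_sin_id[OF R(1) that] by simp
    have near2: "\<bar>h2 x - U2 (x, t1)\<bar> < \<epsilon>" if "x \<in> cball y0 R" for x
      using h2(2)[of x] clamp_sin_id[OF R(1) that] by simp
    have sub1': "cball x0 R \<times> {t0 - \<rho> / 2..t1} \<subseteq> ?C1" "cball y0 R \<times> {t0 - \<rho> / 2..t1} \<subseteq> ?C2"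
      using R t1 r by auto
    have st: "t1 - t0 = s" by (simp add: t1_def)
    have 1: "U1 (x0, t0) \<le> H1 (x0, t0) + \<epsilon> + (c1 + s) * (t1 - t0) + (2 * B + 2 * \<bar>c1\<bar> * \<rho>) / R ^ 4 * (12 * S1\<^sup>2 * (t1 - t0)\<^sup>2)"
    proof (rule linear_sub_le_heat[OF sub1 R(1,2) r(2,3) t1(1,2) _ _ H1(1) _ _ _ s(1) _ S1_def])
      show "continuous_on (cball x0 R \<times> {t0 - \<rho> / 2..t1}) U1" by (rule continuous_on_subset[OF cont1 sub1'(1)])
      show "U1 (x, t) \<le> B" if "x \<in> cball x0 R" "t \<in> {t0 - \<rho> / 2..t1}" for x t
        using UB'(1)[of "(x, t)"] sub1'(1) that by fastforce
      show "- B \<le> H1 (x, t)" if "t \<in> {t0 - \<rho> / 2..t1}" for x t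
        using HB(1)[OF that, of x] by (simp add: abs_le_iff)
      show "U1 (x, t1) \<le> H1 (x, t1) + \<epsilon>" if "x \<in> cball x0 R" for x
        using near[OF that] by (simp add: H1(2))
    qed (use eps B in auto)
    have 2: "U2 (y0, t0) \<le> H2 (y0, t0) + \<epsilon> + (c2 + s) * (t1 - t0) + (2 * B + 2 * \<bar>c2\<bar> * \<rho>) / R ^ 4 * (12 * S2\<^sup>2 * (t1 - t0)\<^sup>2)"
    proof (rule linear_sub_le_heat[OF sub2 R(1,2) r(2,3) t1(1,2) _ _ H2(1) _ _ _ s(1) _ S2_def])
      show "continuous_on (cball y0 R \<times> {t0 - \<rho> / 2..t1}) U2" by (rule continuous_on_subset[OF cont2 sub1'(2)])
      show "U2 (x, t) \<le> B" if "x \<in> cball y0 R" "t \<in> {t0 - \<rho> / 2..t1}" for x t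
        using UB'(2)[of "(x, t)"] sub1'(2) that by fastforce
      show "- B \<le> H2 (x, t)" if "t \<in> {t0 - \<rho> / 2..t1}" for x t
        using HB(2)[OF that, of x] by (simp add: abs_le_iff)
      show "U2 (x, t1) \<le> H2 (x, t1) + \<epsilon>" if "x \<in> cball y0 R" for x
        using near2[OF that] by (simp add: H2(2))
    qed (use eps B in auto)
    have 3: "H1 (x0, t0) + H2 (y0, t0) \<le> (m0 + \<tau> * s + 2 * \<epsilon>) + (coupling_cost a b \<alpha> \<gamma> + s) * (t1 - t0)
     + 2 * B' / R ^ 4 * (12 * S1\<^sup>2 * (t1 - t0)\<^sup>2 + 12 * S2\<^sup>2 * (t1 - t0)\<^sup>2)"
    proof (rule heat_pair_le_quad[OF H1(1) H2(1) t1(4-6) R(1) ag B'(1) s(1) _ _ _ S1_def S2_def, where ?\<nu>1.0=\<nu>1 and ?\<nu>2.0=\<nu>2])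
      fix x y assume xy: "x \<in> cball x0 R" "y \<in> cball y0 R"
      have nx: "norm (x - x0) \<le> R" "norm (y - y0) \<le> R" using xy by (auto simp: dist_norm norm_minus_commute)
      have "U1 (x0 + (x - x0), t0 + s) + U2 (y0 + (y - y0), t0 + s) \<le>
          quad_bound (m0 + \<tau> * s) \<nu>1 \<nu>2 \<alpha> \<gamma> (x - x0) (y - y0)"
        unfolding m0_def by (rule contact) (use nx R s r in auto)
      then show "H1 (x, t1) + H2 (y, t1) \<le> quad_bound (m0 + \<tau> * s + 2 * \<epsilon>) \<nu>1 \<nu>2 \<alpha> \<gamma> (x - x0) (y - y0)"
        using near[OF xy(1)] near2[OF xy(2)] unfolding H1(2) H2(2) t1_def[symmetric] by (simp add: quad_bound_def)
      show "H1 (x, t) + H2 (y, t) \<le> B'" if "t \<in> {t0..t1}" for t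
      proof -
        have "t \<in> {t0 - \<rho> / 2..t1}" using that r by auto
        then show ?thesis using HB[of t x] HB[of t y] B' by (smt (verit))
      qed
      have "\<bar>\<nu>1 \<bullet> (x - x0)\<bar> \<le> norm \<nu>1 * \<rho>" "\<bar>\<nu>2 \<bullet> (y - y0)\<bar> \<le> norm \<nu>2 * \<rho>"
        using nx R by (auto intro!: order_trans[OF Cauchy_Schwarz_ineq2] mult_left_mono)
      moreover have "\<bar>\<tau> * s\<bar> \<le> \<bar>\<tau>\<bar> * \<rho>" using s r by (auto simp: abs_mult intro!: mult_left_mono)
      moreover have "0 \<le> \<alpha> * (norm (x - x0 - (y - y0)))\<^sup>2" "0 \<le> \<gamma> * ((norm (x - x0))\<^sup>2 + (norm (y - y0))\<^sup>2)"
        using ag by auto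
      ultimately show "- B' \<le> quad_bound (m0 + \<tau> * s + 2 * \<epsilon>) \<nu>1 \<nu>2 \<alpha> \<gamma> (x - x0) (y - y0)"
        unfolding quad_bound_def B'_def using eps B abs_ge_minus_self[of m0]
        unfolding abs_le_iff distrib_right by linarith
    qed
    have "0 \<le> s * ((\<tau> + c1 + c2 + Q) + (C + 7) * s)"
      using 1 2 3 unfolding st Q_def[symmetric] C_def \<epsilon>_def m0_def
      by (simp add: algebra_simps power2_eq_square)
    then show ?thesis using s by (simp add: zero_le_mult_iff)
  qed
  show ?thesis
  proof (rule ccontr)
    assume neg: "\<not> ?thesis"
    define X where "X = \<tau> + c1 + c2 + Q"
    have X: "X < 0" using neg by (simp add: X_def Q_def)
    define s where "s = min (min (\<rho> / 2) 1) (- X / (2 * (C + 7)))"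
    have "s \<le> \<rho> / 2" "s \<le> 1" "s \<le> - X / (2 * (C + 7))" unfolding s_def by linarith+
    moreover have "0 < s" using X C r unfolding s_def by (simp add: divide_less_0_iff)
    ultimately have s: "0 < s" "s \<le> \<rho> / 2" "s \<le> 1" "s \<le> - X / (2 * (C + 7))" by blast+
    have "(C + 7) * s \<le> (C + 7) * (- X / (2 * (C + 7)))" by (rule mult_left_mono[OF s(4)]) (use C in simp)
    also have "\<dots> = - X / 2" using C by (simp add: field_simps)
    finally show False using main[OF s(1-3)] X by (simp add: X_def)
  qed
qed

section \<open>Sup-convolution in space\<close>

text \<open>Sup-convolution in the space variable over a compact ball. Time is left alone because \<open>w\<close> is
  continuous in it. Compactness makes the supremum attained for every \<open>\<kappa> > 0\<close>, however small; where the
  gradient may vanish, \<open>\<kappa>\<close> has to be small.\<close>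

definition supconv :: "real \<Rightarrow> real^'n \<Rightarrow> real \<Rightarrow> ((real^'n) \<times> real \<Rightarrow> real) \<Rightarrow> (real^'n) \<times> real \<Rightarrow> real" where
  "supconv \<kappa> x0 \<rho> w z = (SUP y\<in>cball x0 \<rho>. w (y, snd z) - \<kappa> / 2 * (norm (fst z - y))\<^sup>2)"

locale local_supconv =
  fixes \<kappa> \<rho> t0 :: real and x0 :: "real^'n" and w :: "(real^'n) \<times> real \<Rightarrow> real"
  assumes kappa: "\<kappa> > 0" and rho: "\<rho> > 0"
    and cont: "continuous_on (cball x0 \<rho> \<times> {t0 - \<rho>..t0 + \<rho>}) w"
begin

abbreviation U where "U \<equiv> supconv \<kappa> x0 \<rho> w"

abbreviation \<Phi> where "\<Phi> y x t \<equiv> w (y, t) - \<kappa> / 2 * (norm (x - y))\<^sup>2"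

lemma supconv_attained:
  assumes "t \<in> {t0 - \<rho>..t0 + \<rho>}"
  shows "\<exists>y\<in>cball x0 \<rho>. U (x, t) = \<Phi> y x t"
    and "y \<in> cball x0 \<rho> \<Longrightarrow> \<Phi> y x t \<le> U (x, t)"
proof -
  let ?f = "\<lambda>y. \<Phi> y x t"
  have "continuous_on (cball x0 \<rho>) (\<lambda>y. w (y, t))"
    by (rule continuous_on_compose2[OF cont]) (use assms in \<open>auto intro!: continuous_intros\<close>)
  then have "continuous_on (cball x0 \<rho>) ?f" by (intro continuous_intros)
  moreover have "x0 \<in> cball x0 \<rho>" using rho by simp
  ultimately obtain y0 where y0: "y0 \<in> cball x0 \<rho>" "\<And>y. y \<in> cball x0 \<rho> \<Longrightarrow> ?f y \<le> ?f y0"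
    using continuous_attains_sup[OF compact_cball, of x0 \<rho> ?f] by blast
  have "U (x, t) = ?f y0"
    unfolding supconv_def fst_conv snd_conv by (rule cSup_eq_maximum) (use y0 in auto)
  then show "\<exists>y\<in>cball x0 \<rho>. U (x, t) = ?f y" "y \<in> cball x0 \<rho> \<Longrightarrow> ?f y \<le> U (x, t)"
    using y0 by auto
qed

lemma maximand_uniformly_continuous:
  assumes "\<omega> > 0"
  obtains r where "r > 0" "\<And>x t x2 t2 y. x \<in> cball x1 \<rho> \<Longrightarrow> x2 \<in> cball x1 \<rho> \<Longrightarrow> t \<in> {t0 - \<rho>..t0 + \<rho>} \<Longrightarrow>
     t2 \<in> {t0 - \<rho>..t0 + \<rho>} \<Longrightarrow> norm (x - x2) < r \<Longrightarrow> \<bar>t - t2\<bar> < r \<Longrightarrow> y \<in> cball x0 \<rho> \<Longrightarrow>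
     \<bar>\<Phi> y x t - \<Phi> y x2 t2\<bar> < \<omega>"
proof -
  let ?f = "\<lambda>p. w (fst (fst p), snd p) - \<kappa> / 2 * (norm (snd (fst p) - fst (fst p)))\<^sup>2"
  let ?K = "(cball x0 \<rho> \<times> cball x1 \<rho>) \<times> {t0 - \<rho>..t0 + \<rho>}"
  have "continuous_on ?K (\<lambda>p. w (fst (fst p), snd p))"
    by (rule continuous_on_compose2[OF cont]) (auto intro!: continuous_intros)
  then have "continuous_on ?K ?f" by (intro continuous_intros)
  then have "uniformly_continuous_on ?K ?f"
    by (rule compact_uniformly_continuous) (intro compact_Times compact_cball compact_Icc)
  then obtain d where d: "d > 0" "\<And>p q. p \<in> ?K \<Longrightarrow> q \<in> ?K \<Longrightarrow> dist q p < d \<Longrightarrow> dist (?f q) (?f p) < \<omega>"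
    unfolding uniformly_continuous_on_def using assms by metis
  show thesis
  proof (rule that[of "d / 2"])
    fix x t x2 t2 y
    assume as: "x \<in> cball x1 \<rho>" "x2 \<in> cball x1 \<rho>" "t \<in> {t0 - \<rho>..t0 + \<rho>}"
     "t2 \<in> {t0 - \<rho>..t0 + \<rho>}" "norm (x - x2) < d / 2" "\<bar>t - t2\<bar> < d / 2" "y \<in> cball x0 \<rho>"
    have "dist ((y, x), t) ((y, x2), t2) = sqrt ((norm (x - x2))\<^sup>2 + (t - t2)\<^sup>2)"
      unfolding dist_Pair_Pair by (simp add: dist_norm dist_real_def)
    also have "\<dots> \<le> norm (x - x2) + \<bar>t - t2\<bar>"
      using sqrt_sum_squares_le_sum_abs[of "norm (x - x2)" "t - t2"] by simp
    also have "\<dots> < d" using as by simp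
    finally show "\<bar>\<Phi> y x t - \<Phi> y x2 t2\<bar> < \<omega>"
      using d(2)[of "((y, x2), t2)" "((y, x), t)"] as by (simp add: dist_real_def)
  qed (use d in simp)
qed

lemma supconv_continuous: "continuous_on (cball x1 \<rho> \<times> {t0 - \<rho>..t0 + \<rho>}) U"
  unfolding continuous_on_iff
proof (intro ballI allI impI)
  fix z and \<omega> :: real assume z: "z \<in> cball x1 \<rho> \<times> {t0 - \<rho>..t0 + \<rho>}" and om: "\<omega> > 0"
  obtain r where r: "r > 0" "\<And>x t x2 t2 y. x \<in> cball x1 \<rho> \<Longrightarrow> x2 \<in> cball x1 \<rho> \<Longrightarrow> t \<in> {t0 - \<rho>..t0 + \<rho>} \<Longrightarrow>
     t2 \<in> {t0 - \<rho>..t0 + \<rho>} \<Longrightarrow> norm (x - x2) < r \<Longrightarrow> \<bar>t - t2\<bar> < r \<Longrightarrow> y \<in> cball x0 \<rho> \<Longrightarrow>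
     \<bar>\<Phi> y x t - \<Phi> y x2 t2\<bar> < \<omega>"
    using maximand_uniformly_continuous[OF om] by blast
  have half: "U (x, t) < U (x2, t2) + \<omega>"
    if as: "x \<in> cball x1 \<rho>" "x2 \<in> cball x1 \<rho>" "t \<in> {t0 - \<rho>..t0 + \<rho>}" "t2 \<in> {t0 - \<rho>..t0 + \<rho>}"
     "norm (x - x2) < r" "\<bar>t - t2\<bar> < r" for x t x2 t2
  proof -
    obtain y where y: "y \<in> cball x0 \<rho>" "U (x, t) = \<Phi> y x t"
      using supconv_attained(1)[OF as(3)] by blast
    show ?thesis using r(2)[OF as y(1)] supconv_attained(2)[OF as(4) y(1), of x2] y(2) by linarith
  qed
  show "\<exists>d>0. \<forall>z'\<in>cball x1 \<rho> \<times> {t0 - \<rho>..t0 + \<rho>}. dist z' z < d \<longrightarrow> dist (U z') (U z) < \<omega>"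
  proof (intro exI[of _ r] conjI ballI impI r(1))
    fix z' assume z': "z' \<in> cball x1 \<rho> \<times> {t0 - \<rho>..t0 + \<rho>}" "dist z' z < r"
    obtain x t x2 t2 where zz: "z = (x2, t2)" "z' = (x, t)" by (metis surj_pair)
    have "norm (x - x2) < r" "\<bar>t - t2\<bar> < r"
      using z'(2) dist_fst_le[of z' z] dist_snd_le[of z' z] unfolding zz by (auto simp: dist_norm)
    then show "dist (U z') (U z) < \<omega>"
      using half[of x x2 t t2] half[of x2 x t2 t] z z' unfolding zz
      by (auto simp: dist_real_def norm_minus_commute abs_minus_commute abs_less_iff)
  qed
qed

end

text \<open>The point \<open>(x0, t0)\<close> is one where \<open>w\<close> is touched from above by a paraboloid flatter than \<open>\<kappa>\<close> with slope \<open>\<nu>\<close>.\<close>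

locale touching_supconv = local_supconv \<kappa> \<rho> t0 x0 w
  for \<kappa> \<rho> t0 :: real and x0 :: "real^'n" and w :: "(real^'n) \<times> real \<Rightarrow> real" +
  fixes \<nu> :: "real^'n" and \<kappa>' :: real
  assumes kappa': "\<kappa>' < \<kappa>"
    and touch: "\<And>h. norm h \<le> \<rho> \<Longrightarrow> w (x0 + h, t0) \<le> w (x0, t0) + \<nu> \<bullet> h + \<kappa>' / 2 * (norm h)\<^sup>2"
begin

text \<open>The centre at which the supremum at time \<open>t0\<close> is attained exactly at \<open>x0\<close>.\<close>

definition base :: "real^'n" where "base = x0 - (1 / \<kappa>) *\<^sub>R \<nu>"

text \<open>Completing the square around the centre: the linear term \<open>\<nu> \<bullet> h\<close> of the touching paraboloid is
  compensated by the shift of the centre.\<close>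

lemma base_value:
  "w (x0 + h, t) - \<kappa> / 2 * (norm (base + g - (x0 + h)))\<^sup>2 =
     w (x0 + h, t) - (norm \<nu>)\<^sup>2 / (2 * \<kappa>) - \<nu> \<bullet> (h - g) - \<kappa> / 2 * (norm (h - g))\<^sup>2"
proof -
  have "base + g - (x0 + h) = (g - h) + (- 1 / \<kappa>) *\<^sub>R \<nu>" by (simp add: base_def)
  moreover have "(g - h) \<bullet> \<nu> = - (\<nu> \<bullet> (h - g))" by (simp add: inner_commute inner_diff_right)
  ultimately have "(norm (base + g - (x0 + h)))\<^sup>2 = (norm (h - g))\<^sup>2 + 2 / \<kappa> * (\<nu> \<bullet> (h - g)) + (norm \<nu>)\<^sup>2 / \<kappa>\<^sup>2"
    by (simp only: norm_add_scaled_sq norm_minus_commute[of g h]) (simp add: power_divide)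
  then show ?thesis using kappa by (simp add: field_simps power2_eq_square)
qed

lemma base_sup: "U (base, t0) = w (x0, t0) - (norm \<nu>)\<^sup>2 / (2 * \<kappa>)"
proof (rule antisym)
  have t: "t0 \<in> {t0 - \<rho>..t0 + \<rho>}" using rho by simp
  show "w (x0, t0) - (norm \<nu>)\<^sup>2 / (2 * \<kappa>) \<le> U (base, t0)"
    using supconv_attained(2)[OF t, of x0 base] base_value[of 0 t0 0] rho by simp
  obtain y where y: "y \<in> cball x0 \<rho>" "U (base, t0) = \<Phi> y base t0"
    using supconv_attained(1)[OF t] by blast
  have "norm (y - x0) \<le> \<rho>" using y(1) by (simp add: dist_norm norm_minus_commute)
  from touch[OF this] have "w (y, t0) \<le> w (x0, t0) + \<nu> \<bullet> (y - x0) + \<kappa>' / 2 * (norm (y - x0))\<^sup>2" by simp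
  moreover have "\<kappa>' / 2 * (norm (y - x0))\<^sup>2 \<le> \<kappa> / 2 * (norm (y - x0))\<^sup>2"
    using kappa' by (intro mult_right_mono) auto
  ultimately show "U (base, t0) \<le> w (x0, t0) - (norm \<nu>)\<^sup>2 / (2 * \<kappa>)"
    using base_value[of "y - x0" t0 0] y(2) by simp
qed

text \<open>At the centre the maximiser is unique since \<open>\<kappa>' < \<kappa>\<close>; by uniform continuity all maximisers
  for nearby points are close to \<open>x0\<close>.\<close>

lemma maximizer_near:
  assumes d: "\<delta> > 0"
  obtains r where "r > 0" "\<And>x t y. norm (x - base) < r \<Longrightarrow> \<bar>t - t0\<bar> < r \<Longrightarrow> y \<in> cball x0 \<rho> \<Longrightarrow>
     U (x, t) = \<Phi> y x t \<Longrightarrow> norm (y - x0) < \<delta>"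
proof -
  define \<omega> where "\<omega> = (\<kappa> - \<kappa>') / 4 * \<delta>\<^sup>2"
  have om: "\<omega> > 0" using d kappa' by (simp add: \<omega>_def)
  obtain r where r: "r > 0" "\<And>x t x2 t2 y. x \<in> cball base \<rho> \<Longrightarrow> x2 \<in> cball base \<rho> \<Longrightarrow> t \<in> {t0 - \<rho>..t0 + \<rho>} \<Longrightarrow>
     t2 \<in> {t0 - \<rho>..t0 + \<rho>} \<Longrightarrow> norm (x - x2) < r \<Longrightarrow> \<bar>t - t2\<bar> < r \<Longrightarrow> y \<in> cball x0 \<rho> \<Longrightarrow>
     \<bar>\<Phi> y x t - \<Phi> y x2 t2\<bar> < \<omega>"
    using maximand_uniformly_continuous[OF om] by blast
  show thesis
  proof (rule that[of "min r \<rho>"])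
    fix x t y assume as: "norm (x - base) < min r \<rho>" "\<bar>t - t0\<bar> < min r \<rho>" "y \<in> cball x0 \<rho>"
     "U (x, t) = \<Phi> y x t"
    have m: "x \<in> cball base \<rho>" "base \<in> cball base \<rho>" "t \<in> {t0 - \<rho>..t0 + \<rho>}" "t0 \<in> {t0 - \<rho>..t0 + \<rho>}"
      "norm (x - base) < r" "\<bar>t - t0\<bar> < r"
      using as rho by (auto simp: dist_norm norm_minus_commute)
    have x0: "x0 \<in> cball x0 \<rho>" using rho by simp
    have "norm (y - x0) \<le> \<rho>" using as(3) by (simp add: dist_norm norm_minus_commute)
    from touch[OF this] have "\<Phi> y base t0
        \<le> w (x0, t0) - (norm \<nu>)\<^sup>2 / (2 * \<kappa>) - (\<kappa> - \<kappa>') / 2 * (norm (y - x0))\<^sup>2"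
      using base_value[of "y - x0" t0 0] by (simp add: algebra_simps diff_divide_distrib)
    moreover have "\<Phi> x0 base t0 = w (x0, t0) - (norm \<nu>)\<^sup>2 / (2 * \<kappa>)"
      using base_value[of 0 t0 0] by simp
    moreover note r(2)[OF m as(3)] r(2)[OF m x0] supconv_attained(2)[OF m(3) x0, of x] as(4)
    ultimately have "(\<kappa> - \<kappa>') / 2 * (norm (y - x0))\<^sup>2 < 2 * \<omega>" by linarith
    then have "(\<kappa> - \<kappa>') / 2 * (norm (y - x0))\<^sup>2 < (\<kappa> - \<kappa>') / 2 * \<delta>\<^sup>2" by (simp add: \<omega>_def)
    then have "(norm (y - x0))\<^sup>2 < \<delta>\<^sup>2" using kappa' by (simp add: mult_less_cancel_left)
    then show "norm (y - x0) < \<delta>" using d by (simp add: power_less_imp_less_base)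
  qed (use r rho in auto)
qed

end

lemma quartic_below_shift:
  fixes \<psi> :: "(real^'n) \<times> real \<Rightarrow> real"
  assumes "quartic_below T \<psi>" shows "quartic_below T (\<lambda>z. \<psi> (fst z + d, snd z))"
proof -
  obtain c where c: "\<And>x t. t \<in> {0<..<T} \<Longrightarrow> - c * (1 + norm x ^ 4) \<le> \<psi> (x, t)"
    using assms unfolding quartic_below_def by blast
  define C where "C = \<bar>c\<bar> * (8 + 8 * norm d ^ 4)"
  show ?thesis unfolding quartic_below_def
  proof (intro exI[of _ C] allI ballI)
    fix x :: "real^'n" and t assume t: "t \<in> {0<..<T}"
    have "norm (x + d) ^ 4 \<le> (norm x + norm d) ^ 4" by (intro power_mono norm_triangle_ineq) simp
    also have "\<dots> \<le> 8 * norm x ^ 4 + 8 * norm d ^ 4" by (rule power4_sum_le) auto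
    finally have "norm (x + d) ^ 4 \<le> 8 * norm x ^ 4 + 8 * norm d ^ 4" .
    moreover have "(8 + 8 * norm d ^ 4) * (1 + norm x ^ 4) = 8 + 8 * norm x ^ 4 + 8 * norm d ^ 4 + 8 * (norm x ^ 4 * norm d ^ 4)"
      by (simp add: algebra_simps)
    moreover have "0 \<le> norm x ^ 4 * norm d ^ 4" by simp
    ultimately have "1 + norm (x + d) ^ 4 \<le> (8 + 8 * norm d ^ 4) * (1 + norm x ^ 4)" by linarith
    then have "\<bar>c\<bar> * (1 + norm (x + d) ^ 4) \<le> C * (1 + norm x ^ 4)"
      unfolding C_def mult.assoc by (rule mult_left_mono) simp
    moreover have "c * (1 + norm (x + d) ^ 4) \<le> \<bar>c\<bar> * (1 + norm (x + d) ^ 4)"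
      by (intro mult_right_mono) auto
    ultimately show "- C * (1 + norm x ^ 4) \<le> \<psi> (fst (x, t) + d, snd (x, t))"
      using c[OF t, of "x + d"] by simp
  qed
qed

context touching_supconv
begin

text \<open>A test function touching the sup-convolution from above at \<open>x\<close> lies above the paraboloid
  \<open>w(y) - \<kappa>/2 |\<cdot> - y|\<^sup>2\<close> of a maximiser \<open>y\<close> and meets it at \<open>x\<close>. Hence its gradient is \<open>\<kappa> (y - x)\<close>, which is
  close to \<open>\<nu>\<close>, and its Hessian is at least \<open>- \<kappa>\<close>. Translated by \<open>x - y\<close> it touches \<open>w\<close> at \<open>y\<close>. So any linear
  inequality that follows from the nonlinear one under these constraints passes to the sup-convolution.\<close>

lemma supconv_linear_sub:
  assumes vs: "viscosity_sub T F w" and lg: "linear_growth T w"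
    and T: "0 < t0 - \<rho>" "t0 + \<rho> < T" and d: "\<delta> > 0"
    and near: "\<And>y t G M \<tau>. norm (y - x0) < \<delta> \<Longrightarrow> \<bar>t - t0\<bar> < \<delta> \<Longrightarrow> t \<in> {0..T} \<Longrightarrow> norm (G - \<nu>) < \<delta> \<Longrightarrow>
      \<bar>w (y, t) - w (x0, t0)\<bar> < \<delta> \<Longrightarrow> (\<And>a b. (M *v a) \<bullet> b = (M *v b) \<bullet> a) \<Longrightarrow>
      (\<And>h. 0 \<le> (M *v h) \<bullet> h + \<kappa> * (h \<bullet> h)) \<Longrightarrow> viscosity_ineq F (y, t) (w (y, t)) G M \<tau> \<Longrightarrow>
      0 \<le> \<tau> + heat_op a M + c"
  shows "\<exists>r>0. r \<le> \<rho> \<and> linear_sub T a c base t0 r U"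
proof -
  have z0: "(x0, t0) \<in> cball x0 \<rho> \<times> {t0 - \<rho>..t0 + \<rho>}" using rho by simp
  obtain d1 where d1: "d1 > 0" "\<And>z. z \<in> cball x0 \<rho> \<times> {t0 - \<rho>..t0 + \<rho>} \<Longrightarrow> dist z (x0, t0) < d1 \<Longrightarrow> dist (w z) (w (x0, t0)) < \<delta>"
    using cont[unfolded continuous_on_iff, rule_format, OF z0 d] by blast
  define \<delta>' where "\<delta>' = min (min \<delta> (\<rho> / 2)) (min (d1 / 2) (\<delta> / (2 * \<kappa>)))"
  have d': "\<delta>' > 0" "\<delta>' \<le> \<delta>" "\<delta>' \<le> \<rho> / 2" "\<delta>' \<le> d1 / 2" "\<delta>' \<le> \<delta> / (2 * \<kappa>)"
    using d rho d1 kappa by (simp_all add: \<delta>'_def min_le_iff_disj)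
  obtain r0 where r0: "r0 > 0" "\<And>x t y. norm (x - base) < r0 \<Longrightarrow> \<bar>t - t0\<bar> < r0 \<Longrightarrow> y \<in> cball x0 \<rho> \<Longrightarrow>
     U (x, t) = w (y, t) - \<kappa> / 2 * (norm (x - y))\<^sup>2 \<Longrightarrow> norm (y - x0) < \<delta>'"
    using maximizer_near[OF d'(1)] by blast
  define r where "r = min r0 (min \<delta>' \<rho>)"
  have r: "r > 0" "r \<le> r0" "r \<le> \<delta>'" "r \<le> \<rho>" using r0(1) d'(1) rho by (auto simp: r_def)
  have "linear_sub T a c base t0 r U"
    unfolding linear_sub_def
  proof (intro allI impI)
    fix \<psi> G M \<tau> x t and e :: real
    assume D: "test_data T \<psi> G M \<tau>" and qb: "quartic_below T \<psi>" and x: "norm (x - base) < r" and t: "\<bar>t - t0\<bar> < r"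
      and e: "e > 0"
      and max': "\<forall>y s. norm (y - x) < e \<longrightarrow> \<bar>s - t\<bar> < e \<longrightarrow> U (y, s) - \<psi> (y, s) \<le> U (x, t) - \<psi> (x, t)"
    note max = max'[rule_format]
    have tI: "t \<in> {t0 - \<rho>..t0 + \<rho>}" and tT: "0 < t" "t < T" using t r T by auto
    obtain x' where x': "x' \<in> cball x0 \<rho>" "U (x, t) = w (x', t) - \<kappa> / 2 * (norm (x - x'))\<^sup>2"
      using supconv_attained(1)[OF tI] by blast
    have n: "norm (x' - x0) < \<delta>'" by (rule r0(2)[OF _ _ x']) (use x t r in auto)
    define q where "q = x - x'"
    have hess: "G (x, t) \<bullet> h + \<kappa> * (q \<bullet> h) = 0 \<and> 0 \<le> (M (x, t) *v h) \<bullet> h + \<kappa> * (h \<bullet> h)" for h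
    proof -
      let ?f = "\<lambda>s. - \<psi> (x + s *\<^sub>R h, t) - \<kappa> / 2 * (norm q)\<^sup>2 - \<kappa> * (q \<bullet> h) * s - \<kappa> / 2 * (h \<bullet> h) * s\<^sup>2"
      let ?f' = "\<lambda>s. - (G (x + s *\<^sub>R h, t) \<bullet> h) - \<kappa> * (q \<bullet> h) - \<kappa> * (h \<bullet> h) * s"
      have 1: "(?f has_real_derivative ?f' s) (at s)" for s
        by (auto intro!: derivative_eq_intros test_data_line(1)[OF D tT])
      have 2: "(?f' has_real_derivative - ((M (x + 0 *\<^sub>R h, t) *v h) \<bullet> h) - \<kappa> * (h \<bullet> h)) (at 0)"
        by (auto intro!: derivative_eq_intros test_data_line(2)[OF D tT, of x h 0, simplified])
      have pos: "e / (1 + norm h) > 0" using e by (simp add: add_pos_nonneg)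
      have 3: "?f s \<le> ?f 0" if s: "\<bar>s\<bar> < e / (1 + norm h)" for s
      proof -
        have "\<bar>s\<bar> * (1 + norm h) < e" using s by (simp add: pos_less_divide_eq add_pos_nonneg)
        then have "norm (x + s *\<^sub>R h - x) < e" using abs_ge_zero[of s] by (simp add: algebra_simps)
        from max[OF this, of t] e have "U (x + s *\<^sub>R h, t) - \<psi> (x + s *\<^sub>R h, t) \<le> U (x, t) - \<psi> (x, t)" by simp
        moreover have "w (x', t) - \<kappa> / 2 * (norm (q + s *\<^sub>R h))\<^sup>2 \<le> U (x + s *\<^sub>R h, t)"
          using supconv_attained(2)[OF tI x'(1), of "x + s *\<^sub>R h"] by (simp add: q_def algebra_simps)
        moreover have "\<kappa> / 2 * (norm (q + s *\<^sub>R h))\<^sup>2 = \<kappa> / 2 * (norm q)\<^sup>2 + \<kappa> * (q \<bullet> h) * s + \<kappa> / 2 * (h \<bullet> h) * s\<^sup>2"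
          unfolding norm_add_scaled_sq by (simp add: power2_norm_eq_inner algebra_simps)
        moreover have "?f 0 = - \<psi> (x, t) - \<kappa> / 2 * (norm q)\<^sup>2" by simp
        ultimately show ?thesis using x'(2)[folded q_def] by linarith
      qed
      show ?thesis
        using second_derivative_at_max(1)[OF 1 2 pos 3] second_derivative_at_max(2)[OF 1 2 pos 3] by simp
    qed
    have "(G (x, t) + \<kappa> *\<^sub>R q) \<bullet> (G (x, t) + \<kappa> *\<^sub>R q) = 0"
      using hess[of "G (x, t) + \<kappa> *\<^sub>R q"] by (simp add: inner_add_left)
    then have G: "G (x, t) = - \<kappa> *\<^sub>R q" by (simp add: add_eq_0_iff2)
    have "G (x, t) - \<nu> = \<kappa> *\<^sub>R ((x' - x0) - (x - base))"
      using kappa by (simp add: G q_def base_def algebra_simps)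
    then have "norm (G (x, t) - \<nu>) \<le> \<kappa> * (norm (x' - x0) + norm (x - base))"
      using kappa norm_triangle_ineq4[of "x' - x0" "x - base"] by simp
    also have "\<dots> < \<kappa> * (\<delta> / (2 * \<kappa>) + \<delta> / (2 * \<kappa>))"
      by (rule mult_strict_left_mono[OF _ kappa]) (use n x r d' in linarith)
    also have "\<dots> = \<delta>" using kappa by (simp add: field_simps)
    finally have Gn: "norm (G (x, t) - \<nu>) < \<delta>" .
    have "dist (x', t) (x0, t0) \<le> norm (x' - x0) + \<bar>t - t0\<bar>"
      using sqrt_sum_squares_le_sum_abs[of "norm (x' - x0)" "t - t0"]
      unfolding dist_Pair_Pair by (simp add: dist_norm dist_real_def)
    also have "\<dots> < d1" using n t r d' by linarith
    finally have wn: "\<bar>w (x', t) - w (x0, t0)\<bar> < \<delta>"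
      using d1(2)[of "(x', t)"] x'(1) tI by (simp add: dist_real_def)
    define e' where "e' = min e (min (\<rho> / 2) (\<rho> - \<bar>t - t0\<bar>))"
    have e': "e' > 0" using e rho t r by (auto simp: e'_def)
    have lm: "w (y, s) - \<psi> (fst (y, s) + q, snd (y, s)) \<le> w (x', t) - \<psi> (fst (x', t) + q, snd (x', t))"
      if "norm (y - x') < e'" "\<bar>s - t\<bar> < e'" for y s
    proof -
      have "norm (y - x0) \<le> norm (y - x') + norm (x' - x0)"
        using norm_triangle_ineq[of "y - x'" "x' - x0"] by simp
      also have "\<dots> \<le> \<rho>" using that(1) n d' by (simp add: e'_def)
      finally have y: "y \<in> cball x0 \<rho>" by (simp add: dist_norm norm_minus_commute)
      have s: "s \<in> {t0 - \<rho>..t0 + \<rho>}" using that(2) by (auto simp: e'_def abs_less_iff)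
      have "w (y, s) - \<kappa> / 2 * (norm q)\<^sup>2 \<le> U (y + q, s)"
        using supconv_attained(2)[OF s y, of "y + q"] by simp
      moreover have "U (y + q, s) - \<psi> (y + q, s) \<le> U (x, t) - \<psi> (x, t)"
        by (rule max) (use that in \<open>auto simp: q_def e'_def algebra_simps\<close>)
      ultimately show ?thesis using x'(2) by (simp add: q_def)
    qed
    have xq: "fst (x', t) + q = x" by (simp add: q_def)
    note V = viscosity_sub_local_max[OF vs lg test_data_shift[OF D, of q] quartic_below_shift[OF qb] tT e' lm,
        unfolded xq snd_conv]
    show "0 \<le> \<tau> (x, t) + heat_op a (M (x, t)) + c"
      by (rule near[OF _ _ _ Gn wn test_data_sym[OF D] _ V]) (use n d' t r tT hess in auto)
  qed
  with r show ?thesis by blast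
qed

end

lemma norm_add_sq_le: "(norm (a + b))\<^sup>2 \<le> 2 * (norm a)\<^sup>2 + 2 * (norm b)\<^sup>2" for a b :: "'a::real_inner"
proof -
  have "0 \<le> (norm (a - b))\<^sup>2" by simp
  then show ?thesis unfolding power2_norm_eq_inner
    by (simp add: inner_diff_left inner_diff_right inner_add_left inner_add_right inner_commute)
qed

lemma norm_diff_sq_le: "(norm (a - b))\<^sup>2 \<le> 2 * (norm a)\<^sup>2 + 2 * (norm b)\<^sup>2" for a b :: "'a::real_inner"
  using norm_add_sq_le[of a "- b"] by simp

text \<open>Quadratic contact survives both sup-convolutions with twice the coefficients. The choice
  \<open>\<kappa> = 4 \<alpha> + 2 \<gamma>\<close> is what the inequality \<open>|a + b|\<^sup>2 \<le> 2 |a|\<^sup>2 + 2 |b|\<^sup>2\<close> asks for.\<close>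

lemma supconv_contact:
  fixes x0 y0 \<nu>1 \<nu>2 :: "real^'n"
  assumes A: "touching_supconv \<kappa> \<rho> t0 x0 w1 \<nu>1 \<kappa>'" and B: "touching_supconv \<kappa> \<rho> t0 y0 w2 \<nu>2 \<kappa>'"
    and k: "\<kappa> = 4 * \<alpha> + 2 * \<gamma>" and ag: "\<alpha> \<ge> 0" "\<gamma> \<ge> 0"
    and contact: "\<And>h1 h2 s. norm h1 \<le> \<rho> \<Longrightarrow> norm h2 \<le> \<rho> \<Longrightarrow> 0 \<le> s \<Longrightarrow> s \<le> \<rho> \<Longrightarrow>
      w1 (x0 + h1, t0 + s) + w2 (y0 + h2, t0 + s) \<le>
        quad_bound (w1 (x0, t0) + w2 (y0, t0) + \<tau> * s) \<nu>1 \<nu>2 (\<alpha> / 2) (\<gamma> / 2) h1 h2"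
    and s: "0 \<le> s" "s \<le> \<rho>"
  defines "U1 \<equiv> supconv \<kappa> x0 \<rho> w1" and "U2 \<equiv> supconv \<kappa> y0 \<rho> w2"
    and "x1 \<equiv> touching_supconv.base \<kappa> x0 \<nu>1" and "y1 \<equiv> touching_supconv.base \<kappa> y0 \<nu>2"
  shows "U1 (x1 + g1, t0 + s) + U2 (y1 + g2, t0 + s) \<le>
        quad_bound (U1 (x1, t0) + U2 (y1, t0) + \<tau> * s) \<nu>1 \<nu>2 \<alpha> \<gamma> g1 g2"
proof -
  interpret A: touching_supconv \<kappa> \<rho> t0 x0 w1 \<nu>1 \<kappa>' by (rule A)
  interpret B: touching_supconv \<kappa> \<rho> t0 y0 w2 \<nu>2 \<kappa>' by (rule B)
  have ts: "t0 + s \<in> {t0 - \<rho>..t0 + \<rho>}" using s by auto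
  obtain x' where x': "x' \<in> cball x0 \<rho>" "U1 (x1 + g1, t0 + s) = w1 (x', t0 + s) - \<kappa> / 2 * (norm (x1 + g1 - x'))\<^sup>2"
    using A.supconv_attained(1)[OF ts] unfolding U1_def by blast
  obtain y' where y': "y' \<in> cball y0 \<rho>" "U2 (y1 + g2, t0 + s) = w2 (y', t0 + s) - \<kappa> / 2 * (norm (y1 + g2 - y'))\<^sup>2"
    using B.supconv_attained(1)[OF ts] unfolding U2_def by blast
  define h1 where "h1 = x' - x0"
  define h2 where "h2 = y' - y0"
  have h: "norm h1 \<le> \<rho>" "norm h2 \<le> \<rho>" "x' = x0 + h1" "y' = y0 + h2"
    using x'(1) y'(1) by (auto simp: h1_def h2_def dist_norm norm_minus_commute)
  define d1 where "d1 = h1 - g1"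
  define d2 where "d2 = h2 - g2"
  have 1: "U1 (x1 + g1, t0 + s) = w1 (x0 + h1, t0 + s) - (norm \<nu>1)\<^sup>2 / (2 * \<kappa>) - \<nu>1 \<bullet> d1 - \<kappa> / 2 * (norm d1)\<^sup>2"
    using A.base_value[of h1 "t0 + s" g1] x'(2) unfolding h(3) x1_def d1_def by simp
  have 2: "U2 (y1 + g2, t0 + s) = w2 (y0 + h2, t0 + s) - (norm \<nu>2)\<^sup>2 / (2 * \<kappa>) - \<nu>2 \<bullet> d2 - \<kappa> / 2 * (norm d2)\<^sup>2"
    using B.base_value[of h2 "t0 + s" g2] y'(2) unfolding h(4) y1_def d2_def by simp
  have hg: "h1 = g1 + d1" "h2 = g2 + d2" "h1 - h2 = (g1 - g2) + (d1 - d2)" by (simp_all add: d1_def d2_def)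
  have "(norm (h1 - h2))\<^sup>2 \<le> 2 * (norm (g1 - g2))\<^sup>2 + 2 * (2 * (norm d1)\<^sup>2 + 2 * (norm d2)\<^sup>2)"
    unfolding hg(3) by (rule order_trans[OF norm_add_sq_le]) (use norm_diff_sq_le[of d1 d2] in simp)
  then have "\<alpha> / 2 * (norm (h1 - h2))\<^sup>2 \<le> \<alpha> / 2 * (2 * (norm (g1 - g2))\<^sup>2 + 2 * (2 * (norm d1)\<^sup>2 + 2 * (norm d2)\<^sup>2))"
    by (rule mult_left_mono) (use ag in simp)
  moreover have "(norm h1)\<^sup>2 + (norm h2)\<^sup>2 \<le> 2 * (norm g1)\<^sup>2 + 2 * (norm d1)\<^sup>2 + (2 * (norm g2)\<^sup>2 + 2 * (norm d2)\<^sup>2)"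
    unfolding hg(1,2) by (intro add_mono norm_add_sq_le)
  then have "\<gamma> / 2 * ((norm h1)\<^sup>2 + (norm h2)\<^sup>2) \<le> \<gamma> / 2 * (2 * (norm g1)\<^sup>2 + 2 * (norm d1)\<^sup>2 + (2 * (norm g2)\<^sup>2 + 2 * (norm d2)\<^sup>2))"
    by (rule mult_left_mono) (use ag in simp)
  ultimately have q: "\<alpha> / 2 * (norm (h1 - h2))\<^sup>2 + \<gamma> / 2 * ((norm h1)\<^sup>2 + (norm h2)\<^sup>2)
      \<le> \<alpha> * (norm (g1 - g2))\<^sup>2 + \<gamma> * ((norm g1)\<^sup>2 + (norm g2)\<^sup>2) + \<kappa> / 2 * (norm d1)\<^sup>2 + \<kappa> / 2 * (norm d2)\<^sup>2"
    unfolding k by (simp add: algebra_simps add_divide_distrib)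
  show ?thesis
    using contact[OF h(1,2) s] q A.base_sup B.base_sup
    unfolding 1 2 quad_bound_def unfolding U1_def[symmetric] U2_def[symmetric] x1_def[symmetric] y1_def[symmetric]
    by (simp add: hg(1,2) inner_add_right)
qed

section \<open>Ellipticity of the normalised p-Laplacian\<close>

lemma matrix_entry: "(N::real^'n^'n) $ i $ j = (N *v axis j 1) \<bullet> axis i 1"
  by (simp add: matrix_vector_mult_basis column_def inner_axis)

lemma psd_Cauchy_Schwarz:
  fixes N :: "real^'n^'n"
  assumes sym: "\<And>a b. (N *v a) \<bullet> b = (N *v b) \<bullet> a" and psd: "\<And>h. 0 \<le> (N *v h) \<bullet> h"
  shows "((N *v a) \<bullet> b)\<^sup>2 \<le> ((N *v a) \<bullet> a) * ((N *v b) \<bullet> b)"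
proof -
  define A B C where "A = (N *v a) \<bullet> a" and "B = (N *v a) \<bullet> b" and "C = (N *v b) \<bullet> b"
  have q: "0 \<le> A + 2 * B * s + C * s\<^sup>2" for s
  proof -
    have "(N *v (a + s *\<^sub>R b)) \<bullet> (a + s *\<^sub>R b) = A + 2 * B * s + C * s\<^sup>2"
      using sym[of b a] unfolding A_def B_def C_def
      by (simp add: matrix_vector_right_distrib matrix_vector_mult_scaleR inner_add_left inner_add_right
          power2_eq_square algebra_simps)
    then show ?thesis using psd[of "a + s *\<^sub>R b"] by simp
  qed
  have A0: "A \<ge> 0" "C \<ge> 0" using psd by (auto simp: A_def C_def)
  show ?thesis unfolding A_def[symmetric] B_def[symmetric] C_def[symmetric]
  proof (cases "C = 0")
    case True
    have "B = 0"
    proof (rule ccontr)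
      assume "B \<noteq> 0"
      then show False using q[of "- (A + 1) / (2 * B)"] True by simp
    qed
    then show "B\<^sup>2 \<le> A * C" using True by simp
  next
    case False
    then have "C > 0" using A0 by simp
    have "0 \<le> C * (A + 2 * B * (- B / C) + C * (- B / C)\<^sup>2)" using q[of "- B / C"] A0 by simp
    also have "\<dots> = A * C - B\<^sup>2" using False by (simp add: field_simps power2_eq_square)
    finally show "B\<^sup>2 \<le> A * C" by simp
  qed
qed

text \<open>For a positive semidefinite matrix \<open>|N\<^sub>i\<^sub>j| \<le> \<surd>N\<^sub>i\<^sub>i \<surd>N\<^sub>j\<^sub>j\<close>, so the form is dominated by the square of
  \<open>\<Sum>\<^sub>i \<surd>N\<^sub>i\<^sub>i |h\<^sub>i|\<close>, and Cauchy-Schwarz brings out the trace.\<close>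

lemma psd_le_trace:
  fixes N :: "real^'n^'n"
  assumes sym: "\<And>a b. (N *v a) \<bullet> b = (N *v b) \<bullet> a" and psd: "\<And>h. 0 \<le> (N *v h) \<bullet> h"
  shows "(N *v h) \<bullet> h \<le> trace N * (norm h)\<^sup>2"
proof -
  have d: "0 \<le> N $ i $ i" for i using psd[of "axis i 1"] by (simp add: matrix_entry)
  have entry: "\<bar>N $ i $ j\<bar> \<le> sqrt (N $ i $ i) * sqrt (N $ j $ j)" for i j
  proof -
    have "(N $ i $ j)\<^sup>2 \<le> (N $ i $ i) * (N $ j $ j)"
      using psd_Cauchy_Schwarz[OF sym psd, of "axis j 1" "axis i 1"] by (simp add: matrix_entry mult.commute)
    then have "sqrt ((N $ i $ j)\<^sup>2) \<le> sqrt ((N $ i $ i) * (N $ j $ j))" by (rule real_sqrt_le_mono)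
    then show ?thesis by (simp add: real_sqrt_mult)
  qed
  define f where "f i = \<bar>h $ i\<bar>" for i
  define g where "g i = sqrt (N $ i $ i)" for i
  have "(N *v h) \<bullet> h = (\<Sum>i\<in>UNIV. \<Sum>j\<in>UNIV. N $ i $ j * h $ j * h $ i)"
    by (simp add: inner_vec_def matrix_vector_mult_def sum_distrib_right)
  also have "\<dots> \<le> (\<Sum>i\<in>UNIV. \<Sum>j\<in>UNIV. (f i * g i) * (f j * g j))"
  proof (intro sum_mono)
    fix i j
    have "N $ i $ j * h $ j * h $ i \<le> \<bar>N $ i $ j\<bar> * (\<bar>h $ j\<bar> * \<bar>h $ i\<bar>)"
      by (metis abs_ge_self abs_mult mult.assoc)
    also have "\<dots> \<le> (g i * g j) * (\<bar>h $ j\<bar> * \<bar>h $ i\<bar>)"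
      unfolding g_def by (rule mult_right_mono[OF entry]) simp
    finally show "N $ i $ j * h $ j * h $ i \<le> (f i * g i) * (f j * g j)" by (simp add: f_def mult_ac)
  qed
  also have "\<dots> = (\<Sum>i\<in>UNIV. f i * g i)\<^sup>2" by (simp add: power2_eq_square sum_product)
  also have "\<dots> \<le> (\<Sum>i\<in>UNIV. (f i)\<^sup>2) * (\<Sum>i\<in>UNIV. (g i)\<^sup>2)" by (rule Cauchy_Schwarz_ineq_sum)
  also have "\<dots> = trace N * (norm h)\<^sup>2"
    using d by (simp add: f_def g_def trace_def power2_norm_eq_inner inner_vec_def power2_eq_square[symmetric] mult.commute)
  finally show ?thesis .
qed

lemma psd_bilinear_le_trace:
  fixes N :: "real^'n^'n"
  assumes sym: "\<And>a b. (N *v a) \<bullet> b = (N *v b) \<bullet> a" and psd: "\<And>h. 0 \<le> (N *v h) \<bullet> h"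
  shows "\<bar>(N *v a) \<bullet> b\<bar> \<le> trace N * norm a * norm b"
proof -
  have tr: "0 \<le> trace N"
    unfolding trace_def by (rule sum_nonneg) (use psd[of "axis _ 1"] in \<open>simp add: matrix_entry\<close>)
  have "((N *v a) \<bullet> b)\<^sup>2 \<le> ((N *v a) \<bullet> a) * ((N *v b) \<bullet> b)" by (rule psd_Cauchy_Schwarz[OF sym psd])
  also have "\<dots> \<le> (trace N * (norm a)\<^sup>2) * (trace N * (norm b)\<^sup>2)"
    by (intro mult_mono psd_le_trace[OF sym psd] psd) (use tr in auto)
  also have "\<dots> = (trace N * norm a * norm b)\<^sup>2" by (simp add: power_mult_distrib power2_eq_square)
  finally have "\<bar>(N *v a) \<bullet> b\<bar> \<le> \<bar>trace N * norm a * norm b\<bar>" by (simp only: abs_le_square_iff)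
  then show ?thesis using tr by simp
qed

lemma trace_add_mat: "trace (M + \<kappa> *\<^sub>R mat 1 :: real^'n^'n) = trace M + \<kappa> * real CARD('n)"
  by (simp add: trace_def mat_def sum.distrib)

lemma add_mat_form: "((M + \<kappa> *\<^sub>R mat 1 :: real^'n^'n) *v a) \<bullet> b = (M *v a) \<bullet> b + \<kappa> * (a \<bullet> b)"
  by (simp add: matrix_vector_mult_add_rdistrib scaleR_matrix_vector_assoc[symmetric] inner_add_left)

text \<open>A crude linear bound valid for every direction \<open>e\<close>, hence also where the gradient vanishes. It loses a
  multiple of \<open>\<kappa>\<close>, which is harmless exactly when the Hessians are small.\<close>

lemma uniform_ellipticity:
  fixes M :: "real^'n^'n"
  assumes sym: "\<And>a b. (M *v a) \<bullet> b = (M *v b) \<bullet> a" and semi: "\<And>h. 0 \<le> (M *v h) \<bullet> h + \<kappa> * (h \<bullet> h)"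
    and k: "\<kappa> \<ge> 0" and q: "1 \<le> q" "q \<le> P" and e: "norm e = 1"
  shows "(q - 2) * ((M *v e) \<bullet> e) + trace M \<le> (1 + P) * (trace M + \<kappa> * real CARD('n))"
proof -
  define N where "N = M + \<kappa> *\<^sub>R mat 1"
  have symN: "(N *v a) \<bullet> b = (N *v b) \<bullet> a" for a b 
    unfolding N_def add_mat_form using sym[of a b] by (simp add: inner_commute[of a b])
  have psdN: "0 \<le> (N *v h) \<bullet> h" for h using semi[of h] by (simp add: N_def add_mat_form)
  have ee: "e \<bullet> e = 1" using e by (simp add: norm_eq_1)
  have n: "1 \<le> real CARD('n)" using one_le_card_finite[where 'a='n] by linarith
  have 1: "(N *v e) \<bullet> e \<le> trace N" using psd_le_trace[OF symN psdN, of e] e by simp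
  have "(q - 2) * ((N *v e) \<bullet> e) \<le> P * ((N *v e) \<bullet> e)" by (rule mult_right_mono) (use q psdN in auto)
  also have "\<dots> \<le> P * trace N" by (rule mult_left_mono[OF 1]) (use q in simp)
  finally have 2: "(q - 2) * ((N *v e) \<bullet> e) + trace N \<le> (1 + P) * trace N" by (simp add: algebra_simps)
  have "0 \<le> \<kappa> * (real CARD('n) + q - 2)" by (rule mult_nonneg_nonneg[OF k]) (use n q in linarith)
  then show ?thesis using 2 unfolding N_def trace_add_mat add_mat_form ee by (simp add: algebra_simps)
qed

text \<open>Freezing the coefficients \<open>q\<close> and \<open>e\<close> costs \<open>\<delta>\<close> times the trace of the positive matrix \<open>M + \<kappa>\<close>. That trace is
  linear in \<open>M\<close>, so the error can be moved into the constant coefficient operator, although no upper bound on \<open>M\<close>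
  is known.\<close>

lemma frozen_ellipticity:
  fixes M :: "real^'n^'n"
  assumes sym: "\<And>a b. (M *v a) \<bullet> b = (M *v b) \<bullet> a" and semi: "\<And>h. 0 \<le> (M *v h) \<bullet> h + \<kappa> * (h \<bullet> h)"
    and k: "\<kappa> \<ge> 0" and e: "norm e = 1" "norm e' = 1"
    and close: "\<bar>q' - q\<bar> + 2 * \<bar>q - 2\<bar> * norm (e' - e) \<le> \<delta>"
  shows "(q' - 2) * ((M *v e') \<bullet> e') + trace M
     \<le> (1 + \<delta>) * trace M + (q - 2) * ((M *v e) \<bullet> e) + \<kappa> * \<delta> * (real CARD('n) + 1)"
proof -
  define N where "N = M + \<kappa> *\<^sub>R mat 1"
  have symN: "(N *v a) \<bullet> b = (N *v b) \<bullet> a" for a b 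
    unfolding N_def add_mat_form using sym[of a b] by (simp add: inner_commute[of a b])
  have psdN: "0 \<le> (N *v h) \<bullet> h" for h using semi[of h] by (simp add: N_def add_mat_form)
  note bil = psd_bilinear_le_trace[OF symN psdN]
  have ee: "e \<bullet> e = 1" "e' \<bullet> e' = 1" using e by (simp_all add: norm_eq_1)
  have tr: "0 \<le> trace N" using bil[of e e] e by simp
  have "(N *v e') \<bullet> e' - (N *v e) \<bullet> e = (N *v (e' - e)) \<bullet> e' + (N *v (e' - e)) \<bullet> e"
    using symN[of e e'] by (simp add: matrix_vector_mult_diff_distrib inner_diff_left)
  then have 1: "\<bar>(N *v e') \<bullet> e' - (N *v e) \<bullet> e\<bar> \<le> 2 * norm (e' - e) * trace N"
    using bil[of "e' - e" e'] bil[of "e' - e" e] e by (simp add: mult.commute)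
  have "(q' - 2) * ((N *v e') \<bullet> e') - (q - 2) * ((N *v e) \<bullet> e)
     = (q' - q) * ((N *v e') \<bullet> e') + (q - 2) * ((N *v e') \<bullet> e' - (N *v e) \<bullet> e)" by (simp add: algebra_simps)
  also have "\<dots> \<le> \<bar>q' - q\<bar> * trace N + \<bar>q - 2\<bar> * (2 * norm (e' - e) * trace N)"
  proof (rule add_mono)
    have "(q' - q) * ((N *v e') \<bullet> e') \<le> \<bar>q' - q\<bar> * ((N *v e') \<bullet> e')" by (rule mult_right_mono) (use psdN in auto)
    also have "\<dots> \<le> \<bar>q' - q\<bar> * trace N"
      by (rule mult_left_mono) (use psd_le_trace[OF symN psdN, of e'] e in auto)
    finally show "(q' - q) * ((N *v e') \<bullet> e') \<le> \<bar>q' - q\<bar> * trace N" .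
    have "(q - 2) * ((N *v e') \<bullet> e' - (N *v e) \<bullet> e) \<le> \<bar>q - 2\<bar> * \<bar>(N *v e') \<bullet> e' - (N *v e) \<bullet> e\<bar>"
      by (metis abs_ge_self abs_mult)
    also have "\<dots> \<le> \<bar>q - 2\<bar> * (2 * norm (e' - e) * trace N)" by (rule mult_left_mono[OF 1]) simp
    finally show "(q - 2) * ((N *v e') \<bullet> e' - (N *v e) \<bullet> e) \<le> \<bar>q - 2\<bar> * (2 * norm (e' - e) * trace N)" .
  qed
  also have "\<dots> = (\<bar>q' - q\<bar> + 2 * \<bar>q - 2\<bar> * norm (e' - e)) * trace N" by (simp add: algebra_simps)
  also have "\<dots> \<le> \<delta> * trace N" by (rule mult_right_mono[OF close tr])
  finally have 2: "(q' - 2) * ((N *v e') \<bullet> e') - (q - 2) * ((N *v e) \<bullet> e) \<le> \<delta> * trace N" .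
  have "\<bar>q' - q\<bar> \<le> \<delta>" using close by (smt (verit) mult_nonneg_nonneg norm_ge_zero abs_ge_zero)
  then have "\<kappa> * (q - q') \<le> \<kappa> * \<delta>" by (intro mult_left_mono k) simp
  then show ?thesis using 2 unfolding N_def trace_add_mat add_mat_form ee by (simp add: algebra_simps)
qed

text \<open>The columns of \<open>\<sigma> = l I + s e e\<^sup>T\<close>. Since \<open>\<sigma>\<sigma>\<^sup>T = l\<^sup>2 I + (2 l s + s\<^sup>2) e e\<^sup>T\<close>, suitable \<open>l\<close> and \<open>s\<close> give a square root of
  the coefficient matrix \<open>(1 + \<eta>) I + (p - 2) e e\<^sup>T\<close> that depends on \<open>p\<close> only through \<open>s\<close>.\<close>

definition diffusion_field :: "real \<Rightarrow> real \<Rightarrow> real^'n \<Rightarrow> 'n \<Rightarrow> real^'n" where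
  "diffusion_field l s e i = l *\<^sub>R axis i 1 + (s * e $ i) *\<^sub>R e"

lemma diffusion_field_uminus: "diffusion_field l s (- e) = diffusion_field l s e"
  by (simp add: diffusion_field_def fun_eq_iff)

lemma heat_op_diffusion_field:
  fixes M :: "real^'n^'n"
  assumes sym: "\<And>a b. (M *v a) \<bullet> b = (M *v b) \<bullet> a" and e: "norm e = 1"
  shows "heat_op (diffusion_field l s e) M = l\<^sup>2 * trace M + (2 * l * s + s\<^sup>2) * ((M *v e) \<bullet> e)"
proof -
  have ee: "(\<Sum>i\<in>UNIV. (e $ i)\<^sup>2) = 1"
    using e by (simp add: norm_eq_1 inner_vec_def power2_eq_square)
  have ax: "(\<Sum>i\<in>UNIV. e $ i * ((M *v e) \<bullet> axis i 1)) = (M *v e) \<bullet> e"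
    by (simp add: inner_axis inner_vec_def[of "M *v e"] mult.commute)
  have "(M *v diffusion_field l s e i) \<bullet> diffusion_field l s e i
    = l\<^sup>2 * (M $ i $ i) + 2 * l * s * (e $ i * ((M *v e) \<bullet> axis i 1)) + s\<^sup>2 * (e $ i)\<^sup>2 * ((M *v e) \<bullet> e)" for i
    using sym[of "axis i 1" e] unfolding diffusion_field_def matrix_entry
    by (simp add: matrix_vector_right_distrib matrix_vector_mult_scaleR inner_add_left inner_add_right
        power2_eq_square algebra_simps)
  then have "heat_op (diffusion_field l s e) M = l\<^sup>2 * trace M
     + 2 * l * s * (\<Sum>i\<in>UNIV. e $ i * ((M *v e) \<bullet> axis i 1)) + s\<^sup>2 * (\<Sum>i\<in>UNIV. (e $ i)\<^sup>2) * ((M *v e) \<bullet> e)"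
    by (simp only: heat_op_def sum.distrib sum_distrib_left sum_distrib_right trace_def mult.assoc)
  then show ?thesis unfolding ee ax by (simp add: algebra_simps)
qed

lemma norm_diffusion_field:
  assumes "norm e = 1"
  shows "(norm (diffusion_field l s e i))\<^sup>2 \<le> 2 * l\<^sup>2 + 2 * s\<^sup>2"
proof -
  have "(e $ i)\<^sup>2 \<le> 1" using component_le_norm_cart[of e i] assms by (simp add: abs_square_le_1)
  then have "s\<^sup>2 * (e $ i)\<^sup>2 \<le> s\<^sup>2 * 1" by (intro mult_left_mono) auto
  then have "(norm ((s * e $ i) *\<^sub>R e))\<^sup>2 \<le> s\<^sup>2" using assms by (simp add: power_mult_distrib)
  moreover have "(norm (l *\<^sub>R axis i (1::real)))\<^sup>2 = l\<^sup>2" by simp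
  ultimately show ?thesis
    unfolding diffusion_field_def using norm_add_sq_le[of "l *\<^sub>R axis i (1::real)" "(s * e $ i) *\<^sub>R e"] by linarith
qed

lemma diffusion_field_diff:
  fixes e f :: "real^'n"
  assumes e: "norm e = 1" "norm f = 1"
  shows "(norm (diffusion_field l s e i - diffusion_field l s' f i))\<^sup>2 \<le> 2 * (s - s')\<^sup>2 + 8 * s'\<^sup>2 * (norm (e - f))\<^sup>2"
proof -
  have c: "\<bar>e $ i\<bar> \<le> 1" "\<bar>e $ i - f $ i\<bar> \<le> norm (e - f)"
    using component_le_norm_cart[of e i] component_le_norm_cart[of "e - f" i] e by simp_all
  have eq: "diffusion_field l s e i - diffusion_field l s' f i
     = ((s - s') * e $ i) *\<^sub>R e + s' *\<^sub>R ((e $ i) *\<^sub>R (e - f) + (e $ i - f $ i) *\<^sub>R f)"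
    by (simp add: diffusion_field_def algebra_simps)
  have "norm (((s - s') * e $ i) *\<^sub>R e) \<le> \<bar>s - s'\<bar>"
    using c e by (simp add: abs_mult mult_left_le)
  moreover have "norm (s' *\<^sub>R ((e $ i) *\<^sub>R (e - f) + (e $ i - f $ i) *\<^sub>R f)) \<le> \<bar>s'\<bar> * (2 * norm (e - f))"
  proof -
    have "norm ((e $ i) *\<^sub>R (e - f) + (e $ i - f $ i) *\<^sub>R f) \<le> \<bar>e $ i\<bar> * norm (e - f) + \<bar>e $ i - f $ i\<bar>"
      using norm_triangle_ineq[of "(e $ i) *\<^sub>R (e - f)" "(e $ i - f $ i) *\<^sub>R f"] e by simp
    also have "\<dots> \<le> 1 * norm (e - f) + norm (e - f)" by (intro add_mono mult_right_mono c) simp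
    finally show ?thesis by (simp add: mult_left_mono)
  qed
  ultimately have "norm (diffusion_field l s e i - diffusion_field l s' f i) \<le> \<bar>s - s'\<bar> + \<bar>s'\<bar> * (2 * norm (e - f))"
    unfolding eq by (intro norm_triangle_le add_mono)
  then have "(norm (diffusion_field l s e i - diffusion_field l s' f i))\<^sup>2 \<le> (\<bar>s - s'\<bar> + \<bar>s'\<bar> * (2 * norm (e - f)))\<^sup>2"
    by (rule power_mono) simp
  also have "\<dots> \<le> 2 * \<bar>s - s'\<bar>\<^sup>2 + 2 * (\<bar>s'\<bar> * (2 * norm (e - f)))\<^sup>2"
    using norm_add_sq_le[of "\<bar>s - s'\<bar>" "\<bar>s'\<bar> * (2 * norm (e - f))"] by simp
  finally show ?thesis by (simp add: power_mult_distrib)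
qed

lemma pLap_F_unit:
  assumes "\<nu> \<noteq> 0"
  shows "pLap_F p \<mu> r z \<xi> \<nu> M =
    (p z - 2) * ((M *v ((1 / norm \<nu>) *\<^sub>R \<nu>)) \<bullet> ((1 / norm \<nu>) *\<^sub>R \<nu>)) + trace M + \<mu> \<bullet> \<nu> - r * \<xi>"
  using assms by (simp add: pLap_F_def matrix_vector_mult_scaleR power2_eq_square)

lemma linear_sub_mono:
  assumes "linear_sub T a c x0 t0 \<rho> U" "\<rho>' \<le> \<rho>" shows "linear_sub T a c x0 t0 \<rho>' U"
  unfolding linear_sub_def
proof (intro allI impI, goal_cases)
  case (1 \<psi> G M \<tau> x t e)
  show ?case
    by (rule assms(1)[unfolded linear_sub_def, rule_format, OF 1(1,2) _ _ 1(5)])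
       (use 1 assms(2) in auto)
qed

lemma norm_unit_diff:
  fixes a b :: "real^'n"
  assumes "a \<noteq> 0" "b \<noteq> 0"
  shows "norm ((1 / norm b) *\<^sub>R b - (1 / norm a) *\<^sub>R a) \<le> 2 * norm (b - a) / norm a"
proof -
  have "(1 / norm b) *\<^sub>R b - (1 / norm a) *\<^sub>R a = (1 / norm b - 1 / norm a) *\<^sub>R b + (1 / norm a) *\<^sub>R (b - a)"
    by (simp add: algebra_simps)
  then have "norm ((1 / norm b) *\<^sub>R b - (1 / norm a) *\<^sub>R a) \<le> \<bar>1 / norm b - 1 / norm a\<bar> * norm b + (1 / norm a) * norm (b - a)"
    using norm_triangle_ineq[of "(1 / norm b - 1 / norm a) *\<^sub>R b" "(1 / norm a) *\<^sub>R (b - a)"] by simp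
  also have "\<bar>1 / norm b - 1 / norm a\<bar> * norm b = \<bar>norm a - norm b\<bar> / norm a"
  proof -
    have "(1 / norm b - 1 / norm a) * norm b = (norm a - norm b) / norm a"
      using assms by (simp add: field_simps)
    moreover have "\<bar>1 / norm b - 1 / norm a\<bar> * norm b = \<bar>(1 / norm b - 1 / norm a) * norm b\<bar>"
      by (simp add: abs_mult)
    ultimately show ?thesis by simp
  qed
  also have "\<dots> \<le> norm (b - a) / norm a"
    by (intro divide_right_mono) (use norm_triangle_ineq3[of a b] in \<open>auto simp: norm_minus_commute\<close>)
  finally show ?thesis by simp
qed

section \<open>Freezing the coefficients\<close>

text \<open>At a vanishing gradient all directions are admissible, and the uniform bound covers them
  at once; the drift contributes nothing in the limit.\<close>

lemma touching_uniform_bound: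
  fixes M :: "real^'n^'n"
  assumes sym: "\<And>a b. (M *v a) \<bullet> b = (M *v b) \<bullet> a" and semi: "\<And>h. 0 \<le> (M *v h) \<bullet> h + \<kappa> * (h \<bullet> h)"
    and k: "\<kappa> \<ge> 0" and p: "p z \<in> {1..P}"
    and V: "viscosity_ineq (pLap_F p \<mu> r) z \<xi> G M \<tau>"
  shows "0 \<le> \<tau> + (1 + P) * (trace M + \<kappa> * real CARD('n)) + \<mu> \<bullet> G - r * \<xi>"
proof -
  let ?E = "(1 + P) * (trace M + \<kappa> * real CARD('n))"
  have F: "pLap_F p \<mu> r z \<xi> \<omega> M \<le> ?E + \<mu> \<bullet> \<omega> - r * \<xi>" if "\<omega> \<noteq> 0" for \<omega>
    using uniform_ellipticity[OF sym semi k, of "p z" P "(1 / norm \<omega>) *\<^sub>R \<omega>"] p that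
    unfolding pLap_F_unit[OF that] by simp
  show ?thesis
  proof (cases "G = 0")
    case False
    then show ?thesis using V F[OF False] unfolding viscosity_ineq_def by fastforce
  next
    case True
    show ?thesis
    proof (rule field_le_epsilon)
      fix \<delta> :: real assume d: "\<delta> > 0"
      have "\<forall>\<^sub>F \<omega> in at 0. \<mu> \<bullet> \<omega> < \<delta>"
      proof (rule order_tendstoD(2))
        show "((\<lambda>\<omega>. \<mu> \<bullet> \<omega>) \<longlongrightarrow> 0) (at 0)" by (auto intro!: tendsto_eq_intros)
      qed (rule d)
      then have "\<forall>\<^sub>F \<omega> in at 0. pLap_F p \<mu> r z \<xi> \<omega> M \<le> ?E - r * \<xi> + \<delta>"
        using eventually_neq_at_within[of 0 0 UNIV]
      proof eventually_elim
        case (elim \<omega>) then show ?case using F[of \<omega>] by linarith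
      qed
      then have "0 \<le> \<tau> + (?E - r * \<xi> + \<delta>)" using V True unfolding viscosity_ineq_def by blast
      then show "0 \<le> \<tau> + ?E + \<mu> \<bullet> G - r * \<xi> + \<delta>" using True by simp
    qed
  qed
qed

lemma drift_discount_le:
  fixes \<mu> \<nu> G :: "real^'n"
  assumes "norm (G - \<nu>) < \<delta>" "\<bar>\<xi>' - \<xi>\<bar> < \<delta>" "r \<ge> 0" "(norm \<mu> + r + 1) * \<delta> \<le> \<eta>"
  shows "\<mu> \<bullet> G - r * \<xi>' \<le> \<mu> \<bullet> \<nu> - r * \<xi> + \<eta>"
proof -
  have "\<mu> \<bullet> (G - \<nu>) \<le> norm \<mu> * norm (G - \<nu>)" by (rule norm_cauchy_schwarz)
  also have "\<dots> \<le> norm \<mu> * \<delta>" using assms(1) by (intro mult_left_mono) auto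
  finally have "\<mu> \<bullet> G \<le> \<mu> \<bullet> \<nu> + norm \<mu> * \<delta>" by (simp add: inner_diff_right)
  moreover have "r * (\<xi> - \<xi>') \<le> r * \<delta>" using assms by (intro mult_left_mono) auto
  moreover have "0 < \<delta>" using assms(1) norm_ge_zero[of "G - \<nu>"] by linarith
  ultimately show ?thesis using assms(4) by (simp add: algebra_simps)
qed

context touching_supconv
begin

text \<open>The operator is a multiple of the Laplacian whatever the gradient is, with an error proportional
  to \<open>\<kappa>\<close>.\<close>

lemma supconv_linear_sub_degenerate:
  assumes vs: "viscosity_sub T (pLap_F p \<mu> r) w" and lg: "linear_growth T w"
    and T: "0 < t0 - \<rho>" "t0 + \<rho> < T" and r: "r \<ge> 0" and \<eta>: "\<eta> > 0"
    and p: "\<And>z. z \<in> closed_cyl T \<Longrightarrow> p z \<in> {1..P}" and e: "norm e = 1"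
  shows "\<exists>d>0. d \<le> \<rho> \<and> linear_sub T (diffusion_field (sqrt (1 + P)) 0 e)
     ((1 + P) * \<kappa> * real CARD('n) + \<mu> \<bullet> \<nu> - r * w (x0, t0) + \<eta>) base t0 d U"
proof -
  define \<delta> where "\<delta> = \<eta> / (norm \<mu> + r + 1)"
  have den: "norm \<mu> + r + 1 > 0" using r by (simp add: add_nonneg_pos)
  have d: "\<delta> > 0" "(norm \<mu> + r + 1) * \<delta> \<le> \<eta>" using \<eta> den by (simp_all add: \<delta>_def)
  have "(x0, t0) \<in> closed_cyl T" using T rho by auto
  then have P: "P \<ge> 1" using p by fastforce
  show ?thesis
  proof (rule supconv_linear_sub[OF vs lg T d(1)])
    fix y t G \<tau> and M :: "real^'n^'n"
    assume tT: "t \<in> {0..T}" and G: "norm (G - \<nu>) < \<delta>" and wn: "\<bar>w (y, t) - w (x0, t0)\<bar> < \<delta>"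
      and sym: "\<And>a b. (M *v a) \<bullet> b = (M *v b) \<bullet> a" and semi: "\<And>h. 0 \<le> (M *v h) \<bullet> h + \<kappa> * (h \<bullet> h)"
      and V: "viscosity_ineq (pLap_F p \<mu> r) (y, t) (w (y, t)) G M \<tau>"
    have "0 \<le> \<tau> + (1 + P) * (trace M + \<kappa> * real CARD('n)) + \<mu> \<bullet> G - r * w (y, t)"
      by (rule touching_uniform_bound[OF sym semi less_imp_le[OF kappa] p V]) (use tT in simp)
    moreover have P0: "sqrt (1 + P) * sqrt (1 + P) = 1 + P" using P by simp
    have "heat_op (diffusion_field (sqrt (1 + P)) 0 e) M = (1 + P) * trace M"
      unfolding heat_op_diffusion_field[OF sym e] power2_eq_square P0 by simp
    ultimately show "0 \<le> \<tau> + heat_op (diffusion_field (sqrt (1 + P)) 0 e) M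
        + ((1 + P) * \<kappa> * real CARD('n) + \<mu> \<bullet> \<nu> - r * w (x0, t0) + \<eta>)"
      using drift_discount_le[OF G wn r d(2)] by (simp add: algebra_simps)
  qed
qed

text \<open>If \<open>\<nu> \<noteq> 0\<close>, gradients of touching functions stay away from \<open>0\<close> near the contact point, their directions are close to
  \<open>e\<close>, and the exponent is close to its value at the contact point.\<close>

lemma supconv_linear_sub_nondegenerate:
  assumes vs: "viscosity_sub T (pLap_F p \<mu> r) w" and lg: "linear_growth T w"
    and T: "0 < t0 - \<rho>" "t0 + \<rho> < T" and r: "r \<ge> 0" and \<eta>: "\<eta> > 0"
    and p: "p (x0, t0) \<ge> 1" and pc: "continuous_on (closed_cyl T) p"
    and \<nu>: "\<nu> \<noteq> 0" and e: "e = (1 / norm \<nu>) *\<^sub>R \<nu>"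
  shows "\<exists>d>0. d \<le> \<rho> \<and> linear_sub T (diffusion_field (sqrt (1 + \<eta>)) (sqrt (p (x0, t0) - 1 + \<eta>) - sqrt (1 + \<eta>)) e)
     (\<kappa> * \<eta> * (real CARD('n) + 1) + \<mu> \<bullet> \<nu> - r * w (x0, t0) + \<eta>) base t0 d U"
proof -
  let ?q = "p (x0, t0)"
  have z0: "(x0, t0) \<in> closed_cyl T" using T rho by auto
  obtain d1 where d1: "d1 > 0" "\<And>z. z \<in> closed_cyl T \<Longrightarrow> dist z (x0, t0) < d1 \<Longrightarrow> dist (p z) ?q < \<eta> / 2"
    using pc[unfolded continuous_on_iff, rule_format, OF z0, of "\<eta> / 2"] \<eta> by auto
  have N: "norm \<nu> > 0" using \<nu> by simp
  \<comment> \<open>The directions of \<open>G\<close> and \<open>\<nu>\<close> differ by at most \<open>2 |G - \<nu>| / |\<nu>|\<close>.\<close>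
  define D where "D = 8 * (\<bar>?q - 2\<bar> + 1) / norm \<nu>"
  have D: "D > 0" unfolding D_def using N by (intro divide_pos_pos mult_pos_pos) auto
  define \<delta> where "\<delta> = min (min (\<eta> / (norm \<mu> + r + 1)) (d1 / 2)) (min (norm \<nu>) (\<eta> / D))"
  have den: "norm \<mu> + r + 1 > 0" using r by (simp add: add_nonneg_pos)
  have d: "\<delta> > 0" using \<eta> den d1(1) N D by (simp add: \<delta>_def)
  have "\<delta> \<le> \<eta> / (norm \<mu> + r + 1)" "\<delta> \<le> d1 / 2" "\<delta> \<le> norm \<nu>" "\<delta> \<le> \<eta> / D" unfolding \<delta>_def by linarith+
  then have dd: "(norm \<mu> + r + 1) * \<delta> \<le> \<eta>" "\<delta> \<le> d1 / 2" "\<delta> \<le> norm \<nu>" "D * \<delta> \<le> \<eta>"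
    using den D by (simp_all add: pos_le_divide_eq mult.commute)
  let ?l = "sqrt (1 + \<eta>)" and ?s = "sqrt (?q - 1 + \<eta>) - sqrt (1 + \<eta>)"
  have e1: "norm e = 1" using \<nu> by (simp add: e)
  show ?thesis
  proof (rule supconv_linear_sub[OF vs lg T d])
    fix y t G \<tau> and M :: "real^'n^'n"
    assume y: "norm (y - x0) < \<delta>" "\<bar>t - t0\<bar> < \<delta>" and tT: "t \<in> {0..T}"
      and G: "norm (G - \<nu>) < \<delta>" and wn: "\<bar>w (y, t) - w (x0, t0)\<bar> < \<delta>"
      and sym: "\<And>a b. (M *v a) \<bullet> b = (M *v b) \<bullet> a" and semi: "\<And>h. 0 \<le> (M *v h) \<bullet> h + \<kappa> * (h \<bullet> h)"
      and V: "viscosity_ineq (pLap_F p \<mu> r) (y, t) (w (y, t)) G M \<tau>"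
    have G0: "G \<noteq> 0" using G dd(3) by auto
    let ?e = "(1 / norm G) *\<^sub>R G"
    have "dist (y, t) (x0, t0) \<le> norm (y - x0) + \<bar>t - t0\<bar>"
      using sqrt_sum_squares_le_sum_abs[of "norm (y - x0)" "t - t0"]
      unfolding dist_Pair_Pair by (simp add: dist_norm dist_real_def)
    also have "\<dots> < d1" using y dd(2) by linarith
    finally have pq: "\<bar>p (y, t) - ?q\<bar> \<le> \<eta> / 2" using d1(2)[of "(y, t)"] tT by (simp add: dist_real_def)
    have "norm (?e - e) \<le> 2 * norm (G - \<nu>) / norm \<nu>"
      unfolding e by (rule norm_unit_diff[OF \<nu> G0])
    also have "\<dots> \<le> 2 * \<delta> / norm \<nu>" using G N by (intro divide_right_mono) auto
    finally have "2 * \<bar>?q - 2\<bar> * norm (?e - e) \<le> 2 * \<bar>?q - 2\<bar> * (2 * \<delta> / norm \<nu>)" by (rule mult_left_mono) simp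
    also have "\<dots> \<le> D * \<delta> / 2" unfolding D_def using N d by (simp add: field_simps)
    also have "\<dots> \<le> \<eta> / 2" using dd(4) by simp
    finally have close: "\<bar>p (y, t) - ?q\<bar> + 2 * \<bar>?q - 2\<bar> * norm (?e - e) \<le> \<eta>" using pq by simp
    have e2: "norm ?e = 1" using G0 by simp
    note FE = frozen_ellipticity[OF sym semi less_imp_le[OF kappa] e1 e2 close]
    have l2: "?l\<^sup>2 = 1 + \<eta>" using \<eta> by simp
    have "(?l + ?s)\<^sup>2 = ?q - 1 + \<eta>" using \<eta> p by simp
    then have "2 * ?l * ?s + ?s\<^sup>2 = ?q - 2" using l2 unfolding power2_sum by linarith
    then have H: "heat_op (diffusion_field ?l ?s e) M = (1 + \<eta>) * trace M + (?q - 2) * ((M *v e) \<bullet> e)"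
      unfolding heat_op_diffusion_field[OF sym e1] l2 by simp
    have "0 \<le> \<tau> + pLap_F p \<mu> r (y, t) (w (y, t)) G M" using V G0 unfolding viscosity_ineq_def by blast
    then show "0 \<le> \<tau> + heat_op (diffusion_field ?l ?s e) M
        + (\<kappa> * \<eta> * (real CARD('n) + 1) + \<mu> \<bullet> \<nu> - r * w (x0, t0) + \<eta>)"
      using FE drift_discount_le[OF G wn r dd(1)] unfolding H pLap_F_unit[OF G0] by (simp add: algebra_simps)
  qed
qed

end

lemma supconv_theorem_on_sums:
  fixes x0 y0 \<nu>1 \<nu>2 :: "real^'n" and a b :: "'k::finite \<Rightarrow> real^'n"
  assumes A: "touching_supconv \<kappa> \<rho> t0 x0 w1 \<nu>1 \<kappa>'" and B: "touching_supconv \<kappa> \<rho> t0 y0 w2 \<nu>2 \<kappa>'"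
    and k: "\<kappa> = 4 * \<alpha> + 2 * \<gamma>" and ag: "\<alpha> \<ge> 0" "\<gamma> \<ge> 0" and T: "0 < t0 - \<rho>" "t0 + \<rho> < T"
    and contact: "\<And>h1 h2 s. norm h1 \<le> \<rho> \<Longrightarrow> norm h2 \<le> \<rho> \<Longrightarrow> 0 \<le> s \<Longrightarrow> s \<le> \<rho> \<Longrightarrow>
      w1 (x0 + h1, t0 + s) + w2 (y0 + h2, t0 + s) \<le>
        quad_bound (w1 (x0, t0) + w2 (y0, t0) + \<tau> * s) \<nu>1 \<nu>2 (\<alpha> / 2) (\<gamma> / 2) h1 h2"
    and L1: "\<exists>d>0. d \<le> \<rho> \<and> linear_sub T a c1 (touching_supconv.base \<kappa> x0 \<nu>1) t0 d (supconv \<kappa> x0 \<rho> w1)"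
    and L2: "\<exists>d>0. d \<le> \<rho> \<and> linear_sub T b c2 (touching_supconv.base \<kappa> y0 \<nu>2) t0 d (supconv \<kappa> y0 \<rho> w2)"
  shows "0 \<le> \<tau> + c1 + c2 + coupling_cost a b \<alpha> \<gamma>"
proof -
  interpret A: touching_supconv \<kappa> \<rho> t0 x0 w1 \<nu>1 \<kappa>' by (rule A)
  interpret B: touching_supconv \<kappa> \<rho> t0 y0 w2 \<nu>2 \<kappa>' by (rule B)
  obtain d1 where d1: "d1 > 0" "d1 \<le> \<rho>" "linear_sub T a c1 A.base t0 d1 A.U" using L1 by blast
  obtain d2 where d2: "d2 > 0" "d2 \<le> \<rho>" "linear_sub T b c2 B.base t0 d2 B.U" using L2 by blast
  define d where "d = min d1 d2"
  have d: "d > 0" "d \<le> d1" "d \<le> d2" "d \<le> \<rho>" using d1 d2 by (auto simp: d_def)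
  show ?thesis
  proof (rule linear_theorem_on_sums[OF linear_sub_mono[OF d1(3) d(2)] linear_sub_mono[OF d2(3) d(3)] d(1) _ _ _ _ ag])
    show "continuous_on (cball A.base d \<times> {t0 - d..t0 + d}) A.U"
      by (rule continuous_on_subset[OF A.supconv_continuous[of A.base]]) (use d in auto)
    show "continuous_on (cball B.base d \<times> {t0 - d..t0 + d}) B.U"
      by (rule continuous_on_subset[OF B.supconv_continuous[of B.base]]) (use d in auto)
    show "A.U (A.base + g1, t0 + s) + B.U (B.base + g2, t0 + s)
        \<le> quad_bound (A.U (A.base, t0) + B.U (B.base, t0) + \<tau> * s) \<nu>1 \<nu>2 \<alpha> \<gamma> g1 g2"
      if "0 \<le> s" "s \<le> d" for g1 g2 s
      by (rule supconv_contact[OF A B k ag contact]) (use that d in auto)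
  qed (use d T in auto)
qed

section \<open>Subsolutions are bounded by their terminal values\<close>

text \<open>The barrier \<open>B + \<gamma> exp (C (T - t)) (|x|\<^sup>2 + 1) + \<beta> / t\<close> is a strict supersolution for large \<open>C\<close> and
  outgrows \<open>w\<close>. The discount term has a favourable sign because \<open>w > B \<ge> 0\<close> at the maximum. Boundedness is what
  later makes the gradient of the localising penalty \<open>\<gamma> |x|\<^sup>2\<close> vanish as \<open>\<gamma> \<rightarrow> 0\<close>; linear growth
  would only keep it bounded.\<close>

lemma viscosity_sub_bounded_above:
  fixes w :: "(real^'n) \<times> real \<Rightarrow> real"
  assumes vs: "viscosity_sub T (pLap_F p \<mu> r) w" and lg: "linear_growth T w"
    and cont: "continuous_on (closed_cyl T) w" and r: "r \<ge> 0"
    and p: "\<And>z. z \<in> closed_cyl T \<Longrightarrow> p z \<in> {1..P}"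
    and terminal: "\<And>x. w (x, T) \<le> B" and B: "B \<ge> 0" and t1: "0 < t1" "t1 \<le> T"
  shows "w (x1, t1) \<le> B"
proof (rule ccontr)
  assume *: "\<not> w (x1, t1) \<le> B"
  have T: "T > 0" using t1 by simp
  define n where "n = real CARD('n)"
  have P: "P \<ge> 1" using p[of "(x1, t1)"] t1 by auto
  define C where "C = 2 * n * (1 + P) + 2 * norm \<mu>"
  define m where "m = w (x1, t1) - B"
  have m: "m > 0" using * by (simp add: m_def)
  have n: "n \<ge> 0" by (simp add: n_def)
  have C: "C \<ge> 0" using n P by (simp add: C_def)
  obtain c0 where c0: "\<And>x t. 0 \<le> t \<Longrightarrow> t \<le> T \<Longrightarrow> \<bar>w (x, t)\<bar> \<le> c0 * (1 + norm x)"
    using lg unfolding linear_growth_def by (metis atLeastAtMost_iff)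
  define c where "c = \<bar>c0\<bar>"
  have c: "w (x, t) \<le> c * (1 + norm x)" if "0 \<le> t" "t \<le> T" for x t
  proof -
    have "c0 * (1 + norm x) \<le> c * (1 + norm x)" by (intro mult_right_mono) (auto simp: c_def)
    then show ?thesis using c0[OF that, of x] by linarith
  qed
  have c_pos: "c \<ge> 0" by (simp add: c_def)
  define \<beta> where "\<beta> = m * t1 / 4"
  define \<gamma> where "\<gamma> = m / (4 * exp (C * T) * ((norm x1)\<^sup>2 + 1))"
  have bg: "\<beta> > 0" "\<gamma> > 0" using m t1 by (auto simp: \<beta>_def \<gamma>_def intro!: divide_pos_pos mult_pos_pos add_nonneg_pos)
  define a where "a t = \<gamma> * exp (C * (T - t))" for t
  define \<psi> where "\<psi> = (\<lambda>z::(real^'n)\<times>real. a (snd z) * (norm (fst z - 0))\<^sup>2 + (B + a (snd z) + \<beta> / snd z))"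
  have a_pos: "a t > 0" for t using bg by (simp add: a_def)
  have a_ge: "a t \<ge> \<gamma>" if "t \<le> T" for t using bg C that by (simp add: a_def)
  have da: "(a has_real_derivative - C * a t) (at t)" for t
    unfolding a_def by (auto intro!: derivative_eq_intros)
  have ca: "continuous_on X a" for X unfolding a_def by (intro continuous_intros)
  have D1: "test_data T (\<lambda>z::(real^'n)\<times>real. a (snd z) * (norm (fst z - 0))\<^sup>2) (\<lambda>z. (2 * a (snd z)) *\<^sub>R (fst z - 0))
      (\<lambda>z. (2 * a (snd z)) *\<^sub>R mat 1) (\<lambda>z. (- C * a (snd z)) * (norm (fst z - 0))\<^sup>2)"
    by (rule test_data_square[where f'="\<lambda>t. - C * a t"]) (intro da ca continuous_intros)+
  have D2: "test_data T (\<lambda>z::(real^'n)\<times>real. B + a (snd z) + \<beta> / snd z) (\<lambda>z. 0) (\<lambda>z. 0)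
      (\<lambda>z. - C * a (snd z) - \<beta> / (snd z)\<^sup>2)"
  proof (rule test_data_time[where f="\<lambda>t. B + a t + \<beta> / t" and f'="\<lambda>t. - C * a t - \<beta> / t\<^sup>2"])
    fix t :: real assume "0 < t"
    then have "((\<lambda>t. \<beta> / t) has_real_derivative - \<beta> / t\<^sup>2) (at t)"
      by (auto intro!: derivative_eq_intros simp: power2_eq_square)
    from DERIV_add[OF DERIV_add[OF DERIV_const[of B] da[of t]] this]
    show "((\<lambda>t. B + a t + \<beta> / t) has_real_derivative - C * a t - \<beta> / t\<^sup>2) (at t)" by simp
  qed (intro continuous_intros ca, auto)
  note D = test_data_add[OF D1 D2, folded \<psi>_def]
  define R where "R = 2 * c / \<gamma> + 1 + norm x1"
  have R: "R \<ge> 1" "norm x1 < R" "2 * c / \<gamma> + 1 \<le> R" using c_pos bg by (auto simp: R_def intro: add_nonneg_pos)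
  define \<theta> where "\<theta> = min (t1 / 2) (\<beta> / (c * (1 + R) + 1))"
  have den: "c * (1 + R) + 1 > 0" using c_pos R by (simp add: add_nonneg_pos)
  have th: "\<theta> > 0" "\<theta> < t1" using t1 bg den by (auto simp: \<theta>_def min_less_iff_disj)
  have "\<theta> \<le> \<beta> / (c * (1 + R) + 1)" by (simp add: \<theta>_def)
  then have "\<theta> * (c * (1 + R) + 1) \<le> \<beta>" using den by (simp add: pos_le_divide_eq)
  then have th2: "c * (1 + R) + 1 \<le> \<beta> / \<theta>" using th by (simp add: pos_le_divide_eq mult.commute)
  let ?K = "cball (0::real^'n) R \<times> {\<theta>..T}"
  have "continuous_on ?K w" by (rule continuous_on_subset[OF cont]) (use th in auto)
  moreover have "continuous_on ?K (\<lambda>z. a (snd z))"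
    by (rule continuous_on_compose2[OF ca[of UNIV]]) (auto intro!: continuous_intros)
  then have "continuous_on ?K \<psi>" unfolding \<psi>_def using th by (intro continuous_intros) auto
  ultimately have cw: "continuous_on ?K (\<lambda>z. w z - \<psi> z)" by (intro continuous_on_diff)
  have ne: "(x1, t1) \<in> ?K" using R th t1 by auto
  obtain z where z: "z \<in> ?K" "\<And>z'. z' \<in> ?K \<Longrightarrow> w z' - \<psi> z' \<le> w z - \<psi> z"
    using continuous_attains_sup[OF compact_Times[OF compact_cball compact_Icc] _ cw] ne by blast
  obtain x t where xt: "z = (x, t)" by (cases z)
  have x: "norm x \<le> R" and t: "\<theta> \<le> t" "t \<le> T" using z(1) xt by auto
  have t0: "0 < t" using t th by simp
  have "w (x1, t1) - \<psi> (x1, t1) > 0"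
  proof -
    have "a t1 \<le> \<gamma> * exp (C * T)" using bg C t1 by (simp add: a_def mult_left_mono)
    then have "a t1 * ((norm x1)\<^sup>2 + 1) \<le> \<gamma> * exp (C * T) * ((norm x1)\<^sup>2 + 1)" by (rule mult_right_mono) simp
    also have "\<dots> = m / 4"
      unfolding \<gamma>_def by (simp add: add_nonneg_eq_0_iff divide_simps)
    finally have "a t1 * (norm x1)\<^sup>2 + a t1 \<le> m / 4" by (simp add: algebra_simps)
    moreover have "\<beta> / t1 = m / 4" using t1 by (simp add: \<beta>_def)
    ultimately show ?thesis using m by (simp add: \<psi>_def m_def)
  qed
  then have val: "w (x, t) - \<psi> (x, t) > 0" using z(2)[OF ne] xt by auto
  have wB: "w (x, t) > B"
  proof -
    have "0 \<le> a t * (norm x)\<^sup>2" "0 < \<beta> / t" using a_pos[of t] bg t0 by simp_all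
    moreover have "\<psi> (x, t) = a t * (norm x)\<^sup>2 + (B + a t + \<beta> / t)" by (simp add: \<psi>_def)
    ultimately show ?thesis using val a_pos[of t] by linarith
  qed
  have "t \<noteq> T" using wB terminal[of x] by auto
  moreover have "t \<noteq> \<theta>"
  proof
    assume "t = \<theta>"
    moreover have "c * (1 + norm x) \<le> c * (1 + R)" using x c_pos by (intro mult_left_mono) auto
    moreover have "w (x, t) \<le> c * (1 + norm x)" using c[of t x] t t0 by simp
    moreover have "0 \<le> a t * (norm x)\<^sup>2" using a_pos[of t] by simp
    ultimately show False using val th2 a_pos[of t] B by (simp add: \<psi>_def)
  qed
  moreover have "norm x \<noteq> R"
  proof
    assume *: "norm x = R"
    have "(2 * c + \<gamma>) * 1 \<le> \<gamma> * R" using R(3) bg mult_left_mono[OF R(3), of \<gamma>] by (simp add: algebra_simps)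
    then have "(2 * c + \<gamma>) * R \<le> (\<gamma> * R) * R" using R by (intro mult_right_mono) auto
    moreover have "c * 1 \<le> c * R" using R c_pos by (intro mult_left_mono) auto
    moreover have "0 < \<gamma> * R" using bg R by simp
    moreover have "\<gamma> * R\<^sup>2 \<le> a t * R\<^sup>2" using a_ge[OF t(2)] by (intro mult_right_mono) auto
    moreover have "w (x, t) \<le> c * (1 + R)" using c[of t x] t t0 * by simp
    moreover have "0 < \<beta> / t" using bg t0 by simp
    ultimately show False using val a_pos[of t] B * by (simp add: \<psi>_def algebra_simps power2_eq_square)
  qed
  ultimately have int: "norm x < R" "\<theta> < t" "t < T" using x t by auto
  define e where "e = min (R - norm x) (min (t - \<theta>) (T - t))"
  have e: "e > 0" using int by (simp add: e_def)
  have qb: "quartic_below T \<psi>"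
  proof (rule quartic_below_bounded)
    fix y :: "real^'n" and s assume s: "0 < s" "s < T"
    show "0 \<le> \<psi> (y, s)" using a_pos[of s] bg s B by (simp add: \<psi>_def)
  qed
  have lm: "w (y, s) - \<psi> (y, s) \<le> w (x, t) - \<psi> (x, t)"
    if as: "norm (y - x) < e" "\<bar>s - t\<bar> < e" for y s
  proof -
    have "norm y \<le> norm x + norm (y - x)" using norm_triangle_ineq[of x "y - x"] by simp
    then have "(y, s) \<in> ?K" using as by (auto simp: e_def)
    then show ?thesis using z(2) xt by blast
  qed
  note V = viscosity_sub_local_max[OF vs lg D qb t0 int(3) e lm, unfolded fst_conv snd_conv]
  have zc: "(x, t) \<in> closed_cyl T" using t t0 by auto
  have M: "(2 * a t) *\<^sub>R mat 1 + 0 = (2 * a t) *\<^sub>R (mat 1 :: real^'n^'n)" by simp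
  have "0 \<le> ((- C * a t) * (norm (x - 0))\<^sup>2 + (- C * a t - \<beta> / t\<^sup>2))
      + (1 + P) * (trace ((2 * a t) *\<^sub>R mat 1 + 0 :: real^'n^'n) + 0 * real CARD('n))
      + \<mu> \<bullet> ((2 * a t) *\<^sub>R (x - 0) + 0) - r * w (x, t)"
    by (rule touching_uniform_bound[OF _ _ _ p[OF zc] V])
       (use a_pos[of t] in \<open>auto simp: scaleR_matrix_vector_assoc[symmetric] inner_commute\<close>)
  moreover have "trace ((2 * a t) *\<^sub>R mat 1 + 0 :: real^'n^'n) = 2 * a t * n"
    using trace_add_mat[of 0 "2 * a t"] by (simp add: n_def trace_def)
  moreover have "\<mu> \<bullet> ((2 * a t) *\<^sub>R (x - 0) + 0) \<le> 2 * a t * (norm \<mu> * ((norm x)\<^sup>2 + 1))"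
  proof -
    have "0 \<le> (norm x - 1)\<^sup>2 + norm x" by simp
    then have "norm x \<le> (norm x)\<^sup>2 + 1" by (simp add: power2_diff)
    then have "norm \<mu> * norm x \<le> norm \<mu> * ((norm x)\<^sup>2 + 1)" by (rule mult_left_mono) simp
    then have "\<mu> \<bullet> x \<le> norm \<mu> * ((norm x)\<^sup>2 + 1)" using norm_cauchy_schwarz[of \<mu> x] by linarith
    then have "2 * a t * (\<mu> \<bullet> x) \<le> 2 * a t * (norm \<mu> * ((norm x)\<^sup>2 + 1))"
      by (rule mult_left_mono) (use a_pos[of t] in simp)
    then show ?thesis by simp
  qed
  moreover have "0 \<le> r * w (x, t)" using r wB B by simp
  moreover have "2 * a t * n * (1 + P) * 1 \<le> 2 * a t * n * (1 + P) * ((norm x)\<^sup>2 + 1)"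
    using a_pos[of t] n P by (intro mult_left_mono) auto
  moreover have "0 < \<beta> / t\<^sup>2" using bg t0 by simp
  ultimately show False by (simp add: C_def algebra_simps)
qed

section \<open>Doubling of variables\<close>

text \<open>The quartic power has a Hessian that vanishes with the distance, which tames the singularity at
  vanishing gradients. The exponential produces the negative term \<open>- K A |x - y|\<^sup>4\<close> that absorbs the dependence of
  the coefficients on \<open>x\<close>. The term \<open>\<beta> / t\<close> keeps the maximum away from \<open>t = 0\<close> and gives the strict sign.\<close>

definition penalty :: "real \<Rightarrow> real \<Rightarrow> real \<Rightarrow> real \<Rightarrow> real \<Rightarrow> real^'n \<Rightarrow> real^'n \<Rightarrow> real \<Rightarrow> real" where
  "penalty A K T \<gamma> \<beta> x y t = A * exp (K * (T - t)) * norm (x - y) ^ 4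
     + \<gamma> / 2 * ((norm x)\<^sup>2 + (norm y)\<^sup>2) + \<beta> / t"

lemma quartic_expansion:
  fixes q d :: "'a::real_inner"
  shows "norm (q + d) ^ 4 \<le> norm q ^ 4 + 4 * (norm q)\<^sup>2 * (q \<bullet> d) + 8 * (norm q)\<^sup>2 * (norm d)\<^sup>2 + 3 * norm d ^ 4"
proof -
  define a b c where "a = (norm q)\<^sup>2" and "b = q \<bullet> d" and "c = (norm d)\<^sup>2"
  have b: "b\<^sup>2 \<le> a * c" using Cauchy_Schwarz_ineq[of q d] by (simp add: a_def b_def c_def power2_norm_eq_inner)
  have "(norm (q + d))\<^sup>2 = a + 2 * b + c"
    by (simp add: a_def b_def c_def power2_norm_eq_inner inner_add_left inner_add_right inner_commute)
  then have "norm (q + d) ^ 4 = (a + 2 * b + c)\<^sup>2" by (metis power_mult numeral_Bit0 mult_2 power_add power2_eq_square power4_eq_xxxx mult.assoc)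
  also have "\<dots> = a\<^sup>2 + 4 * a * b + 2 * a * c + 4 * b\<^sup>2 + 4 * b * c + c\<^sup>2"
    by (simp add: power2_eq_square algebra_simps)
  also have "4 * b * c \<le> 2 * b\<^sup>2 + 2 * c\<^sup>2"
    using zero_le_power2[of "b - c"] by (simp add: power2_diff)
  finally have "norm (q + d) ^ 4 \<le> a\<^sup>2 + 4 * a * b + 8 * a * c + 3 * c\<^sup>2" using b by linarith
  then show ?thesis by (simp add: a_def b_def c_def power_mult[symmetric])
qed

text \<open>Reciprocal of \<open>1 + u \<le> exp u\<close>, expanded.\<close>

lemma exp_minus_le: "u \<ge> 0 \<Longrightarrow> exp (- u) \<le> 1 - u + u\<^sup>2" for u :: real
proof -
  assume u: "u \<ge> 0"
  have "exp (- u) \<le> 1 / (1 + u)"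
    using exp_ge_add_one_self[of u] u by (simp add: exp_minus divide_simps)
  also have "\<dots> \<le> 1 - u + u\<^sup>2"
  proof -
    have "(1 - u + u\<^sup>2) * (1 + u) = 1 + u ^ 3" by (simp add: algebra_simps power2_eq_square power3_eq_cube)
    then show ?thesis using u by (simp add: divide_le_eq)
  qed
  finally show ?thesis .
qed

text \<open>Near a maximum point the penalty is expanded to second order in space and first order in time.
  The error \<open>\<eta>\<close> in the time slope absorbs the mixed terms, and doubling the coefficient \<open>\<gamma>\<close> absorbs the term
  \<open>|h1 - h2|\<^sup>4\<close>.\<close>

lemma doubling_contact:
  fixes x0 y0 :: "real^'n"
  assumes max: "\<And>x y t. 0 < t \<Longrightarrow> t \<le> T \<Longrightarrow> w1 (x, t) + w2 (y, t) - penalty A K T \<gamma> \<beta> x y t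
       \<le> w1 (x0, t0) + w2 (y0, t0) - penalty A K T \<gamma> \<beta> x0 y0 t0"
    and t0: "0 < t0" "t0 < T" and pos: "A > 0" "K \<ge> 0" "\<gamma> > 0" "\<beta> > 0" "\<eta> > 0"
  defines "E \<equiv> exp (K * (T - t0))" and "q \<equiv> x0 - y0"
  shows "\<exists>\<rho>>0. 0 < t0 - \<rho> \<and> t0 + \<rho> < T \<and>
     (\<forall>h1 h2 s. norm h1 \<le> \<rho> \<longrightarrow> norm h2 \<le> \<rho> \<longrightarrow> 0 \<le> s \<longrightarrow> s \<le> \<rho> \<longrightarrow>
        w1 (x0 + h1, t0 + s) + w2 (y0 + h2, t0 + s) \<le>
          quad_bound (w1 (x0, t0) + w2 (y0, t0) + (\<eta> - \<beta> / T\<^sup>2 - K * (A * E * norm q ^ 4)) * s)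
            ((4 * A * E * (norm q)\<^sup>2) *\<^sub>R q + \<gamma> *\<^sub>R x0) (- (4 * A * E * (norm q)\<^sup>2) *\<^sub>R q + \<gamma> *\<^sub>R y0)
            ((16 * A * E * (norm q)\<^sup>2) / 2) ((2 * \<gamma>) / 2) h1 h2)"
proof -
  have E: "E > 0" by (simp add: E_def)
  have T: "T > 0" using t0 by simp
  let ?g = "\<lambda>z::(real^'n)\<times>real. A * E * K * (\<bar>norm (q + fst z) ^ 4 - norm q ^ 4\<bar> + K * \<bar>snd z\<bar> * norm (q + fst z) ^ 4)"
  have "continuous_on UNIV ?g" by (intro continuous_intros)
  then have "continuous (at (0, 0)) ?g" by (simp add: continuous_on_eq_continuous_at)
  then obtain d where d: "d > 0" "\<And>z. dist z (0, 0) < d \<Longrightarrow> dist (?g z) (?g (0, 0)) < \<eta>"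
    unfolding continuous_at_eps_delta using pos by metis
  define \<rho> where "\<rho> = min (min (d / 4) (sqrt (\<gamma> / (48 * A * E)))) (min (t0 / 2) ((T - t0) / 2))"
  have rho: "\<rho> > 0" using d(1) t0 pos E by (simp add: \<rho>_def)
  have "\<rho> \<le> d / 4" "\<rho> \<le> sqrt (\<gamma> / (48 * A * E))" "\<rho> \<le> t0 / 2" "\<rho> \<le> (T - t0) / 2" unfolding \<rho>_def by linarith+
  then have r: "3 * \<rho> < d" "\<rho> \<le> sqrt (\<gamma> / (48 * A * E))" "0 < t0 - \<rho>" "t0 + \<rho> < T" using d(1) t0 by auto
  have "\<rho>\<^sup>2 \<le> (sqrt (\<gamma> / (48 * A * E)))\<^sup>2" by (rule power_mono[OF r(2)]) (use rho in simp)
  also have "\<dots> = \<gamma> / (48 * A * E)" using pos E by simp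
  finally have rr: "48 * A * E * \<rho>\<^sup>2 \<le> \<gamma>" using pos E by (simp add: pos_le_divide_eq mult.commute)
  show ?thesis
  proof (intro exI[of _ \<rho>] conjI allI impI rho r(3,4))
    fix h1 h2 :: "real^'n" and s assume h: "norm h1 \<le> \<rho>" "norm h2 \<le> \<rho>" and s: "0 \<le> s" "s \<le> \<rho>"
    define dd where "dd = h1 - h2"
    define X where "X = norm (q + dd) ^ 4"
    define Q where "Q = norm q ^ 4"
    have dn: "norm dd \<le> 2 * \<rho>" using h norm_triangle_ineq4[of h1 h2] by (simp add: dd_def)
    have ts: "0 < t0 + s" "t0 + s \<le> T" using s r t0 by auto
    have "dist (dd, s) (0, 0) \<le> norm dd + \<bar>s\<bar>"
      using sqrt_sum_squares_le_sum_abs[of "norm dd" s] unfolding dist_Pair_Pair by (simp add: dist_norm)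
    also have "\<dots> < d" using dn s r(1) by simp
    finally have g: "A * E * K * (\<bar>X - Q\<bar> + K * s * X) < \<eta>"
      using d(2)[of "(dd, s)"] s(1) by (simp add: X_def Q_def dist_real_def abs_less_iff)
    have X0: "X \<ge> 0" by (simp add: X_def)
    have "exp (K * (T - (t0 + s))) = E * exp (- (K * s))" by (simp add: E_def exp_add[symmetric] algebra_simps)
    also have "\<dots> \<le> E * (1 - K * s + (K * s)\<^sup>2)" using E pos s by (intro mult_left_mono exp_minus_le) auto
    finally have "exp (K * (T - (t0 + s))) * X \<le> E * (1 - K * s + (K * s)\<^sup>2) * X" by (rule mult_right_mono[OF _ X0])
    then have "A * (exp (K * (T - (t0 + s))) * X) \<le> A * (E * (1 - K * s + (K * s)\<^sup>2) * X)"
      by (rule mult_left_mono) (use pos in simp)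
    also have "\<dots> = A * E * X - A * E * K * s * Q + s * (A * E * K * (- (X - Q) + K * s * X))"
      by (simp add: algebra_simps power2_eq_square)
    also have "\<dots> \<le> A * E * X - A * E * K * s * Q + s * \<eta>"
    proof -
      have "A * E * K * (- (X - Q) + K * s * X) \<le> A * E * K * (\<bar>X - Q\<bar> + K * s * X)"
        using pos E by (intro mult_left_mono) auto
      then have "A * E * K * (- (X - Q) + K * s * X) \<le> \<eta>" using g by linarith
      then show ?thesis using mult_left_mono[OF _ s(1)] by fastforce
    qed
    finally have 1: "A * exp (K * (T - (t0 + s))) * X \<le> A * E * X - A * E * K * s * Q + s * \<eta>" by (simp add: mult.assoc)
    have "X \<le> Q + 4 * (norm q)\<^sup>2 * (q \<bullet> dd) + 8 * (norm q)\<^sup>2 * (norm dd)\<^sup>2 + 3 * norm dd ^ 4"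
      unfolding X_def Q_def by (rule quartic_expansion)
    then have "A * E * X \<le> A * E * (Q + 4 * (norm q)\<^sup>2 * (q \<bullet> dd) + 8 * (norm q)\<^sup>2 * (norm dd)\<^sup>2 + 3 * norm dd ^ 4)"
      by (rule mult_left_mono) (use pos E in simp)
    moreover have "A * E * (3 * norm dd ^ 4) \<le> \<gamma> / 2 * ((norm h1)\<^sup>2 + (norm h2)\<^sup>2)"
    proof -
      have "(norm dd)\<^sup>2 \<le> (2 * \<rho>)\<^sup>2" by (rule power_mono[OF dn]) simp
      then have "(norm dd)\<^sup>2 * (norm dd)\<^sup>2 \<le> (2 * \<rho>)\<^sup>2 * (norm dd)\<^sup>2" by (rule mult_right_mono) simp
      then have "norm dd ^ 4 \<le> 4 * \<rho>\<^sup>2 * (norm dd)\<^sup>2" by (simp add: power2_eq_square power4_eq_xxxx)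
      then have "A * E * (3 * norm dd ^ 4) \<le> A * E * (3 * (4 * \<rho>\<^sup>2 * (norm dd)\<^sup>2))" using pos E by (intro mult_left_mono) auto
      also have "\<dots> = (48 * A * E * \<rho>\<^sup>2) * ((norm dd)\<^sup>2 / 4)" by simp
      also have "\<dots> \<le> \<gamma> * ((norm dd)\<^sup>2 / 4)" by (rule mult_right_mono[OF rr]) simp
      also have "\<dots> \<le> \<gamma> * ((2 * (norm h1)\<^sup>2 + 2 * (norm h2)\<^sup>2) / 4)"
        using norm_diff_sq_le[of h1 h2] pos unfolding dd_def by (intro mult_left_mono divide_right_mono) auto
      also have "\<dots> = \<gamma> / 2 * ((norm h1)\<^sup>2 + (norm h2)\<^sup>2)" by (simp add: field_simps)
      finally show ?thesis .
    qed
    ultimately have 2: "A * E * X \<le> A * E * Q + 4 * A * E * (norm q)\<^sup>2 * (q \<bullet> dd) + 8 * A * E * (norm q)\<^sup>2 * (norm dd)\<^sup>2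
        + \<gamma> / 2 * ((norm h1)\<^sup>2 + (norm h2)\<^sup>2)" by (simp add: algebra_simps)
    have 3: "\<beta> / (t0 + s) - \<beta> / t0 \<le> - (\<beta> / T\<^sup>2 * s)"
    proof -
      have "t0 * (t0 + s) \<le> T * T" using ts t0 by (intro mult_mono) auto
      moreover have "0 < t0 * (t0 + s)" using ts t0 by simp
      ultimately have "\<beta> * s / (T * T) \<le> \<beta> * s / (t0 * (t0 + s))" using pos s by (intro divide_left_mono) (auto intro: mult_pos_pos T)
      moreover have "\<beta> / (t0 + s) - \<beta> / t0 = - (\<beta> * s / (t0 * (t0 + s)))"
        using ts t0 by (simp add: field_simps)
      ultimately show ?thesis by (simp add: power2_eq_square)
    qed
    have n1: "(norm (x0 + h1))\<^sup>2 = (norm x0)\<^sup>2 + 2 * (x0 \<bullet> h1) + (norm h1)\<^sup>2"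
      "(norm (y0 + h2))\<^sup>2 = (norm y0)\<^sup>2 + 2 * (y0 \<bullet> h2) + (norm h2)\<^sup>2"
      using norm_add_scaled_sq[of x0 1 h1] norm_add_scaled_sq[of y0 1 h2] by simp_all
    have xq: "x0 + h1 - (y0 + h2) = q + dd" by (simp add: q_def dd_def)
    have "w1 (x0 + h1, t0 + s) + w2 (y0 + h2, t0 + s) \<le> w1 (x0, t0) + w2 (y0, t0)
       + (A * exp (K * (T - (t0 + s))) * X - A * E * Q)
       + \<gamma> / 2 * ((norm (x0 + h1))\<^sup>2 + (norm (y0 + h2))\<^sup>2 - (norm x0)\<^sup>2 - (norm y0)\<^sup>2) + (\<beta> / (t0 + s) - \<beta> / t0)"
      using max[OF ts, of "x0 + h1" "y0 + h2"] unfolding penalty_def xq X_def[symmetric]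
      by (simp add: E_def q_def Q_def algebra_simps)
    also have "\<dots> \<le> w1 (x0, t0) + w2 (y0, t0) + (\<eta> - \<beta> / T\<^sup>2 - K * (A * E * Q)) * s
        + 4 * A * E * (norm q)\<^sup>2 * (q \<bullet> dd) + 8 * A * E * (norm q)\<^sup>2 * (norm dd)\<^sup>2
        + \<gamma> * (x0 \<bullet> h1) + \<gamma> * (y0 \<bullet> h2) + \<gamma> * ((norm h1)\<^sup>2 + (norm h2)\<^sup>2)"
      using 1 2 3 unfolding n1 by (simp add: algebra_simps)
    finally show "w1 (x0 + h1, t0 + s) + w2 (y0 + h2, t0 + s) \<le>
          quad_bound (w1 (x0, t0) + w2 (y0, t0) + (\<eta> - \<beta> / T\<^sup>2 - K * (A * E * norm q ^ 4)) * s)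
            ((4 * A * E * (norm q)\<^sup>2) *\<^sub>R q + \<gamma> *\<^sub>R x0) (- (4 * A * E * (norm q)\<^sup>2) *\<^sub>R q + \<gamma> *\<^sub>R y0)
            ((16 * A * E * (norm q)\<^sup>2) / 2) ((2 * \<gamma>) / 2) h1 h2"
      unfolding quad_bound_def by (simp add: Q_def dd_def inner_add_left inner_diff_right algebra_simps)
  qed
qed

text \<open>The quadratic penalty and \<open>\<beta> / t\<close> make the doubled function negative outside a compact set, and the
  assumption on the terminal values excludes \<open>t0 = T\<close>.\<close>

lemma doubling_max:
  fixes w1 w2 :: "(real^'n) \<times> real \<Rightarrow> real"
  assumes c1: "continuous_on (closed_cyl T) w1" and c2: "continuous_on (closed_cyl T) w2"
    and B: "\<And>x y t. 0 < t \<Longrightarrow> t \<le> T \<Longrightarrow> w1 (x, t) + w2 (y, t) \<le> B" "B \<ge> 0"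
    and terminal: "\<And>x y. w1 (x, T) + w2 (y, T) - A * norm (x - y) ^ 4 < \<sigma>" and sig: "0 < \<sigma>"
    and start: "0 < t1" "t1 \<le> T" "w1 (x1, t1) + w2 (x1, t1) - penalty A K T \<gamma> \<beta> x1 x1 t1 \<ge> \<sigma>"
    and pos: "A > 0" "K \<ge> 0" "\<gamma> > 0" "\<beta> > 0"
  obtains x0 y0 t0 where "0 < t0" "t0 < T"
    "w1 (x0, t0) + w2 (y0, t0) - penalty A K T \<gamma> \<beta> x0 y0 t0 \<ge> \<sigma>"
    "\<And>x y t. 0 < t \<Longrightarrow> t \<le> T \<Longrightarrow> w1 (x, t) + w2 (y, t) - penalty A K T \<gamma> \<beta> x y t
       \<le> w1 (x0, t0) + w2 (y0, t0) - penalty A K T \<gamma> \<beta> x0 y0 t0"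
proof -
  let ?\<Phi> = "\<lambda>x y t. w1 (x, t) + w2 (y, t) - penalty A K T \<gamma> \<beta> x y t"
  define R where "R = sqrt (2 * B / \<gamma>) + norm x1"
  define \<theta> where "\<theta> = min t1 (\<beta> / (B + 1))"
  have th: "0 < \<theta>" "\<theta> \<le> t1" using start pos B by (simp_all add: \<theta>_def)
  let ?K = "(cball (0::real^'n) R \<times> cball (0::real^'n) R) \<times> {\<theta>..T}"
  have pen: "A * exp (K * (T - t)) * norm (x - y) ^ 4 \<ge> 0" for x y :: "real^'n" and t using pos by simp
  have c: "continuous_on ?K (\<lambda>p. ?\<Phi> (fst (fst p)) (snd (fst p)) (snd p))"
  proof (intro continuous_on_diff continuous_on_add)
    show "continuous_on ?K (\<lambda>p. w1 (fst (fst p), snd p))"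
      by (rule continuous_on_compose2[OF c1]) (use th in \<open>auto intro!: continuous_intros\<close>)
    show "continuous_on ?K (\<lambda>p. w2 (snd (fst p), snd p))"
      by (rule continuous_on_compose2[OF c2]) (use th in \<open>auto intro!: continuous_intros\<close>)
    show "continuous_on ?K (\<lambda>p. penalty A K T \<gamma> \<beta> (fst (fst p)) (snd (fst p)) (snd p))"
      unfolding penalty_def using th by (intro continuous_intros) auto
  qed
  have "0 \<le> sqrt (2 * B / \<gamma>)" using B pos by simp
  then have ne: "((x1, x1), t1) \<in> ?K" using th start by (simp add: R_def)
  have comp: "compact ?K" by (intro compact_Times compact_cball compact_Icc)
  obtain z where z: "z \<in> ?K" "\<And>p. p \<in> ?K \<Longrightarrow> ?\<Phi> (fst (fst p)) (snd (fst p)) (snd p) \<le> ?\<Phi> (fst (fst z)) (snd (fst z)) (snd z)"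
    using continuous_attains_sup[OF comp _ c] ne by blast
  obtain x0 y0 t0 where xyt: "z = ((x0, y0), t0)" by (metis surj_pair)
  have val: "?\<Phi> x0 y0 t0 \<ge> \<sigma>" using z(2)[OF ne] start(3) unfolding xyt by simp
  have out: "?\<Phi> x y t \<le> ?\<Phi> x0 y0 t0" if t: "0 < t" "t \<le> T" for x y t
  proof (cases "((x, y), t) \<in> ?K")
    case True
    then show ?thesis using z(2)[OF True] unfolding xyt by simp
  next
    case False
    have "?\<Phi> x y t \<le> 0"
    proof (cases "t < \<theta>")
      case True
      then have "t < \<beta> / (B + 1)" by (simp add: \<theta>_def)
      then have "t * (B + 1) < \<beta>" using B(2) by (simp add: pos_less_divide_eq)
      then have "B + 1 < \<beta> / t" using t by (simp add: pos_less_divide_eq mult.commute)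
      moreover have "0 \<le> \<gamma> / 2 * ((norm x)\<^sup>2 + (norm y)\<^sup>2)" using pos by simp
      ultimately show ?thesis using B(1)[OF t, of x y] pen[of t x y] unfolding penalty_def by linarith
    next
      case f: False
      then have "norm x > R \<or> norm y > R" using False t by auto
      then have "norm x > sqrt (2 * B / \<gamma>) \<or> norm y > sqrt (2 * B / \<gamma>)"
        using norm_ge_zero[of x1] unfolding R_def by linarith
      then have "(norm x)\<^sup>2 \<ge> 2 * B / \<gamma> \<or> (norm y)\<^sup>2 \<ge> 2 * B / \<gamma>"
        using sqrt_le_D less_imp_le by metis
      then have "2 * B / \<gamma> \<le> (norm x)\<^sup>2 + (norm y)\<^sup>2"
        using zero_le_power2[of "norm x"] zero_le_power2[of "norm y"] by linarith
      then have "B \<le> \<gamma> / 2 * ((norm x)\<^sup>2 + (norm y)\<^sup>2)" using pos by (simp add: pos_divide_le_eq mult.commute)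
      moreover have "0 < \<beta> / t" using pos t by simp
      ultimately show ?thesis using B(1)[OF t, of x y] pen[of t x y] unfolding penalty_def by linarith
    qed
    then show ?thesis using val sig by linarith
  qed
  have t0: "0 < t0" "t0 \<le> T" using z(1) th unfolding xyt by auto
  have "t0 \<noteq> T"
  proof
    assume "t0 = T"
    moreover have "0 \<le> \<gamma> / 2 * ((norm x0)\<^sup>2 + (norm y0)\<^sup>2)" using pos by simp
    moreover have "0 < \<beta> / T" using pos t0 by simp
    ultimately show False using val terminal[of x0 y0] unfolding penalty_def by simp
  qed
  then show thesis using that[of t0 x0 y0] t0 val out by auto
qed

lemma sqrt_diff_sq_le:
  assumes "0 < c" "c \<le> a" "c \<le> b"
  shows "(sqrt a - sqrt b)\<^sup>2 \<le> (a - b)\<^sup>2 / (4 * c)"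
proof -
  have s: "sqrt c \<le> sqrt a" "sqrt c \<le> sqrt b" "0 < sqrt c" using assms by auto
  have "(2 * sqrt c)\<^sup>2 \<le> (sqrt a + sqrt b)\<^sup>2" by (rule power_mono) (use s in linarith)+
  then have "4 * c \<le> (sqrt a + sqrt b)\<^sup>2" using assms by (simp add: power_mult_distrib)
  then have "(sqrt a - sqrt b)\<^sup>2 * (4 * c) \<le> (sqrt a - sqrt b)\<^sup>2 * (sqrt a + sqrt b)\<^sup>2"
    by (rule mult_left_mono) simp
  also have "\<dots> = ((sqrt a - sqrt b) * (sqrt a + sqrt b))\<^sup>2" by (simp add: power_mult_distrib)
  also have "(sqrt a - sqrt b) * (sqrt a + sqrt b) = a - b"
    using assms by (simp add: algebra_simps)
  finally show ?thesis using assms by (simp add: pos_le_divide_eq)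
qed

text \<open>The two consequences of the equations at a maximum point of the doubled function. The first is used when
  \<open>x0 - y0\<close> is small: the same multiple of the Laplacian serves both variables, so the coupled directions have zero difference
  and only terms proportional to \<open>\<kappa>\<close> and \<open>\<gamma>\<close> remain. The second keeps the true coefficients. The discount terms
  drop out since \<open>w1 + w2 \<ge> 0\<close> there.\<close>

lemma doubling_inequality:
  fixes x0 y0 :: "real^'n" and w1 w2 :: "(real^'n) \<times> real \<Rightarrow> real"
  assumes vs: "viscosity_sub T (pLap_F p \<mu> r) w1" "viscosity_sub T (pLap_F p \<mu> r) w2"
    and lg: "linear_growth T w1" "linear_growth T w2"
    and c: "continuous_on (closed_cyl T) w1" "continuous_on (closed_cyl T) w2"
    and r: "r \<ge> 0" and p: "\<And>z. z \<in> closed_cyl T \<Longrightarrow> p z \<in> {1..P}" and pc: "continuous_on (closed_cyl T) p"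
    and max: "\<And>x y t. 0 < t \<Longrightarrow> t \<le> T \<Longrightarrow> w1 (x, t) + w2 (y, t) - penalty A K T \<gamma> \<beta> x y t
       \<le> w1 (x0, t0) + w2 (y0, t0) - penalty A K T \<gamma> \<beta> x0 y0 t0"
    and t0: "0 < t0" "t0 < T" and pos: "A > 0" "K \<ge> 0" "\<gamma> > 0" "\<beta> > 0" "\<eta> > 0"
    and m: "0 \<le> w1 (x0, t0) + w2 (y0, t0)"
  defines "q \<equiv> x0 - y0" and "n \<equiv> real CARD('n)"
  defines "\<Lambda> \<equiv> A * exp (K * (T - t0))"
  defines "\<nu>1 \<equiv> (4 * \<Lambda> * (norm q)\<^sup>2) *\<^sub>R q + \<gamma> *\<^sub>R x0"
    and "\<nu>2 \<equiv> - (4 * \<Lambda> * (norm q)\<^sup>2) *\<^sub>R q + \<gamma> *\<^sub>R y0"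
    and "\<kappa> \<equiv> 64 * \<Lambda> * (norm q)\<^sup>2 + 4 * \<gamma>"
  shows "\<beta> / T\<^sup>2 + K * (\<Lambda> * norm q ^ 4) \<le> 3 * \<eta> + 2 * (1 + P) * n * \<kappa> + \<mu> \<bullet> (\<nu>1 + \<nu>2) + 8 * \<gamma> * (1 + P) * n"
    and "\<nu>1 \<noteq> 0 \<Longrightarrow> \<nu>2 \<noteq> 0 \<Longrightarrow> \<beta> / T\<^sup>2 + K * (\<Lambda> * norm q ^ 4) \<le> 3 * \<eta> + 2 * \<kappa> * \<eta> * (n + 1) + \<mu> \<bullet> (\<nu>1 + \<nu>2)
       + coupling_cost
          (diffusion_field (sqrt (1 + \<eta>)) (sqrt (p (x0, t0) - 1 + \<eta>) - sqrt (1 + \<eta>)) ((1 / norm \<nu>1) *\<^sub>R \<nu>1))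
          (diffusion_field (sqrt (1 + \<eta>)) (sqrt (p (y0, t0) - 1 + \<eta>) - sqrt (1 + \<eta>)) ((1 / norm \<nu>2) *\<^sub>R (- \<nu>2)))
          (16 * \<Lambda> * (norm q)\<^sup>2) (2 * \<gamma>)"
proof -
  define \<alpha> where "\<alpha> = 16 * \<Lambda> * (norm q)\<^sup>2"
  define \<tau> where "\<tau> = \<eta> - \<beta> / T\<^sup>2 - K * (\<Lambda> * norm q ^ 4)"
  have L: "\<Lambda> > 0" using pos by (simp add: \<Lambda>_def)
  have al: "\<alpha> \<ge> 0" using L by (simp add: \<alpha>_def)
  have k: "\<kappa> = 4 * \<alpha> + 2 * (2 * \<gamma>)" by (simp add: \<kappa>_def \<alpha>_def)
  have kpos: "\<kappa> > 0" unfolding k using al pos by simp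
  obtain \<rho> where rho: "\<rho> > 0" "0 < t0 - \<rho>" "t0 + \<rho> < T"
    and contact: "\<And>h1 h2 s. norm h1 \<le> \<rho> \<Longrightarrow> norm h2 \<le> \<rho> \<Longrightarrow> 0 \<le> s \<Longrightarrow> s \<le> \<rho> \<Longrightarrow>
        w1 (x0 + h1, t0 + s) + w2 (y0 + h2, t0 + s) \<le>
          quad_bound (w1 (x0, t0) + w2 (y0, t0) + \<tau> * s) \<nu>1 \<nu>2 (\<alpha> / 2) (2 * \<gamma> / 2) h1 h2"
    using doubling_contact[OF max t0 pos]
    unfolding q_def[symmetric] \<nu>1_def \<nu>2_def \<alpha>_def \<tau>_def \<Lambda>_def mult.assoc by blast
  have cyl: "cball z \<rho> \<times> {t0 - \<rho>..t0 + \<rho>} \<subseteq> closed_cyl T" for z :: "real^'n" using rho by auto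
  have A: "touching_supconv \<kappa> \<rho> t0 x0 w1 \<nu>1 (\<alpha> + 2 * \<gamma>)"
  proof
    show "continuous_on (cball x0 \<rho> \<times> {t0 - \<rho>..t0 + \<rho>}) w1" by (rule continuous_on_subset[OF c(1) cyl])
    show "w1 (x0 + h, t0) \<le> w1 (x0, t0) + \<nu>1 \<bullet> h + (\<alpha> + 2 * \<gamma>) / 2 * (norm h)\<^sup>2" if "norm h \<le> \<rho>" for h
      using contact[OF that, of 0 0] rho by (simp add: quad_bound_def algebra_simps add_divide_distrib)
  qed (use kpos rho k al pos in auto)
  have B: "touching_supconv \<kappa> \<rho> t0 y0 w2 \<nu>2 (\<alpha> + 2 * \<gamma>)"
  proof
    show "continuous_on (cball y0 \<rho> \<times> {t0 - \<rho>..t0 + \<rho>}) w2" by (rule continuous_on_subset[OF c(2) cyl])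
    show "w2 (y0 + h, t0) \<le> w2 (y0, t0) + \<nu>2 \<bullet> h + (\<alpha> + 2 * \<gamma>) / 2 * (norm h)\<^sup>2" if "norm h \<le> \<rho>" for h
      using contact[OF _ that, of 0 0] rho by (simp add: quad_bound_def algebra_simps add_divide_distrib)
  qed (use kpos rho k al pos in auto)
  have g: "0 \<le> 2 * \<gamma>" using pos by simp
  have rm: "0 \<le> r * (w1 (x0, t0) + w2 (y0, t0))" using r m by simp
  have zc: "(x0, t0) \<in> closed_cyl T" "(y0, t0) \<in> closed_cyl T" using t0 by auto
  obtain i :: 'n where "True" by simp
  define e where "e = axis i (1::real)"
  have e: "norm e = 1" by (simp add: e_def)
  have P: "P \<ge> 1" using p[OF zc(1)] by simp
  have "0 \<le> \<tau> + ((1 + P) * \<kappa> * real CARD('n) + \<mu> \<bullet> \<nu>1 - r * w1 (x0, t0) + \<eta>)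
     + ((1 + P) * \<kappa> * real CARD('n) + \<mu> \<bullet> \<nu>2 - r * w2 (y0, t0) + \<eta>)
     + coupling_cost (diffusion_field (sqrt (1 + P)) 0 e) (diffusion_field (sqrt (1 + P)) 0 e) \<alpha> (2 * \<gamma>)"
    by (rule supconv_theorem_on_sums[OF A B k al g rho(2,3) contact
        touching_supconv.supconv_linear_sub_degenerate[OF A vs(1) lg(1) rho(2,3) r pos(5) p e]
        touching_supconv.supconv_linear_sub_degenerate[OF B vs(2) lg(2) rho(2,3) r pos(5) p e]])
  moreover have "coupling_cost (diffusion_field (sqrt (1 + P)) 0 e) (diffusion_field (sqrt (1 + P)) 0 e) \<alpha> (2 * \<gamma>)
     = 8 * \<gamma> * (1 + P) * n"
    using P by (simp add: coupling_cost_def diffusion_field_def n_def)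
  ultimately show "\<beta> / T\<^sup>2 + K * (\<Lambda> * norm q ^ 4) \<le> 3 * \<eta> + 2 * (1 + P) * n * \<kappa> + \<mu> \<bullet> (\<nu>1 + \<nu>2) + 8 * \<gamma> * (1 + P) * n"
    using rm by (simp add: \<tau>_def n_def inner_add_right algebra_simps)
  assume nu: "\<nu>1 \<noteq> 0" "\<nu>2 \<noteq> 0"
  define e1 where "e1 = (1 / norm \<nu>1) *\<^sub>R \<nu>1"
  define e2 where "e2 = (1 / norm \<nu>2) *\<^sub>R \<nu>2"
  \<comment> \<open>In the application the two slopes are nearly opposite, so the fields are compared through \<open>- \<nu>2\<close>; the field is even in \<open>e\<close>.\<close>
  have e2': "(1 / norm \<nu>2) *\<^sub>R (- \<nu>2) = - e2" by (simp add: e2_def)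
  have p1: "p (x0, t0) \<ge> 1" "p (y0, t0) \<ge> 1" using p zc by auto
  have "0 \<le> \<tau> + (\<kappa> * \<eta> * (real CARD('n) + 1) + \<mu> \<bullet> \<nu>1 - r * w1 (x0, t0) + \<eta>)
     + (\<kappa> * \<eta> * (real CARD('n) + 1) + \<mu> \<bullet> \<nu>2 - r * w2 (y0, t0) + \<eta>)
     + coupling_cost (diffusion_field (sqrt (1 + \<eta>)) (sqrt (p (x0, t0) - 1 + \<eta>) - sqrt (1 + \<eta>)) e1)
         (diffusion_field (sqrt (1 + \<eta>)) (sqrt (p (y0, t0) - 1 + \<eta>) - sqrt (1 + \<eta>)) e2) \<alpha> (2 * \<gamma>)"
    by (rule supconv_theorem_on_sums[OF A B k al g rho(2,3) contact
        touching_supconv.supconv_linear_sub_nondegenerate[OF A vs(1) lg(1) rho(2,3) r pos(5) p1(1) pc nu(1) e1_def]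
        touching_supconv.supconv_linear_sub_nondegenerate[OF B vs(2) lg(2) rho(2,3) r pos(5) p1(2) pc nu(2) e2_def]])
  then show "\<beta> / T\<^sup>2 + K * (\<Lambda> * norm q ^ 4) \<le> 3 * \<eta> + 2 * \<kappa> * \<eta> * (n + 1) + \<mu> \<bullet> (\<nu>1 + \<nu>2)
       + coupling_cost
          (diffusion_field (sqrt (1 + \<eta>)) (sqrt (p (x0, t0) - 1 + \<eta>) - sqrt (1 + \<eta>)) ((1 / norm \<nu>1) *\<^sub>R \<nu>1))
          (diffusion_field (sqrt (1 + \<eta>)) (sqrt (p (y0, t0) - 1 + \<eta>) - sqrt (1 + \<eta>)) ((1 / norm \<nu>2) *\<^sub>R (- \<nu>2)))
          (16 * \<Lambda> * (norm q)\<^sup>2) (2 * \<gamma>)"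
    unfolding e2' diffusion_field_uminus e1_def[symmetric] \<alpha>_def[symmetric]
    using rm by (simp add: \<tau>_def n_def inner_add_right algebra_simps)
qed

lemma coupling_cost_diffusion_le:
  fixes e f :: "real^'n"
  assumes e: "norm e = 1" "norm f = 1" and ag: "\<alpha> \<ge> 0" "\<gamma> \<ge> 0" and s: "s\<^sup>2 \<le> S" "s'\<^sup>2 \<le> S" and l: "l\<^sup>2 \<le> 2"
  shows "coupling_cost (diffusion_field l s e) (diffusion_field l s' f) \<alpha> \<gamma>
    \<le> real CARD('n) * (4 * \<alpha> * (s - s')\<^sup>2 + 16 * \<alpha> * S * (norm (e - f))\<^sup>2 + 2 * \<gamma> * (8 + 4 * S))"
proof -
  have "2 * (\<alpha> * (norm (diffusion_field l s e i - diffusion_field l s' f i))\<^sup>2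
      + \<gamma> * ((norm (diffusion_field l s e i))\<^sup>2 + (norm (diffusion_field l s' f i))\<^sup>2))
     \<le> 4 * \<alpha> * (s - s')\<^sup>2 + 16 * \<alpha> * S * (norm (e - f))\<^sup>2 + 2 * \<gamma> * (8 + 4 * S)" for i
  proof -
    have "8 * s'\<^sup>2 * (norm (e - f))\<^sup>2 \<le> 8 * S * (norm (e - f))\<^sup>2" using s by (intro mult_right_mono) auto
    then have "(norm (diffusion_field l s e i - diffusion_field l s' f i))\<^sup>2 \<le> 2 * (s - s')\<^sup>2 + 8 * S * (norm (e - f))\<^sup>2"
      using diffusion_field_diff[OF e, of l s i s'] by linarith
    then have "\<alpha> * (norm (diffusion_field l s e i - diffusion_field l s' f i))\<^sup>2 \<le> \<alpha> * (2 * (s - s')\<^sup>2 + 8 * S * (norm (e - f))\<^sup>2)"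
      by (rule mult_left_mono[OF _ ag(1)])
    moreover have "(norm (diffusion_field l s e i))\<^sup>2 + (norm (diffusion_field l s' f i))\<^sup>2 \<le> 8 + 4 * S"
      using norm_diffusion_field[OF e(1), of l s i] norm_diffusion_field[OF e(2), of l s' i] s l by linarith
    then have "\<gamma> * ((norm (diffusion_field l s e i))\<^sup>2 + (norm (diffusion_field l s' f i))\<^sup>2) \<le> \<gamma> * (8 + 4 * S)"
      by (rule mult_left_mono[OF _ ag(2)])
    ultimately show ?thesis by (simp add: algebra_simps)
  qed
  then have "coupling_cost (diffusion_field l s e) (diffusion_field l s' f) \<alpha> \<gamma>
    \<le> (\<Sum>i\<in>(UNIV::'n set). 4 * \<alpha> * (s - s')\<^sup>2 + 16 * \<alpha> * S * (norm (e - f))\<^sup>2 + 2 * \<gamma> * (8 + 4 * S))"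
    unfolding coupling_cost_def by (rule sum_mono)
  then show ?thesis by simp
qed


text \<open>The constants are chosen in the order \<open>K\<close>, \<open>A\<close>, \<open>\<beta>\<close>, \<open>\<eta>\<close>, \<open>\<delta>\<close>, \<open>\<gamma>\<close>. The constant \<open>A\<close> handles the terminal
  values, \<open>K\<close> the oscillation of \<open>p\<close>, and \<open>\<beta>\<close> supplies the amount \<open>b = \<beta> / T\<^sup>2\<close> that all the other terms together
  fail to reach. If \<open>|x0 - y0| < \<delta>\<close>, the degenerate inequality applies and \<open>\<kappa> = O(\<delta>\<^sup>2 + \<gamma>)\<close>. Otherwise both slopes have norm at least
  of order \<open>\<delta>\<^sup>3\<close> while their sum is \<open>O(\<surd>\<gamma>)\<close>, so their directions are opposite up to an error that vanishes with \<open>\<gamma>\<close>,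
  and the remaining cost of the coupling is the one that \<open>K\<close> absorbs.\<close>

lemma parabolic_comparison:
  fixes w1 w2 :: "(real^'n) \<times> real \<Rightarrow> real"
  assumes vs: "viscosity_sub T (pLap_F p \<mu> r) w1" "viscosity_sub T (pLap_F p \<mu> r) w2"
    and lg: "linear_growth T w1" "linear_growth T w2"
    and c: "continuous_on (closed_cyl T) w1" "continuous_on (closed_cyl T) w2"
    and r: "r \<ge> 0" and p: "\<And>z. z \<in> closed_cyl T \<Longrightarrow> p z \<in> {pmin..P}" and pmin: "1 < pmin"
    and pc: "continuous_on (closed_cyl T) p"
    and pL: "\<And>x y t. 0 \<le> t \<Longrightarrow> t \<le> T \<Longrightarrow> \<bar>p (x, t) - p (y, t)\<bar> \<le> L * norm (x - y)"
    and B: "\<And>x y t. 0 < t \<Longrightarrow> t \<le> T \<Longrightarrow> w1 (x, t) + w2 (y, t) \<le> B" "B \<ge> 0"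
    and terminal: "\<And>x y. w1 (x, T) + w2 (y, T) \<le> Lg * norm (x - y)"
    and t1: "0 < t1" "t1 \<le> T"
  shows "w1 (x1, t1) + w2 (x1, t1) \<le> 0"
proof (rule ccontr)
  assume neg: "\<not> ?thesis"
  define \<sigma> where "\<sigma> = (w1 (x1, t1) + w2 (x1, t1)) / 4"
  have sig: "\<sigma> > 0" using neg by (simp add: \<sigma>_def)
  define n where "n = real CARD('n)"
  have n: "n \<ge> 1" unfolding n_def using one_le_card_finite[where 'a='n] by linarith
  have T: "T > 0" using t1 by simp
  have p1: "p z \<in> {1..P}" if "z \<in> closed_cyl T" for z using p[OF that] pmin by auto
  have P: "P \<ge> 1" using p1[of "(x1, t1)"] t1 by auto
  \<comment> \<open>The square root of \<open>p - 1\<close> is Lipschitz with constant \<open>L / (2 \<surd>(pmin - 1))\<close>; this \<open>K\<close> makes the absorption exact.\<close>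
  define K where "K = 16 * n * L\<^sup>2 / (pmin - 1)"
  have K: "K \<ge> 0" using n pmin by (simp add: K_def)
  define M where "M = \<bar>Lg\<bar> + 1"
  have M: "M > 0" "Lg \<le> M" by (auto simp: M_def)
  \<comment> \<open>With this \<open>A\<close> the terminal values satisfy \<open>Lg d - A d\<^sup>4 < 2 \<sigma>\<close> for every distance \<open>d\<close>.\<close>
  define A where "A = M ^ 4 / \<sigma> ^ 3"
  have A: "A > 0" using M sig by (simp add: A_def)
  have term': "w1 (x, T) + w2 (y, T) - A * norm (x - y) ^ 4 < 2 * \<sigma>" for x y
  proof -
    define d where "d = norm (x - y)"
    have d: "d \<ge> 0" by (simp add: d_def)
    have Ad: "A * d ^ 4 \<ge> 0" using A d by simp
    have "Lg * d \<le> M * d" using M d by (intro mult_right_mono) auto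
    moreover have "M * d - A * d ^ 4 \<le> \<sigma>"
    proof (cases "M * d \<le> \<sigma>")
      case True then show ?thesis using Ad by linarith
    next
      case False
      then have "\<sigma> ^ 3 \<le> (M * d) ^ 3" using sig by (intro power_mono) auto
      then have "(M * d) * \<sigma> ^ 3 \<le> (M * d) * (M * d) ^ 3" using M d by (intro mult_left_mono) auto
      then have "M * d \<le> M ^ 4 * d ^ 4 / \<sigma> ^ 3"
        using sig by (simp add: pos_le_divide_eq power_mult_distrib power4_eq_xxxx power3_eq_cube mult_ac)
      then show ?thesis using sig by (simp add: A_def)
    qed
    ultimately show ?thesis using terminal[of x y] sig unfolding d_def by linarith
  qed
  define \<beta> where "\<beta> = \<sigma> * t1"
  define b where "b = \<beta> / T\<^sup>2"
  have be: "\<beta> > 0" "b > 0" using sig t1 T by (simp_all add: \<beta>_def b_def)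
  define \<Lambda>m where "\<Lambda>m = A * exp (K * T)"
  define Q2 where "Q2 = sqrt (B / A)"
  define \<kappa>m where "\<kappa>m = 64 * \<Lambda>m * Q2 + 4"
  have Lm: "\<Lambda>m > 0" using A by (simp add: \<Lambda>m_def)
  have Q2: "Q2 \<ge> 0" using A B by (simp add: Q2_def)
  have km: "\<kappa>m > 0" using Lm Q2 by (simp add: \<kappa>m_def add_nonneg_pos)
  define \<eta> where "\<eta> = min 1 (min (b / 12) (b / (8 * \<kappa>m * (n + 1))))"
  have eta: "\<eta> > 0" using be km n by (simp add: \<eta>_def)
  have "\<eta> \<le> 1" "\<eta> \<le> b / 12" "\<eta> \<le> b / (8 * \<kappa>m * (n + 1))" unfolding \<eta>_def by linarith+
  then have eta2: "\<eta> \<le> 1" "3 * \<eta> \<le> b / 4" "2 * \<kappa>m * \<eta> * (n + 1) \<le> b / 4"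
    using km n by (simp_all add: pos_le_divide_eq mult_ac)
  \<comment> \<open>In the degenerate case the terms with \<open>\<delta>\<close> contribute exactly \<open>b / 4\<close>.\<close>
  define \<delta> where "\<delta> = sqrt (b / (512 * (1 + P) * n * \<Lambda>m))"
  have den: "512 * (1 + P) * n * \<Lambda>m > 0" using P n Lm by simp
  have del: "\<delta> > 0" using be den by (simp add: \<delta>_def)
  have "\<delta>\<^sup>2 = b / (512 * (1 + P) * n * \<Lambda>m)" using be den by (simp add: \<delta>_def)
  then have del2: "128 * (1 + P) * n * \<Lambda>m * \<delta>\<^sup>2 = b / 4" using den by (simp add: field_simps)
  define S where "S = 2 * P + 4"
  define g where "g \<gamma> = sqrt (2 * B * \<gamma>)" for \<gamma>
  define \<alpha>m where "\<alpha>m = 16 * \<Lambda>m * Q2"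
  let ?f1 = "\<lambda>\<gamma>. 16 * (1 + P) * n * \<gamma> + 2 * norm \<mu> * g \<gamma>"
  let ?f2 = "\<lambda>\<gamma>. 2 * norm \<mu> * g \<gamma> + n * (16 * \<alpha>m * S * (2 * g \<gamma> / (A * \<delta> ^ 3))\<^sup>2 + 2 * (2 * \<gamma>) * (8 + 4 * S))"
  have tg: "(g \<longlongrightarrow> 0) (at_right 0)"
  proof -
    have "((\<lambda>\<gamma>. sqrt (2 * B * \<gamma>)) \<longlongrightarrow> sqrt (2 * B * 0)) (at_right 0)" by (intro tendsto_intros)
    then show ?thesis unfolding g_def by simp
  qed
  have Ad: "A * \<delta> ^ 3 \<noteq> 0" using A del by simp
  have ev: "\<forall>\<^sub>F \<gamma> in at_right (0::real). \<gamma> < 1" "\<forall>\<^sub>F \<gamma> in at_right 0. \<gamma> * (norm x1)\<^sup>2 < \<sigma>"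
      "\<forall>\<^sub>F \<gamma> in at_right 0. ?f1 \<gamma> < b / 4" "\<forall>\<^sub>F \<gamma> in at_right 0. g \<gamma> < 2 * A * \<delta> ^ 3"
      "\<forall>\<^sub>F \<gamma> in at_right 0. ?f2 \<gamma> < b / 4" "\<forall>\<^sub>F \<gamma> in at_right (0::real). 0 < \<gamma>"
  proof -
    have t0: "((\<lambda>\<gamma>. \<gamma>) \<longlongrightarrow> 0) (at_right (0::real))" by (rule tendsto_ident_at)
    show "\<forall>\<^sub>F \<gamma> in at_right (0::real). \<gamma> < 1" by (rule order_tendstoD(2)[OF t0]) simp
    have "((\<lambda>\<gamma>. \<gamma> * (norm x1)\<^sup>2) \<longlongrightarrow> 0 * (norm x1)\<^sup>2) (at_right 0)" by (intro tendsto_intros t0)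
    then show "\<forall>\<^sub>F \<gamma> in at_right 0. \<gamma> * (norm x1)\<^sup>2 < \<sigma>" by (rule order_tendstoD(2)) (use sig in simp)
    have "(?f1 \<longlongrightarrow> 16 * (1 + P) * n * 0 + 2 * norm \<mu> * 0) (at_right 0)" by (intro tendsto_intros t0 tg)
    then show "\<forall>\<^sub>F \<gamma> in at_right 0. ?f1 \<gamma> < b / 4" by (rule order_tendstoD(2)) (use be in simp)
    show "\<forall>\<^sub>F \<gamma> in at_right 0. g \<gamma> < 2 * A * \<delta> ^ 3" by (rule order_tendstoD(2)[OF tg]) (use A del in simp)
    have "(?f2 \<longlongrightarrow> 2 * norm \<mu> * 0 + n * (16 * \<alpha>m * S * (2 * 0 / (A * \<delta> ^ 3))\<^sup>2 + 2 * (2 * 0) * (8 + 4 * S))) (at_right 0)"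
      by (intro tendsto_intros t0 tg Ad)
    then show "\<forall>\<^sub>F \<gamma> in at_right 0. ?f2 \<gamma> < b / 4" by (rule order_tendstoD(2)) (use be in simp)
    show "\<forall>\<^sub>F \<gamma> in at_right (0::real). 0 < \<gamma>" by (rule eventually_at_right_less)
  qed
  have "\<exists>\<gamma>. \<gamma> < 1 \<and> \<gamma> * (norm x1)\<^sup>2 < \<sigma> \<and> ?f1 \<gamma> < b / 4 \<and> g \<gamma> < 2 * A * \<delta> ^ 3 \<and> ?f2 \<gamma> < b / 4 \<and> 0 < \<gamma>"
    using eventually_happens[OF eventually_conj[OF ev(1) eventually_conj[OF ev(2) eventually_conj[OF ev(3)
        eventually_conj[OF ev(4) eventually_conj[OF ev(5) ev(6)]]]]]] trivial_limit_at_right_real[of 0] by blast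
  then obtain \<gamma> where ga: "\<gamma> < 1" "\<gamma> * (norm x1)\<^sup>2 < \<sigma>" "?f1 \<gamma> < b / 4" "g \<gamma> < 2 * A * \<delta> ^ 3" "?f2 \<gamma> < b / 4" "0 < \<gamma>"
    by blast
  have start: "w1 (x1, t1) + w2 (x1, t1) - penalty A K T \<gamma> \<beta> x1 x1 t1 \<ge> 2 * \<sigma>"
  proof -
    have "penalty A K T \<gamma> \<beta> x1 x1 t1 = \<gamma> * (norm x1)\<^sup>2 + \<sigma>" using t1 by (simp add: penalty_def \<beta>_def)
    moreover have "w1 (x1, t1) + w2 (x1, t1) = 4 * \<sigma>" by (simp add: \<sigma>_def)
    ultimately show ?thesis using ga(2) by linarith
  qed
  obtain x0 y0 t0 where t0: "0 < t0" "t0 < T"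
    and val: "w1 (x0, t0) + w2 (y0, t0) - penalty A K T \<gamma> \<beta> x0 y0 t0 \<ge> 2 * \<sigma>"
    and max: "\<And>x y t. 0 < t \<Longrightarrow> t \<le> T \<Longrightarrow> w1 (x, t) + w2 (y, t) - penalty A K T \<gamma> \<beta> x y t
       \<le> w1 (x0, t0) + w2 (y0, t0) - penalty A K T \<gamma> \<beta> x0 y0 t0"
    using doubling_max[OF c B term' _ t1 start A K ga(6) be(1)] sig by (metis mult_pos_pos zero_less_numeral)
  define q where "q = x0 - y0"
  define \<Lambda> where "\<Lambda> = A * exp (K * (T - t0))"
  have "exp (K * (T - t0)) \<ge> 1" "exp (K * (T - t0)) \<le> exp (K * T)"
    using K t0 by (simp_all add: mult_left_mono)
  then have L: "A \<le> \<Lambda>" "\<Lambda> \<le> \<Lambda>m" unfolding \<Lambda>_def \<Lambda>m_def using A by (simp_all add: mult_left_mono)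
  have Lpos: "\<Lambda> > 0" using L A by simp
  have parts: "0 \<le> \<Lambda> * norm q ^ 4" "0 \<le> \<gamma> / 2 * ((norm x0)\<^sup>2 + (norm y0)\<^sup>2)" "0 < \<beta> / t0"
    using Lpos ga be t0 by simp_all
  have pen: "penalty A K T \<gamma> \<beta> x0 y0 t0 = \<Lambda> * norm q ^ 4 + \<gamma> / 2 * ((norm x0)\<^sup>2 + (norm y0)\<^sup>2) + \<beta> / t0"
    by (simp add: penalty_def \<Lambda>_def q_def)
  have m: "0 \<le> w1 (x0, t0) + w2 (y0, t0)" using val sig parts unfolding pen by linarith
  have mB: "w1 (x0, t0) + w2 (y0, t0) \<le> B" using B(1)[of t0 x0 y0] t0 by simp
  have qB: "\<Lambda> * norm q ^ 4 \<le> B" and xB: "\<gamma> / 2 * ((norm x0)\<^sup>2 + (norm y0)\<^sup>2) \<le> B"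
    using val sig parts mB unfolding pen by linarith+
  have q2: "(norm q)\<^sup>2 \<le> Q2"
  proof -
    have "A * norm q ^ 4 \<le> \<Lambda> * norm q ^ 4" by (rule mult_right_mono[OF L(1)]) simp
    then have "((norm q)\<^sup>2)\<^sup>2 \<le> B / A" using qB A by (simp add: pos_le_divide_eq mult.commute power_mult[symmetric])
    then show ?thesis unfolding Q2_def by (rule real_le_rsqrt)
  qed
  have small: "\<gamma> * norm z \<le> g \<gamma>" if "\<gamma> / 2 * (norm z)\<^sup>2 \<le> B" for z :: "real^'n"
  proof -
    have "(\<gamma> * norm z)\<^sup>2 = 2 * \<gamma> * (\<gamma> / 2 * (norm z)\<^sup>2)" by (simp add: power2_eq_square)
    also have "\<dots> \<le> 2 * \<gamma> * B" by (rule mult_left_mono[OF that]) (use ga in simp)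
    finally show ?thesis unfolding g_def by (intro real_le_rsqrt) (simp add: mult_ac)
  qed
  have "0 \<le> \<gamma> / 2 * (norm x0)\<^sup>2" "0 \<le> \<gamma> / 2 * (norm y0)\<^sup>2" using ga by simp_all
  then have gx: "\<gamma> * norm x0 \<le> g \<gamma>" "\<gamma> * norm y0 \<le> g \<gamma>"
    using xB by (auto intro!: small simp: distrib_left)
  define \<nu>1 where "\<nu>1 = (4 * \<Lambda> * (norm q)\<^sup>2) *\<^sub>R q + \<gamma> *\<^sub>R x0"
  define \<nu>2 where "\<nu>2 = - (4 * \<Lambda> * (norm q)\<^sup>2) *\<^sub>R q + \<gamma> *\<^sub>R y0"
  define \<kappa> where "\<kappa> = 64 * \<Lambda> * (norm q)\<^sup>2 + 4 * \<gamma>"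
  note ineq = doubling_inequality[OF vs lg c r p1 pc max t0 A K ga(6) be(1) eta m,
      folded q_def, folded \<Lambda>_def, folded \<nu>1_def \<nu>2_def \<kappa>_def n_def b_def]
  have ineq1: "b + K * (\<Lambda> * norm q ^ 4) \<le> 3 * \<eta> + 2 * (1 + P) * n * \<kappa> + \<mu> \<bullet> (\<nu>1 + \<nu>2) + 8 * \<gamma> * (1 + P) * n"
    by (rule ineq(1))
  have ineq2: "b + K * (\<Lambda> * norm q ^ 4) \<le> 3 * \<eta> + 2 * \<kappa> * \<eta> * (n + 1) + \<mu> \<bullet> (\<nu>1 + \<nu>2)
       + coupling_cost
          (diffusion_field (sqrt (1 + \<eta>)) (sqrt (p (x0, t0) - 1 + \<eta>) - sqrt (1 + \<eta>)) ((1 / norm \<nu>1) *\<^sub>R \<nu>1))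
          (diffusion_field (sqrt (1 + \<eta>)) (sqrt (p (y0, t0) - 1 + \<eta>) - sqrt (1 + \<eta>)) ((1 / norm \<nu>2) *\<^sub>R (- \<nu>2)))
          (16 * \<Lambda> * (norm q)\<^sup>2) (2 * \<gamma>)" if "\<nu>1 \<noteq> 0" "\<nu>2 \<noteq> 0"
    by (rule ineq(2)) (use that in auto)
  have nusum: "norm (\<nu>1 + \<nu>2) \<le> 2 * g \<gamma>"
  proof -
    have "\<nu>1 + \<nu>2 = \<gamma> *\<^sub>R x0 + \<gamma> *\<^sub>R y0" by (simp add: \<nu>1_def \<nu>2_def)
    then have "norm (\<nu>1 + \<nu>2) \<le> norm (\<gamma> *\<^sub>R x0) + norm (\<gamma> *\<^sub>R y0)" by (simp only: norm_triangle_ineq)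
    then show ?thesis using gx ga by simp
  qed
  have mu: "\<mu> \<bullet> (\<nu>1 + \<nu>2) \<le> 2 * norm \<mu> * g \<gamma>"
  proof -
    have "\<mu> \<bullet> (\<nu>1 + \<nu>2) \<le> norm \<mu> * norm (\<nu>1 + \<nu>2)" by (rule norm_cauchy_schwarz)
    also have "\<dots> \<le> norm \<mu> * (2 * g \<gamma>)" by (rule mult_left_mono[OF nusum]) simp
    finally show ?thesis by simp
  qed
  have Kq: "0 \<le> K * (\<Lambda> * norm q ^ 4)" using K parts by simp
  have Lq: "\<Lambda> * (norm q)\<^sup>2 \<le> \<Lambda>m * Q2" using L(2) q2 Lm by (intro mult_mono) auto
  show False
  proof (cases "norm q < \<delta>")
    case True
    have "\<Lambda> * (norm q)\<^sup>2 \<le> \<Lambda>m * \<delta>\<^sup>2" using L(2) Lm True by (intro mult_mono power_mono) auto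
    then have "\<kappa> \<le> 64 * (\<Lambda>m * \<delta>\<^sup>2) + 4 * \<gamma>" by (simp add: \<kappa>_def)
    then have "2 * (1 + P) * n * \<kappa> \<le> 2 * (1 + P) * n * (64 * (\<Lambda>m * \<delta>\<^sup>2) + 4 * \<gamma>)"
      by (rule mult_left_mono) (use P n in simp)
    also have "\<dots> = b / 4 + 8 * (1 + P) * n * \<gamma>" unfolding del2[symmetric] by (simp add: algebra_simps)
    finally have "b \<le> b / 4 + (b / 4 + 8 * (1 + P) * n * \<gamma>) + 2 * norm \<mu> * g \<gamma> + 8 * \<gamma> * (1 + P) * n"
      using ineq1 Kq eta2(2) mu by linarith
    also have "\<dots> = b / 2 + ?f1 \<gamma>" by (simp add: algebra_simps)
    finally show False using ga(3) be by linarith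
  next
    case False
    then have qd: "\<delta> \<le> norm q" by simp
    have "A * \<delta> ^ 3 \<le> \<Lambda> * norm q ^ 3" using L A qd del by (intro mult_mono power_mono) auto
    then have "4 * A * \<delta> ^ 3 \<le> norm ((4 * \<Lambda> * (norm q)\<^sup>2) *\<^sub>R q)"
      using Lpos by (simp add: power2_eq_square power3_eq_cube)
    moreover have "norm ((4 * \<Lambda> * (norm q)\<^sup>2) *\<^sub>R q) \<le> norm \<nu>1 + norm (\<gamma> *\<^sub>R x0)"
      using norm_triangle_ineq4[of \<nu>1 "\<gamma> *\<^sub>R x0"] by (simp add: \<nu>1_def)
    moreover have "norm ((4 * \<Lambda> * (norm q)\<^sup>2) *\<^sub>R q) \<le> norm \<nu>2 + norm (\<gamma> *\<^sub>R y0)"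
      using norm_triangle_ineq4[of "\<gamma> *\<^sub>R y0" \<nu>2] by (simp add: \<nu>2_def)
    moreover have "norm (\<gamma> *\<^sub>R x0) \<le> g \<gamma>" "norm (\<gamma> *\<^sub>R y0) \<le> g \<gamma>" using gx ga by simp_all
    ultimately have big: "2 * A * \<delta> ^ 3 \<le> norm \<nu>1" "2 * A * \<delta> ^ 3 \<le> norm \<nu>2" using ga(4) by linarith+
    have "0 < A * \<delta> ^ 3" using A del by simp
    then have nz: "\<nu>1 \<noteq> 0" "\<nu>2 \<noteq> 0" using big by auto
    let ?e = "(1 / norm \<nu>1) *\<^sub>R \<nu>1" and ?f = "(1 / norm \<nu>2) *\<^sub>R (- \<nu>2)"
    have unit: "norm ?e = 1" "norm ?f = 1" using nz by simp_all
    have "norm (?e - ?f) \<le> 2 * norm (\<nu>1 + \<nu>2) / norm \<nu>2"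
      using norm_unit_diff[of "- \<nu>2" \<nu>1] nz by simp
    also have "\<dots> \<le> 2 * (2 * g \<gamma>) / (2 * A * \<delta> ^ 3)"
      using nusum big \<open>0 < A * \<delta> ^ 3\<close> order_trans[OF norm_ge_zero nusum] by (intro frac_le) auto
    also have "\<dots> = 2 * g \<gamma> / (A * \<delta> ^ 3)" by simp
    finally have ef: "(norm (?e - ?f))\<^sup>2 \<le> (2 * g \<gamma> / (A * \<delta> ^ 3))\<^sup>2" by (rule power_mono) simp
    define s where "s z = sqrt (p z - 1 + \<eta>) - sqrt (1 + \<eta>)" for z
    have zc: "(x0, t0) \<in> closed_cyl T" "(y0, t0) \<in> closed_cyl T" using t0 by auto
    have sS: "(s z)\<^sup>2 \<le> S" if "z \<in> closed_cyl T" for z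
    proof -
      have "(s z)\<^sup>2 \<le> 2 * (sqrt (p z - 1 + \<eta>))\<^sup>2 + 2 * (sqrt (1 + \<eta>))\<^sup>2"
        unfolding s_def using norm_diff_sq_le[of "sqrt (p z - 1 + \<eta>)" "sqrt (1 + \<eta>)"] by simp
      also have "\<dots> = 2 * (p z - 1 + \<eta>) + 2 * (1 + \<eta>)" using p1[OF that] eta by simp
      also have "\<dots> \<le> S" using p1[OF that] eta2(1) by (simp add: S_def)
      finally show ?thesis .
    qed
    have sdiff: "(s (x0, t0) - s (y0, t0))\<^sup>2 \<le> L\<^sup>2 * (norm q)\<^sup>2 / (4 * (pmin - 1))"
    proof -
      have "(s (x0, t0) - s (y0, t0))\<^sup>2 = (sqrt (p (x0, t0) - 1 + \<eta>) - sqrt (p (y0, t0) - 1 + \<eta>))\<^sup>2"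
        by (simp add: s_def)
      also have "\<dots> \<le> ((p (x0, t0) - 1 + \<eta>) - (p (y0, t0) - 1 + \<eta>))\<^sup>2 / (4 * (pmin - 1))"
        using p[OF zc(1)] p[OF zc(2)] pmin eta by (intro sqrt_diff_sq_le) auto
      also have "((p (x0, t0) - 1 + \<eta>) - (p (y0, t0) - 1 + \<eta>))\<^sup>2 = \<bar>p (x0, t0) - p (y0, t0)\<bar>\<^sup>2" by simp
      also have "\<dots> / (4 * (pmin - 1)) \<le> (L * norm q)\<^sup>2 / (4 * (pmin - 1))"
        using pL[of t0 x0 y0] t0 pmin unfolding q_def by (intro divide_right_mono power_mono) auto
      finally show ?thesis by (simp add: power_mult_distrib)
    qed
    have al: "16 * \<Lambda> * (norm q)\<^sup>2 \<ge> 0" "16 * \<Lambda> * (norm q)\<^sup>2 \<le> \<alpha>m"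
      using Lpos Lq by (simp_all add: \<alpha>m_def)
    have S0: "S \<ge> 0" using P by (simp add: S_def)
    have gg: "2 * \<gamma> \<ge> 0" using ga by simp
    have l2: "(sqrt (1 + \<eta>))\<^sup>2 \<le> 2" using eta eta2 by simp
    have "n * (4 * (16 * \<Lambda> * (norm q)\<^sup>2) * (s (x0, t0) - s (y0, t0))\<^sup>2)
       \<le> n * (4 * (16 * \<Lambda> * (norm q)\<^sup>2) * (L\<^sup>2 * (norm q)\<^sup>2 / (4 * (pmin - 1))))"
      using sdiff al n by (intro mult_left_mono) auto
    also have "\<dots> = K * (\<Lambda> * norm q ^ 4)"
      using pmin by (simp add: K_def field_simps power2_eq_square power4_eq_xxxx)
    finally have c1: "n * (4 * (16 * \<Lambda> * (norm q)\<^sup>2) * (s (x0, t0) - s (y0, t0))\<^sup>2) \<le> K * (\<Lambda> * norm q ^ 4)" .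
    have c2: "16 * (16 * \<Lambda> * (norm q)\<^sup>2) * S * (norm (?e - ?f))\<^sup>2 \<le> 16 * \<alpha>m * S * (2 * g \<gamma> / (A * \<delta> ^ 3))\<^sup>2"
      using al S0 ef by (intro mult_mono) auto
    have cost: "coupling_cost (diffusion_field (sqrt (1 + \<eta>)) (s (x0, t0)) ?e)
        (diffusion_field (sqrt (1 + \<eta>)) (s (y0, t0)) ?f) (16 * \<Lambda> * (norm q)\<^sup>2) (2 * \<gamma>)
      \<le> K * (\<Lambda> * norm q ^ 4) + n * (16 * \<alpha>m * S * (2 * g \<gamma> / (A * \<delta> ^ 3))\<^sup>2 + 2 * (2 * \<gamma>) * (8 + 4 * S))"
    proof -
      have "coupling_cost (diffusion_field (sqrt (1 + \<eta>)) (s (x0, t0)) ?e)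
        (diffusion_field (sqrt (1 + \<eta>)) (s (y0, t0)) ?f) (16 * \<Lambda> * (norm q)\<^sup>2) (2 * \<gamma>)
       \<le> n * (4 * (16 * \<Lambda> * (norm q)\<^sup>2) * (s (x0, t0) - s (y0, t0))\<^sup>2
          + 16 * (16 * \<Lambda> * (norm q)\<^sup>2) * S * (norm (?e - ?f))\<^sup>2 + 2 * (2 * \<gamma>) * (8 + 4 * S))"
        unfolding n_def by (rule coupling_cost_diffusion_le[OF unit al(1) gg sS[OF zc(1)] sS[OF zc(2)] l2])
      also have "\<dots> = n * (4 * (16 * \<Lambda> * (norm q)\<^sup>2) * (s (x0, t0) - s (y0, t0))\<^sup>2)
          + n * (16 * (16 * \<Lambda> * (norm q)\<^sup>2) * S * (norm (?e - ?f))\<^sup>2 + 2 * (2 * \<gamma>) * (8 + 4 * S))"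
        by (simp only: distrib_left add.assoc)
      also have "\<dots> \<le> K * (\<Lambda> * norm q ^ 4) + n * (16 * \<alpha>m * S * (2 * g \<gamma> / (A * \<delta> ^ 3))\<^sup>2 + 2 * (2 * \<gamma>) * (8 + 4 * S))"
        by (intro add_mono[OF c1] mult_left_mono add_right_mono c2) (use n in simp)
      finally show ?thesis .
    qed
    have "\<kappa> \<le> \<kappa>m" using Lq ga(1) by (simp add: \<kappa>_def \<kappa>m_def)
    then have "2 * \<kappa> * \<eta> * (n + 1) \<le> 2 * \<kappa>m * \<eta> * (n + 1)" using eta n by (intro mult_right_mono mult_left_mono) auto
    then have "b \<le> b / 4 + b / 4 + ?f2 \<gamma>"
      using ineq2[OF nz, folded s_def] cost mu eta2 by linarith
    then show False using ga(5) be by linarith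
  qed
qed

section \<open>Uniqueness\<close>

lemma semicontinuous_imp_continuous_on:
  assumes "lsc_on S u" "usc_on S u" shows "continuous_on S u"
  unfolding continuous_on_def
proof
  fix z assume "z \<in> S"
  then show "(u \<longlongrightarrow> u z) (at z within S)"
    using assms by (auto intro!: order_tendstoI simp: lsc_on_def usc_on_def)
qed

lemma linear_growth_uminus: "linear_growth T u \<Longrightarrow> linear_growth T (\<lambda>z. - u z)"
  by (simp add: linear_growth_def)

text \<open>Comparison on \<open>(0, T]\<close> extends to \<open>t = 0\<close> by continuity.\<close>

lemma solution_le:
  fixes T r pmin pmax :: real
    and \<mu> :: "real^'n::finite"
    and p :: "(real^'n) \<times> real \<Rightarrow> real"
    and g :: "real^'n \<Rightarrow> real"
    and u v :: "(real^'n) \<times> real \<Rightarrow> real"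
  assumes T: "T > 0" and r: "r \<ge> 0" and pmin: "1 < pmin"
    and pl: "L-lipschitz_on (closed_cyl T) p" and p: "\<forall>z \<in> closed_cyl T. p z \<in> {pmin..pmax}"
    and g: "\<forall>x. g x > 0" "\<And>x. g x \<le> G" "Lg-lipschitz_on UNIV g"
    and u: "visc_solution T (pLap_F p \<mu> r) g u" and v: "visc_solution T (pLap_F p \<mu> r) g v"
    and t: "t \<in> {0..T}"
  shows "u (x, t) \<le> v (x, t)"
proof -
  have us: "lsc_on (closed_cyl T) u" "usc_on (closed_cyl T) u" "linear_growth T u" "\<And>x. u (x, T) = g x"
    and vs: "lsc_on (closed_cyl T) v" "usc_on (closed_cyl T) v" "linear_growth T v" "\<And>x. v (x, T) = g x"
    using u v unfolding visc_solution_def visc_supersolution_def visc_subsolution_def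
    by (auto intro: antisym)
  have cu: "continuous_on (closed_cyl T) u" and cv: "continuous_on (closed_cyl T) v"
    using us vs by (auto intro: semicontinuous_imp_continuous_on)
  have cv': "continuous_on (closed_cyl T) (\<lambda>z. - v z)" using cv by (intro continuous_intros)
  have su: "viscosity_sub T (pLap_F p \<mu> r) u"
    using u visc_subsolution_imp_sub unfolding visc_solution_def by blast
  have sv: "viscosity_sub T (pLap_F p \<mu> r) (\<lambda>z. - v z)"
    using v visc_supersolution_imp_sub unfolding visc_solution_def by blast
  have lv: "linear_growth T (\<lambda>z. - v z)" by (rule linear_growth_uminus[OF vs(3)])
  have p1: "p z \<in> {1..pmax}" if "z \<in> closed_cyl T" for z using bspec[OF p that] pmin by auto
  have G: "G \<ge> 0" using g(1,2) by (meson less_imp_le order_trans)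
  have uG: "u (y, s) \<le> G" if "0 < s" "s \<le> T" for y s
    by (rule viscosity_sub_bounded_above[OF su us(3) cu r p1 _ G that]) (simp_all add: us g)
  have v0: "- v (y, s) \<le> 0" if "0 < s" "s \<le> T" for y s
    by (rule viscosity_sub_bounded_above[OF sv lv cv' r p1 _ order_refl that]) (simp_all add: vs g less_imp_le)
  have pL: "\<bar>p (y, s) - p (z, s)\<bar> \<le> L * norm (y - z)" if "0 \<le> s" "s \<le> T" for y z s
    using lipschitz_onD[OF pl, of "(y, s)" "(z, s)"] that by (simp add: dist_Pair_Pair dist_norm dist_real_def)
  have gL: "g y - g z \<le> Lg * norm (y - z)" for y z
    using lipschitz_onD[OF g(3), of y z] by (simp add: dist_norm dist_real_def)
  have le: "u (y, s) \<le> v (y, s)" if s: "0 < s" "s \<le> T" for y s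
  proof -
    have "u (y, s) + - v (y, s) \<le> 0"
    proof (rule parabolic_comparison[OF su sv us(3) lv cu cv' r _ pmin _ pL _ G _ s])
      show "continuous_on (closed_cyl T) p" by (rule lipschitz_on_continuous_on[OF pl])
      show "u (x, s) + - v (z, s) \<le> G" if "0 < s" "s \<le> T" for x z s
        using uG[OF that, of x] v0[OF that, of z] by simp
      show "u (x, T) + - v (z, T) \<le> Lg * norm (x - z)" for x z using gL[of x z] by (simp add: us vs)
    qed (use p in auto)
    then show ?thesis by simp
  qed
  show ?thesis
  proof (cases "t = 0")
    case False
    then show ?thesis using le t by simp
  next
    case True
    have tend: "((\<lambda>s. f (x, s)) \<longlongrightarrow> f (x, 0)) (at_right 0)" if "continuous_on (closed_cyl T) f"
      for f :: "(real^'n) \<times> real \<Rightarrow> real"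
    proof -
      have "continuous_on {0..T} (\<lambda>s. f (x, s))"
        by (rule continuous_on_compose2[OF that]) (auto intro!: continuous_intros)
      then have "((\<lambda>s. f (x, s)) \<longlongrightarrow> f (x, 0)) (at 0 within {0..T})"
        using T by (simp add: continuous_on_def)
      then show ?thesis using at_within_Icc_at_right[OF T] by simp
    qed
    have "\<forall>\<^sub>F s in at_right 0. u (x, s) \<le> v (x, s)"
      unfolding eventually_at_right_field using le T by (intro exI[of _ T]) auto
    then show ?thesis unfolding True
      by (rule tendsto_le[OF trivial_limit_at_right_real tend[OF cv] tend[OF cu]])
  qed
qed

theorem theorem1p4:
  fixes T r pmin pmax :: real
    and \<mu> :: "real^'n::finite"
    and p :: "(real^'n) \<times> real \<Rightarrow> real"
    and g :: "real^'n \<Rightarrow> real"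
    and u v :: "(real^'n) \<times> real \<Rightarrow> real"
  assumes "CARD('n) \<ge> 2" and "T > 0" and "r \<ge> 0"
    and "1 < pmin" and "pmin \<le> pmax"
    and "\<exists>L. L-lipschitz_on (closed_cyl T) p"
    and "\<forall>z \<in> closed_cyl T. p z \<in> {pmin..pmax}"
    and "\<forall>x. g x > 0" and "bounded (range g)" and "\<exists>L. L-lipschitz_on UNIV g"
    and "visc_solution T (pLap_F p \<mu> r) g u" and "linear_growth T u"
    and "visc_solution T (pLap_F p \<mu> r) g v" and "linear_growth T v"
  shows "\<forall>x. \<forall>t \<in> {0..T}. u (x, t) = v (x, t)"
proof (intro allI ballI antisym)
  obtain L Lg where L: "L-lipschitz_on (closed_cyl T) p" "Lg-lipschitz_on UNIV g" using assms by blast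
  obtain G where "\<And>x. norm (g x) \<le> G" using assms(9) unfolding bounded_iff by blast
  then have G: "g x \<le> G" for x by (metis abs_le_D1 real_norm_def)
  fix x t assume t: "t \<in> {0..T}"
  show "u (x, t) \<le> v (x, t)"
    by (rule solution_le[OF assms(2,3,4) L(1) assms(7,8) G L(2) assms(11,13) t])
  show "v (x, t) \<le> u (x, t)"
    by (rule solution_le[OF assms(2,3,4) L(1) assms(7,8) G L(2) assms(13,11) t])
qed

end
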